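(* Let $d\ge 2$ and let $k,\ell\ge 2$ be relatively prime integers, and set $r_0=z^k+t^\ell$. For $g\in\mathbb{C}[x,z,t]$ let $X(g)\subset\mathbb{A}^4=\mathrm{Spec}(\mathbb{C}[x,y,z,t])$ be the hypersurface defined by $x^dy+r_0(z,t)+xg(x,z,t)=0$. Let $B$, $\mathfrak{m}_0$, $g_\alpha$ and $\mathfrak{X}_\alpha=X(g_\alpha)$ be as defined in the context, for $\mathbb{C}$-algebra homomorphisms $\alpha:B\to\mathbb{C}[x]$ with $\alpha(\mathfrak{m}_0)\subset x\mathbb{C}[x]$. Then: (1) For every $g\in\mathbb{C}[x,z,t]$, there exists a homomorphism $\alpha:B\to\mathbb{C}[x]$ with $\alpha(\mathfrak{m}_0)\subset x\mathbb{C}[x]$ such that $X(g)$ is isomorphic to $\mathfrak{X}_\alpha$. (2) Two homomorphisms $\alpha,\beta:B\to\mathbb{C}[x]$ with $\alpha(\mathfrak{m}_0)\subset x\mathbb{C}[x]$ and $\beta(\mathfrak{m}_0)\subset x\mathbb{C}[x]$ determine isomorphic threefolds $\mathfrak{X}_\alpha$ and $\mathfrak{X}_\beta$ if and only if there exist constants $\lambda,\mu\in\mathbb{C}^*$ such that $$m_\mu\circ\pi_d\circ\alpha=\pi_d\circ\beta\circ\zeta_\lambda$$ as homomorphisms $B\to\mathbb{C}[x]/(x^d)$, where $\pi_d:\mathbb{C}[x]\to\mathbb{C}[x]/(x^d)$ is the natural projection, $m_\mu$ is the automorphism of $\mathbb{C}[x]/(x^d)$ given by $x\mapsto\mu x$,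 and $\zeta_\lambda:B\to B$ is the linear automorphism defined by $a_{i,j}\mapsto\lambda^{\ell i+kj-k\ell}a_{i,j}$.
   Context: All varieties are over $\mathbb{C}$ and isomorphisms are isomorphisms of algebraic varieties (schemes) over $\mathbb{C}$. $B=\mathbb{C}[a_{i,j}]$ is the polynomial ring in the $(k-1)(\ell-1)$ indeterminates $a_{i,j}$, $0\le i\le k-2$, $0\le j\le\ell-2$, and $\mathfrak{m}_0\subset B$ is the maximal ideal generated by all the $a_{i,j}$. Put $$F=r_0+\sum_{0\le i\le k-2,\ 0\le j\le\ell-2}a_{i,j}z^it^j\in B[z,t].$$ Given a $\mathbb{C}$-algebra homomorphism $\alpha:B\to\mathbb{C}[x]$ with $\alpha(\mathfrak{m}_0)\subset x\mathbb{C}[x]$, the image of $F$ in $\mathbb{C}[x]\otimes_BB[z,t]\simeq\mathbb{C}[x,z,t]$ has the form $r_0+xg_\alpha$, where $g_\alpha=\sum_{i,j}x^{-1}\alpha(a_{i,j})z^it^j\in\mathbb{C}[x,z,t]$. The threefold $\mathfrak{X}_\alpha=X(g_\alpha)$ is the hypersurface of $\mathbb{A}^4$ with equation $x^dy+r_0+xg_\alpha=0$. For these hypersurfaces $X(g)$, the paper uses the following facts (obtained by known methods): the Derksen invariant of $X(g)$ (the subalgebra of its coordinate ring generated by the regular functions invariant under at least one nontrivial action of the additive group $\mathbb{G}_a$ on $X(g)$) equals $\mathbb{C}[x,z,t]$, and the Makar-Limanov invariant of $X(g)$ (the subalgebra of regular functions invariant under all $\mathbb{G}_a$-actions) equals $\mathbb{C}[x]$.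 *)

theory Defs
  imports "HOL-Library.Poly_Mapping" "HOL-Computational_Algebra.Polynomial"
begin

section \<open>Affine four-space and its closed subvarieties\<close>

text \<open>
  A point of \<open>\<bbbA>\<^sup>4\<close> is a tuple \<open>(x, y, z, t)\<close>. Rings of polynomials in several
  variables are iterated univariate ones, with the last variable outermost:
  \<open>\<complex>[x,y,z,t] = \<complex>[x][y][z][t]\<close> and \<open>\<complex>[x,z,t] = \<complex>[x][z][t]\<close>.
\<close>

type_synonym A4 = "complex \<times> complex \<times> complex \<times> complex"
type_synonym poly_xyzt = "complex poly poly poly poly"
type_synonym poly_xzt = "complex poly poly poly"

fun eval_xyzt :: "poly_xyzt \<Rightarrow> A4 \<Rightarrow> complex" where
  "eval_xyzt p (x, y, z, t) = poly (poly (poly (poly p [:[:[:t:]:]:]) [:[:z:]:]) [:y:]) x"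

fun eval_xzt :: "poly_xzt \<Rightarrow> complex \<times> complex \<times> complex \<Rightarrow> complex" where
  "eval_xzt p (x, z, t) = poly (poly (poly p [:[:t:]:]) [:z:]) x"

text \<open>
  Morphisms between closed subvarieties of \<open>\<bbbA>\<^sup>4\<close> are the maps given by polynomials
  in the coordinates.
\<close>

definition regular_map :: "A4 set \<Rightarrow> A4 set \<Rightarrow> (A4 \<Rightarrow> A4) \<Rightarrow> bool" where
  "regular_map V W \<phi> \<longleftrightarrow>
     (\<forall>v\<in>V. \<phi> v \<in> W) \<and>
     (\<exists>P Q R S. \<forall>v\<in>V. \<phi> v = (eval_xyzt P v, eval_xyzt Q v, eval_xyzt R v, eval_xyzt S v))"

definition isomorphic_varieties :: "A4 set \<Rightarrow> A4 set \<Rightarrow> bool" where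
  "isomorphic_varieties V W \<longleftrightarrow>
     (\<exists>\<phi> \<psi>. regular_map V W \<phi> \<and> regular_map W V \<psi> \<and>
            (\<forall>v\<in>V. \<psi> (\<phi> v) = v) \<and> (\<forall>w\<in>W. \<phi> (\<psi> w) = w))"

text \<open>
  The defining polynomial \<open>x\<^sup>d y + r\<^sub>0 + x g\<close> has degree one in \<open>y\<close> with coprime
  coefficients, hence is irreducible, so the hypersurface is determined by its points.
\<close>

definition hypersurface :: "nat \<Rightarrow> nat \<Rightarrow> nat \<Rightarrow> poly_xzt \<Rightarrow> A4 set" where
  "hypersurface d k l g =
     {(x, y, z, t). x ^ d * y + (z ^ k + t ^ l) + x * eval_xzt g (x, z, t) = 0}"


section \<open>The algebra \<open>B\<close> and the threefolds attached to its \<open>\<complex>[x]\<close>-points\<close>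

text \<open>
  The type below is the polynomial ring in indeterminates \<open>a\<^sub>i\<^sub>,\<^sub>j\<close> for all
  \<open>(i, j) \<in> \<nat>\<^sup>2\<close>; \<open>B\<close> is its subalgebra of polynomials in the \<open>(k-1)(l-1)\<close>
  indeterminates indexed by \<open>idx k l\<close>.
\<close>

type_synonym poly_a = "((nat \<times> nat) \<Rightarrow>\<^sub>0 nat) \<Rightarrow>\<^sub>0 complex"

definition idx :: "nat \<Rightarrow> nat \<Rightarrow> (nat \<times> nat) set" where
  "idx k l = {0..k - 2} \<times> {0..l - 2}"

definition const_a :: "complex \<Rightarrow> poly_a" where
  "const_a c = Poly_Mapping.single 0 c"

definition var_a :: "nat \<times> nat \<Rightarrow> poly_a" where
  "var_a v = Poly_Mapping.single (Poly_Mapping.single v 1) 1"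

definition B :: "nat \<Rightarrow> nat \<Rightarrow> poly_a set" where
  "B k l = {b. \<forall>m \<in> Poly_Mapping.keys b. Poly_Mapping.keys m \<subseteq> idx k l}"

definition m0 :: "nat \<Rightarrow> nat \<Rightarrow> poly_a set" where
  "m0 k l = {\<Sum>v\<in>idx k l. q v * var_a v | q. \<forall>v\<in>idx k l. q v \<in> B k l}"

definition alg_hom_B :: "nat \<Rightarrow> nat \<Rightarrow> (poly_a \<Rightarrow> complex poly) \<Rightarrow> bool" where
  "alg_hom_B k l \<alpha> \<longleftrightarrow>
     (\<forall>c. \<alpha> (const_a c) = [:c:]) \<and>
     (\<forall>p\<in>B k l. \<forall>q\<in>B k l. \<alpha> (p + q) = \<alpha> p + \<alpha> q \<and> \<alpha> (p * q) = \<alpha> p * \<alpha> q)"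

definition centered_hom :: "nat \<Rightarrow> nat \<Rightarrow> (poly_a \<Rightarrow> complex poly) \<Rightarrow> bool" where
  "centered_hom k l \<alpha> \<longleftrightarrow>
     alg_hom_B k l \<alpha> \<and> \<alpha> ` m0 k l \<subseteq> {p. [:0, 1:] dvd p}"

text \<open>\<open>r0\<close> is used both over \<open>B\<close> and over \<open>\<complex>[x]\<close>; \<open>F \<in> B[z][t]\<close>.\<close>

definition r0 :: "nat \<Rightarrow> nat \<Rightarrow> 'a::comm_ring_1 poly poly" where
  "r0 k l = monom (monom 1 k) 0 + monom (monom 1 0) l"

definition F :: "nat \<Rightarrow> nat \<Rightarrow> poly_a poly poly" where
  "F k l = r0 k l + (\<Sum>(i, j)\<in>idx k l. monom (monom (var_a (i, j)) i) j)"

definition g_of :: "nat \<Rightarrow> nat \<Rightarrow> (poly_a \<Rightarrow> complex poly) \<Rightarrow> poly_xzt" where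
  "g_of k l \<alpha> = (\<Sum>(i, j)\<in>idx k l. monom (monom (\<alpha> (var_a (i, j)) div [:0, 1:]) i) j)"

definition threefold :: "nat \<Rightarrow> nat \<Rightarrow> nat \<Rightarrow> (poly_a \<Rightarrow> complex poly) \<Rightarrow> A4 set" where
  "threefold d k l \<alpha> = hypersurface d k l (g_of k l \<alpha>)"

text \<open>
  The algebra endomorphism \<open>a\<^sub>v \<mapsto> s v\<close>, and \<open>\<zeta>\<^sub>\<lambda>\<close> as a special case. The exponents
  \<open>l i + k j - k l\<close> may be negative.
\<close>

definition subst_a :: "(nat \<times> nat \<Rightarrow> poly_a) \<Rightarrow> poly_a \<Rightarrow> poly_a" where
  "subst_a s b = (\<Sum>m\<in>Poly_Mapping.keys b. const_a (Poly_Mapping.lookup b m) *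
                   (\<Prod>v\<in>Poly_Mapping.keys m. s v ^ Poly_Mapping.lookup m v))"

definition zeta :: "nat \<Rightarrow> nat \<Rightarrow> complex \<Rightarrow> poly_a \<Rightarrow> poly_a" where
  "zeta k l lam = subst_a (\<lambda>(i, j).
     const_a (lam powi (int l * int i + int k * int j - int k * int l)) * var_a (i, j))"


section \<open>The quotient \<open>\<complex>[x]/(x\<^sup>d)\<close>\<close>

text \<open>Elements of the quotient are cosets of the ideal \<open>(x\<^sup>d)\<close>.\<close>

definition proj_trunc :: "nat \<Rightarrow> complex poly \<Rightarrow> complex poly set" where
  "proj_trunc d p = {q. monom 1 d dvd (q - p)}"

definition scale_trunc :: "complex \<Rightarrow> complex poly set \<Rightarrow> complex poly set" where
  "scale_trunc \<mu> S = (\<lambda>p. pcompose p [:0, \<mu>:]) ` S"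


section \<open>Consistency checks\<close>

lemma eval_xyzt_monomial:
  "eval_xyzt (monom (monom (monom p n) i) j) (x, y, z, t) = poly p x * y ^ n * z ^ i * t ^ j"
  by (simp add: poly_monom)

lemma eval_xzt_monomial:
  "eval_xzt (monom (monom p i) j) (x, z, t) = poly p x * z ^ i * t ^ j"
  by (simp add: poly_monom)

lemma finite_idx: "finite (idx k l)"
  by (simp add: idx_def)

lemma const_a_in_B: "const_a c \<in> B k l"
  by (auto simp: const_a_def B_def)

lemma var_a_in_B: "v \<in> idx k l \<Longrightarrow> var_a v \<in> B k l"
  by (auto simp: var_a_def B_def)

lemma var_a_in_m0:
  assumes "v \<in> idx k l"
  shows "var_a v \<in> m0 k l"
proof -
  let ?q = "\<lambda>w. if w = v then const_a 1 else const_a 0"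
  have "(\<Sum>w\<in>idx k l. ?q w * var_a w) = (\<Sum>w\<in>idx k l. if w = v then var_a w else 0)"
    by (rule sum.cong) (auto simp: const_a_def)
  also have "\<dots> = var_a v"
    using assms finite_idx by simp
  finally have "var_a v = (\<Sum>w\<in>idx k l. ?q w * var_a w)" ..
  moreover have "\<forall>w\<in>idx k l. ?q w \<in> B k l"
    by (simp add: const_a_in_B)
  ultimately show ?thesis
    unfolding m0_def mem_Collect_eq by (intro exI[of _ ?q] conjI)
qed

text \<open>The image of \<open>F\<close> in \<open>\<complex>[x] \<otimes>\<^sub>B B[z,t] = \<complex>[x,z,t]\<close> is \<open>r\<^sub>0 + x g\<^sub>\<alpha>\<close>.\<close>

lemma image_F:
  assumes "centered_hom k l \<alpha>"
  shows "map_poly (map_poly \<alpha>) (F k l) = r0 k l + [:[:[:0, 1:]:]:] * g_of k l \<alpha>"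
proof (rule poly_eqI, rule poly_eqI)
  fix j i
  have const: "\<alpha> (const_a c) = [:c:]" for c
    using assms by (simp add: centered_hom_def alg_hom_B_def)
  have add: "\<alpha> (p + q) = \<alpha> p + \<alpha> q" if "p \<in> B k l" "q \<in> B k l" for p q
    using assms that by (simp add: centered_hom_def alg_hom_B_def)
  have zero: "\<alpha> 0 = 0"
    using const[of 0] by (simp add: const_a_def)
  have coeff_sum_idx:
    "coeff (coeff (\<Sum>(i, j)\<in>idx k l. monom (monom (f (i, j)) i) j) j) i
       = (if (i, j) \<in> idx k l then f (i, j) else 0)" for f :: "nat \<times> nat \<Rightarrow> 'b::comm_ring_1"
  proof -
    have "coeff (coeff (\<Sum>(i, j)\<in>idx k l. monom (monom (f (i, j)) i) j) j) i
            = (\<Sum>v\<in>idx k l. if v = (i, j) then f v else 0)"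
      unfolding coeff_sum by (rule sum.cong) (auto split: if_splits)
    then show ?thesis
      using finite_idx by simp
  qed
  define c :: complex where "c = (if j = 0 \<and> i = k then 1 else 0) + (if j = l \<and> i = 0 then 1 else 0)"
  have "coeff (coeff (r0 k l :: poly_a poly poly) j) i = const_a c"
    by (auto simp: r0_def c_def const_a_def single_add)
  then have F: "coeff (coeff (F k l) j) i
                  = const_a c + (if (i, j) \<in> idx k l then var_a (i, j) else 0)"
    by (simp only: F_def coeff_add coeff_sum_idx)
  have r0: "coeff (coeff (r0 k l :: poly_xzt) j) i = [:c:]"
    by (auto simp: r0_def c_def one_pCons)
  have dvd: "[:0, 1:] dvd \<alpha> (var_a v)" if "v \<in> idx k l" for v
    using assms var_a_in_m0[OF that] by (auto simp: centered_hom_def)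
  have g: "coeff (coeff (g_of k l \<alpha>) j) i
             = (if (i, j) \<in> idx k l then \<alpha> (var_a (i, j)) div [:0, 1:] else 0)"
    unfolding g_of_def by (rule coeff_sum_idx[of "\<lambda>v. \<alpha> (var_a v) div [:0, 1:]"])
  have "coeff (coeff (map_poly (map_poly \<alpha>) (F k l)) j) i = \<alpha> (coeff (coeff (F k l) j) i)"
    by (simp add: coeff_map_poly zero)
  also have "\<dots> = [:c:] + (if (i, j) \<in> idx k l then \<alpha> (var_a (i, j)) else 0)"
    by (simp add: F add const const_a_in_B var_a_in_B)
  also have "\<dots> = [:c:] + [:0, 1:] * coeff (coeff (g_of k l \<alpha>) j) i"
    unfolding g using dvd by (cases "(i, j) \<in> idx k l") (simp_all only: if_True if_False dvd_mult_div_cancel mult_zero_right)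
  also have "\<dots> = coeff (coeff (r0 k l + [:[:[:0, 1:]:]:] * g_of k l \<alpha>) j) i"
    using r0 by (simp only: coeff_add) simp
  finally show "coeff (coeff (map_poly (map_poly \<alpha>) (F k l)) j) i
                  = coeff (coeff (r0 k l + [:[:[:0, 1:]:]:] * g_of k l \<alpha>) j) i" .
qed

lemma zeta_var_a:
  "zeta k l lam (var_a (i, j)) =
     const_a (lam powi (int l * int i + int k * int j - int k * int l)) * var_a (i, j)"
  by (simp add: zeta_def subst_a_def var_a_def const_a_def)

lemma scale_proj_trunc:
  assumes "\<mu> \<noteq> 0"
  shows "scale_trunc \<mu> (proj_trunc d p) = proj_trunc d (pcompose p [:0, \<mu>:])"
proof -
  have monom: "pcompose (monom 1 d) [:0, c:] = smult (c ^ d) (monom 1 d)" for c :: complex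
    by (induction d) (simp_all add: monom_0 monom_Suc pcompose_pCons pcompose_1 mult.commute)
  have dvd: "monom 1 d dvd pcompose q [:0, c:]" if "monom 1 d dvd q" for q and c :: complex
  proof -
    from that obtain r where "q = monom 1 d * r" ..
    then show ?thesis by (simp add: pcompose_mult monom dvd_smult)
  qed
  have inv: "pcompose (pcompose q [:0, inverse \<mu>:]) [:0, \<mu>:] = q"
    "pcompose (pcompose q [:0, \<mu>:]) [:0, inverse \<mu>:] = q" for q
    using assms by (simp_all add: pcompose_assoc [symmetric] pcompose_pCons)
  show ?thesis
  proof
    show "scale_trunc \<mu> (proj_trunc d p) \<subseteq> proj_trunc d (pcompose p [:0, \<mu>:])"
      unfolding scale_trunc_def proj_trunc_def using dvd by (auto simp: pcompose_diff [symmetric])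
    show "proj_trunc d (pcompose p [:0, \<mu>:]) \<subseteq> scale_trunc \<mu> (proj_trunc d p)"
    proof
      fix q assume "q \<in> proj_trunc d (pcompose p [:0, \<mu>:])"
      then have "monom 1 d dvd q - pcompose p [:0, \<mu>:]"
        by (simp add: proj_trunc_def)
      from dvd[OF this, of "inverse \<mu>"] have "pcompose q [:0, inverse \<mu>:] \<in> proj_trunc d p"
        by (simp add: pcompose_diff inv proj_trunc_def)
      then show "q \<in> scale_trunc \<mu> (proj_trunc d p)"
        unfolding scale_trunc_def using inv(1)[of q] by (metis image_eqI)
    qed
  qed
qed

end

theory Submission
  imports Defs "HOL-Computational_Algebra.Computational_Algebra"
begin

text \<open>
  Let \<open>A\<close> be the coordinate ring of \<open>x\<^sup>d y + F = 0\<close>, with \<open>F\<close> congruent to \<open>r = z\<^sup>k + t\<^sup>l\<close> modulo \<open>x\<close>.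
  A nonzero locally nilpotent derivation of \<open>A\<close> has a nonzero, locally nilpotent leading part on the
  graded ring of the \<open>x\<close>-adic filtration, and an argument of Mason--Stothers type for \<open>z\<^sup>k + t\<^sup>l\<close>
  restricts these leading parts so much that the kernel of the derivation lies in \<open>\<complex>[x,z,t]\<close>. Hence an
  isomorphism maps \<open>\<complex>[x,z,t]\<close> to \<open>\<complex>[x,z,t]\<close>, the ideal generated by \<open>F\<close> and \<open>x\<^sup>d\<close> to its counterpart, and \<open>x\<close>
  to a multiple of \<open>x\<close>. Modulo \<open>x\<close> it is an automorphism of the plane that multiplies \<open>r\<close> by a
  constant, and the pole orders at infinity on the curves \<open>r = c\<close> show that it is diagonal. After
  composition with a torus element the isomorphism is the identity modulo \<open>x\<close> and has Jacobian \<open>1\<close>;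
  so its first nontrivial term is a Hamiltonian vector field \<open>x\<^sup>n {\<eta>, -}\<close>. If both equations are in
  normal form, this field is tangent to \<open>r = 0\<close>, so \<open>\<eta> = c + r w\<close> with a constant \<open>c\<close>, and the flow of
  \<open>- x\<^sup>n {w F, -}\<close>, which preserves the ideal generated by \<open>F\<close>, removes the term. Conversely,
  shears along linear forms \<open>a z + t\<close> realize all Hamiltonian vector fields, which together with
  multiples of \<open>r\<close> suffice to remove every monomial outside \<open>idx k l\<close> order by order.
\<close>

unbundle fps_syntax

section \<open>Substitution and derivations\<close>

text \<open>The two halves need different tools. Uniqueness compares congruences modulo x^d only, so
  an exponential series cut at d terms may serve as a flow, although it is multiplicative only
  modulo x^d. Existence needs honest automorphisms of affine space; shears along a z + t are such,
  and the powers of these forms span all polynomials in z and t. In the flow w F takes the place of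
  w r: the term of lowest order in x is the same, but bracketing with w F maps the ideal of F to
  itself. The Jacobian can be normalized because it is a unit of \<complex>[x,z,t], hence a
  constant.

  The obstacle to the converse is that y might occur in the images of x, z and t. Each of these lies
  in the kernel of x^d d/dz or x^d d/dt, and kernels can be transported. Coprimality gives the
  curves z^k + t^l = c a single place at infinity, so that pole orders determine leading monomials;
  it also excludes k = l = 2, the only case in which the degree inequality (k-1)(l-1) <= 1 could
  hold.\<close>

class calg = comm_ring_1 +
  fixes cst :: "complex \<Rightarrow> 'a"
  assumes cst_add: "cst (a + b) = cst a + cst b"
    and cst_mult: "cst (a * b) = cst a * cst b"
    and cst_1 [simp]: "cst 1 = 1"

instantiation complex :: calg
begin
definition cst_complex_def [simp]: "cst (c::complex) = c"
instance by standard simp_all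
end

instantiation poly :: (calg) calg
begin
definition cst_poly_def: "cst c = [:cst c:]"
instance by standard (simp_all add: cst_poly_def cst_add cst_mult one_pCons)
end

instantiation fls :: (calg) calg
begin
definition cst_fls_def: "cst c = fls_const (cst c)"
instance by standard (simp_all add: cst_fls_def cst_add cst_mult fls_plus_const)
end

lemma cst_0 [simp]: "cst 0 = (0::'a::calg)"
  using cst_add[of 0 0, where 'a='a] by simp

lemma cst_minus: "cst (- c) = - (cst c :: 'a::calg)"
  using cst_add[of c "- c", where 'a='a] by (simp add: eq_neg_iff_add_eq_0 add.commute)

lemma cst_diff: "cst (a - b) = (cst a - cst b :: 'a::calg)"
  using cst_add[of a "- b", where 'a='a] by (simp add: cst_minus)

lemma cst_power: "cst (c ^ n) = (cst c ^ n :: 'a::calg)"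
  by (induction n) (simp_all add: cst_mult)

lemma cst_of_nat: "cst (of_nat n) = (of_nat n :: 'a::calg)"
  by (induction n) (simp_all add: cst_add)

lemma cst_of_int: "cst (of_int n) = (of_int n :: 'a::calg)"
  by (cases n) (simp_all add: cst_of_nat cst_minus cst_diff)

lemma cst_inverse: "c \<noteq> 0 \<Longrightarrow> cst c * cst (inverse c) = (1 :: 'a::calg)"
  by (simp flip: cst_mult)

lemma cst_eq_0_iff [simp]: "(cst c :: 'a::calg) = 0 \<longleftrightarrow> c = 0"
  using cst_inverse[of c, where 'a='a] by (cases "c = 0") auto

lemma cst_eq_iff [simp]: "(cst c :: 'a::calg) = cst d \<longleftrightarrow> c = d"
  using cst_eq_0_iff[of "c - d", where 'a='a] by (simp add: cst_diff)

lemma calg_of_nat_neq_0: "n > 0 \<Longrightarrow> (of_nat n :: 'a::calg) \<noteq> 0"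
  using cst_eq_0_iff[of "of_nat n", where 'a='a] by (simp add: cst_of_nat del: cst_eq_0_iff)

lemma calg_of_int_neq_0: "n \<noteq> 0 \<Longrightarrow> (of_int n :: 'a::calg) \<noteq> 0"
  using cst_eq_0_iff[of "of_int n", where 'a='a] by (simp add: cst_of_int del: cst_eq_0_iff)

definition chom :: "('a::calg \<Rightarrow> 'b::calg) \<Rightarrow> bool" where
  "chom h \<longleftrightarrow> (\<forall>c. h (cst c) = cst c) \<and> (\<forall>x y. h (x + y) = h x + h y) \<and> (\<forall>x y. h (x * y) = h x * h y)"

lemma chomI:
  "(\<And>c. h (cst c) = cst c) \<Longrightarrow> (\<And>x y. h (x + y) = h x + h y) \<Longrightarrow> (\<And>x y. h (x * y) = h x * h y) \<Longrightarrow> chom h"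
  by (simp add: chom_def)

lemma
  assumes "chom h"
  shows chom_cst: "h (cst c) = cst c"
    and chom_add: "h (x + y) = h x + h y"
    and chom_mult: "h (x * y) = h x * h y"
  using assms by (auto simp: chom_def)

lemma chom_0: "chom h \<Longrightarrow> h 0 = 0"
  using chom_cst[of h 0] by simp

lemma chom_1: "chom h \<Longrightarrow> h 1 = 1"
  using chom_cst[of h 1] by simp

lemma chom_minus: "chom h \<Longrightarrow> h (- x) = - h x"
  using chom_add[of h x "- x"] chom_0[of h] by (simp add: eq_neg_iff_add_eq_0 add.commute)

lemma chom_diff: "chom h \<Longrightarrow> h (x - y) = h x - h y"
  using chom_add[of h x "- y"] by (simp add: chom_minus)

lemma chom_power: "chom h \<Longrightarrow> h (x ^ n) = h x ^ n"
  by (induction n) (simp_all add: chom_mult chom_1)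

lemma chom_sum: "chom h \<Longrightarrow> h (sum f A) = (\<Sum>a\<in>A. h (f a))"
  by (induction A rule: infinite_finite_induct) (simp_all add: chom_add chom_0)

lemma chom_prod: "chom h \<Longrightarrow> h (prod f A) = (\<Prod>a\<in>A. h (f a))"
  by (induction A rule: infinite_finite_induct) (simp_all add: chom_mult chom_1)

lemmas chom_simps = chom_cst chom_add chom_mult chom_0 chom_1 chom_minus chom_diff chom_power chom_sum chom_prod

lemma chom_cst_fun: "chom cst"
  by (rule chomI) (simp_all add: cst_add cst_mult)

lemma chom_id: "chom (\<lambda>x. x)"
  by (rule chomI) auto

lemma chom_comp: "chom g \<Longrightarrow> chom h \<Longrightarrow> chom (\<lambda>x. g (h x))"
  by (rule chomI) (simp_all add: chom_simps)

lemma chom_const_poly: "chom (\<lambda>c. [:c:])"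
  by (rule chomI) (simp_all add: cst_poly_def)

text \<open>Evaluation over an arbitrary coefficient homomorphism can be nested; this produces the
  substitutions \<open>E1\<close> to \<open>E4\<close>.\<close>

definition lift :: "('a::calg \<Rightarrow> 'b::calg) \<Rightarrow> 'b \<Rightarrow> 'a poly \<Rightarrow> 'b" where
  "lift h a p = poly (map_poly h p) a"

lemma lift_pCons: "chom h \<Longrightarrow> lift h a (pCons c p) = h c + a * lift h a p"
  by (simp add: lift_def map_poly_pCons chom_0)

lemma lift_0 [simp]: "lift h a 0 = 0"
  by (simp add: lift_def)

lemma lift_const [simp]: "chom h \<Longrightarrow> lift h a [:c:] = h c"
  by (simp add: lift_pCons)

lemma lift_X [simp]: "chom h \<Longrightarrow> lift h a [:0, 1:] = a"
  by (simp add: lift_pCons chom_0 chom_1)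

lemma chom_lift: assumes h: "chom h" shows "chom (lift h a)"
proof (rule chomI)
  show add: "lift h a (p + q) = lift h a p + lift h a q" for p q
    by (induction p arbitrary: q, simp) (case_tac q, simp add: lift_pCons[OF h] chom_add[OF h] algebra_simps)
  have smult: "lift h a (smult c q) = h c * lift h a q" for c q
    by (induction q) (simp_all add: lift_pCons[OF h] chom_mult[OF h] algebra_simps)
  show "lift h a (p * q) = lift h a p * lift h a q" for p q
    by (induction p) (simp_all add: add smult lift_pCons[OF h] chom_0[OF h] algebra_simps)
qed (simp add: h chom_cst cst_poly_def)

lemma poly_gen_induct [case_names const var add mult]:
  fixes p :: "'a::comm_ring_1 poly"
  assumes "\<And>c. P [:c:]" "P [:0, 1:]" "\<And>p q. P p \<Longrightarrow> P q \<Longrightarrow> P (p + q)" "\<And>p q. P p \<Longrightarrow> P q \<Longrightarrow> P (p * q)"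
  shows "P p"
proof (induction p)
  case 0
  show ?case using assms(1)[of 0] by simp
next
  case (pCons c p)
  have "pCons c p = [:c:] + [:0, 1:] * p" by simp
  then show ?case using assms pCons by metis
qed

text \<open>Both sides are homomorphisms that agree on constants and on the variable. Through this,
  homomorphisms given by other means, such as evaluation at a point, become one of the substitutions
  \<open>E1\<close> to \<open>E4\<close>.\<close>

lemma chom_lift_eq:
  fixes p :: "'a::calg poly"
  assumes "chom f"
  shows "f p = lift (\<lambda>c. f [:c:]) (f [:0, 1:]) p"
proof -
  have c: "chom (\<lambda>c. f [:c:])" by (rule chom_comp[OF assms chom_const_poly])
  show ?thesis
    by (induction p rule: poly_gen_induct)
      (simp_all add: c chom_simps[OF assms] chom_simps[OF chom_lift[OF c]])
qed

text \<open>
  \<open>bp\<close> is \<open>\<complex>[z][t]\<close>. In \<open>S = \<complex>[z][t][x]\<close> the variable \<open>x\<close> is outermost, so that \<open>coeff\<close> reads off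
  the \<open>x\<close>-adic expansion. The arguments of \<open>E1\<close>, \<open>E2\<close>, \<open>E3\<close>, \<open>E4\<close> are substituted for the variables
  from the innermost to the outermost: for \<open>S\<close>, in the order \<open>z\<close>, \<open>t\<close>, \<open>x\<close>.
\<close>

type_synonym bp = "complex poly poly"
type_synonym S = "complex poly poly poly"

definition E1 :: "'a::calg \<Rightarrow> complex poly \<Rightarrow> 'a" where "E1 a = lift cst a"
definition E2 :: "'a::calg \<Rightarrow> 'a \<Rightarrow> complex poly poly \<Rightarrow> 'a" where "E2 a b = lift (E1 a) b"
definition E3 :: "'a::calg \<Rightarrow> 'a \<Rightarrow> 'a \<Rightarrow> complex poly poly poly \<Rightarrow> 'a" where "E3 a b c = lift (E2 a b) c"
definition E4 :: "'a::calg \<Rightarrow> 'a \<Rightarrow> 'a \<Rightarrow> 'a \<Rightarrow> complex poly poly poly poly \<Rightarrow> 'a" where "E4 a b c d = lift (E3 a b c) d"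

lemma chom_E1: "chom (E1 a)" unfolding E1_def by (intro chom_lift chom_cst_fun)
lemma chom_E2: "chom (E2 a b)" unfolding E2_def by (intro chom_lift chom_E1)
lemma chom_E3: "chom (E3 a b c)" unfolding E3_def by (intro chom_lift chom_E2)
lemma chom_E4: "chom (E4 a b c d)" unfolding E4_def by (intro chom_lift chom_E3)

lemma E_simps [simp]:
  "E1 a [:e:] = cst e" "E1 a [:0, 1:] = a"
  "E2 a b [:p:] = E1 a p" "E2 a b [:0, 1:] = b"
  "E3 a b c [:q:] = E2 a b q" "E3 a b c [:0, 1:] = c"
  "E4 a b c d [:r:] = E3 a b c r" "E4 a b c d [:0, 1:] = d"
  by (simp_all add: E1_def E2_def E3_def E4_def chom_cst_fun
      chom_E1[unfolded E1_def] chom_E2[unfolded E2_def E1_def] chom_E3[unfolded E3_def E2_def E1_def])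

lemmas E1_hom = chom_simps[OF chom_E1]
lemmas E2_hom = chom_simps[OF chom_E2]
lemmas E3_hom = chom_simps[OF chom_E3]
lemmas E4_hom = chom_simps[OF chom_E4]
lemmas E_hom = E1_hom E2_hom E3_hom E4_hom

lemma chom_E1_eq: "chom f \<Longrightarrow> f p = E1 (f [:0,1:]) p"
  by (subst chom_lift_eq) (simp_all add: E1_def chom_cst[of f, unfolded cst_poly_def cst_complex_def])

lemma chom_E2_eq:
  assumes "chom f" shows "f p = E2 (f [:[:0,1:]:]) (f [:0,1:]) p"
proof -
  have "(\<lambda>c. f [:c:]) = E1 (f [:[:0,1:]:])"
    by (intro ext chom_E1_eq[OF chom_comp[OF assms chom_const_poly]])
  then show ?thesis
    unfolding E2_def using chom_lift_eq[OF assms, of p] by metis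
qed

lemma chom_E3_eq:
  assumes "chom f" shows "f p = E3 (f [:[:[:0,1:]:]:]) (f [:[:0,1:]:]) (f [:0,1:]) p"
proof -
  have "(\<lambda>c. f [:c:]) = E2 (f [:[:[:0,1:]:]:]) (f [:[:0,1:]:])"
    by (intro ext chom_E2_eq[OF chom_comp[OF assms chom_const_poly]])
  then show ?thesis
    unfolding E3_def using chom_lift_eq[OF assms, of p] by metis
qed

lemma chom_E4_eq:
  assumes "chom f" shows "f p = E4 (f [:[:[:[:0,1:]:]:]:]) (f [:[:[:0,1:]:]:]) (f [:[:0,1:]:]) (f [:0,1:]) p"
proof -
  have "(\<lambda>c. f [:c:]) = E3 (f [:[:[:[:0,1:]:]:]:]) (f [:[:[:0,1:]:]:]) (f [:[:0,1:]:])"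
    by (intro ext chom_E3_eq[OF chom_comp[OF assms chom_const_poly]])
  then show ?thesis
    unfolding E4_def using chom_lift_eq[OF assms, of p] by metis
qed

lemma chom_E1_comp:
  assumes "chom f" shows "f (E1 a p) = E1 (f a) p"
  by (rule trans[OF chom_E1_eq[OF chom_comp[OF assms chom_E1[of a]], of p]]) simp

lemma chom_E2_comp:
  assumes "chom f" shows "f (E2 a b p) = E2 (f a) (f b) p"
  by (rule trans[OF chom_E2_eq[OF chom_comp[OF assms chom_E2[of a b]], of p]]) simp

lemma chom_E3_comp:
  assumes "chom f" shows "f (E3 a b c p) = E3 (f a) (f b) (f c) p"
  by (rule trans[OF chom_E3_eq[OF chom_comp[OF assms chom_E3[of a b c]], of p]]) simp

lemma chom_E4_comp:
  assumes "chom f" shows "f (E4 a b c d p) = E4 (f a) (f b) (f c) (f d) p"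
  by (rule trans[OF chom_E4_eq[OF chom_comp[OF assms chom_E4[of a b c d]], of p]]) simp

lemma E2_id [simp]: "E2 [:[:0,1:]:] [:0,1:] p = p"
  using chom_E2_eq[OF chom_id, of p] by simp
lemma E3_id [simp]: "E3 [:[:[:0,1:]:]:] [:[:0,1:]:] [:0,1:] p = p"
  using chom_E3_eq[OF chom_id, of p] by simp
lemma E2_comp: "E2 a b (E2 u v p) = E2 (E2 a b u) (E2 a b v) p"
  by (rule chom_E2_comp[OF chom_E2])
lemma E3_comp: "E3 a b c (E3 u v w p) = E3 (E3 a b c u) (E3 a b c v) (E3 a b c w) p"
  by (rule chom_E3_comp[OF chom_E3])
lemma E4_comp: "E4 a b c d (E4 u v w r p) = E4 (E4 a b c d u) (E4 a b c d v) (E4 a b c d w) (E4 a b c d r) p"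
  by (rule chom_E4_comp[OF chom_E4])

lemma bp_induct [case_names const z t add mult]:
  fixes p :: bp
  assumes "\<And>c. P (cst c)" "P [:[:0,1:]:]" "P [:0,1:]"
    "\<And>p q. P p \<Longrightarrow> P q \<Longrightarrow> P (p + q)" "\<And>p q. P p \<Longrightarrow> P q \<Longrightarrow> P (p * q)"
  shows "P p"
proof (induction p rule: poly_gen_induct)
  case (const c)
  show ?case
  proof (induction c rule: poly_gen_induct)
    case (const c) then show ?case using assms(1)[of c] by (simp add: cst_poly_def)
  next
    case (add p q) then show ?case using assms(4)[of "[:p:]" "[:q:]"] by simp
  next
    case (mult p q) then show ?case using assms(5)[of "[:p:]" "[:q:]"] by (simp add: mult.commute)
  qed (fact assms(2))
qed (use assms in auto)

lemma S_induct [case_names const z t x add mult]: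
  fixes p :: S
  assumes "\<And>c. P (cst c)" "P [:[:[:0,1:]:]:]" "P [:[:0,1:]:]" "P [:0,1:]"
    "\<And>p q. P p \<Longrightarrow> P q \<Longrightarrow> P (p + q)" "\<And>p q. P p \<Longrightarrow> P q \<Longrightarrow> P (p * q)"
  shows "P p"
proof (induction p rule: poly_gen_induct)
  case (const c)
  show ?case
  proof (induction c rule: bp_induct)
    case (const c) then show ?case using assms(1)[of c] by (simp add: cst_poly_def)
  next
    case (add p q) then show ?case using assms(5)[of "[:p:]" "[:q:]"] by simp
  next
    case (mult p q) then show ?case using assms(6)[of "[:p:]" "[:q:]"] by (simp add: mult.commute)
  qed (use assms in auto)
qed (use assms in auto)

lemma P4_induct [case_names const x y z t add mult]:
  fixes p :: "complex poly poly poly poly"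
  assumes "\<And>c. P (cst c)" "P [:[:[:[:0,1:]:]:]:]" "P [:[:[:0,1:]:]:]" "P [:[:0,1:]:]" "P [:0,1:]"
    "\<And>p q. P p \<Longrightarrow> P q \<Longrightarrow> P (p + q)" "\<And>p q. P p \<Longrightarrow> P q \<Longrightarrow> P (p * q)"
  shows "P p"
proof (induction p rule: poly_gen_induct)
  case (const c)
  show ?case
  proof (induction c rule: S_induct)
    case (const c) then show ?case using assms(1)[of c] by (simp add: cst_poly_def)
  next
    case (add p q) then show ?case using assms(6)[of "[:p:]" "[:q:]"] by simp
  next
    case (mult p q) then show ?case using assms(7)[of "[:p:]" "[:q:]"] by (simp add: mult.commute)
  qed (use assms in auto)
qed (use assms in auto)

section \<open>Derivations and partial derivatives\<close>

definition der :: "('a::calg \<Rightarrow> 'a) \<Rightarrow> bool" where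
  "der D \<longleftrightarrow> (\<forall>c. D (cst c) = 0) \<and> (\<forall>x y. D (x + y) = D x + D y) \<and> (\<forall>x y. D (x * y) = D x * y + x * D y)"

lemma derI:
  "(\<And>c. D (cst c) = 0) \<Longrightarrow> (\<And>x y. D (x + y) = D x + D y) \<Longrightarrow> (\<And>x y. D (x * y) = D x * y + x * D y) \<Longrightarrow> der D"
  by (simp add: der_def)

lemma
  assumes "der D"
  shows der_cst: "D (cst c) = 0" and der_add: "D (x + y) = D x + D y"
    and der_mult: "D (x * y) = D x * y + x * D y"
  using assms by (auto simp: der_def)

lemma der_0: "der D \<Longrightarrow> D 0 = 0" using der_cst[of D 0] by simp
lemma der_1: "der D \<Longrightarrow> D 1 = 0" using der_cst[of D 1] by simp
lemma der_minus: "der D \<Longrightarrow> D (- x) = - D x"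
  using der_add[of D x "- x"] der_0[of D] by (simp add: eq_neg_iff_add_eq_0 add.commute)
lemma der_diff: "der D \<Longrightarrow> D (x - y) = D x - D y"
  using der_add[of D x "- y"] by (simp add: der_minus)
lemma der_power: "der D \<Longrightarrow> D (x ^ n) = of_nat n * x ^ (n - 1) * D x"
proof (induction n)
  case (Suc n) then show ?case by (cases n) (simp_all add: der_mult algebra_simps)
qed (simp add: der_1)
lemma der_sum: "der D \<Longrightarrow> D (sum f A) = (\<Sum>a\<in>A. D (f a))"
  by (induction A rule: infinite_finite_induct) (simp_all add: der_add der_0)
lemma der_of_nat: "der D \<Longrightarrow> D (of_nat n) = 0"
  by (metis der_cst cst_of_nat)
lemma der_of_int: "der D \<Longrightarrow> D (of_int n) = 0"
  by (metis der_cst cst_of_int)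

lemmas der_simps = der_cst der_add der_mult der_0 der_1 der_minus der_diff der_power der_sum der_of_nat der_of_int

lemma der_plus: "der D \<Longrightarrow> der E \<Longrightarrow> der (\<lambda>f. D f + E f)"
  by (rule derI) (simp_all add: der_simps algebra_simps)
lemma der_times: "der D \<Longrightarrow> der (\<lambda>f. a * D f)"
  by (rule derI) (simp_all add: der_simps algebra_simps)

lemma map_poly_pCons_der: "der D \<Longrightarrow> map_poly D (pCons c p) = pCons (D c) (map_poly D p)"
  by (simp add: map_poly_pCons der_0)

lemma der_map_poly: assumes D: "der D" shows "der (map_poly D)"
proof (rule derI)
  show "map_poly D (cst c) = 0" for c
    by (simp add: cst_poly_def map_poly_pCons_der[OF D] der_cst[OF D])
  show add: "map_poly D (p + q) = map_poly D p + map_poly D q" for p q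
    by (rule poly_eqI) (simp add: coeff_map_poly der_simps[OF D])
  have sm: "map_poly D (smult c q) = smult (D c) q + smult c (map_poly D q)" for c q
    by (rule poly_eqI) (simp add: coeff_map_poly der_simps[OF D])
  show "map_poly D (p * q) = map_poly D p * q + p * map_poly D q" for p q
    by (induction p) (simp_all add: add sm map_poly_pCons_der[OF D] der_0[OF D] algebra_simps)
qed

lemma der_pderiv: "der (pderiv :: 'a::{calg,idom} poly \<Rightarrow> _)"
  by (rule derI) (simp_all add: cst_poly_def pderiv_add pderiv_mult pderiv_pCons)

definition dz :: "bp \<Rightarrow> bp" where "dz = map_poly pderiv"
definition dt :: "bp \<Rightarrow> bp" where "dt = pderiv"

lemma der_dz: "der dz" unfolding dz_def by (intro der_map_poly der_pderiv)
lemma der_dt: "der dt" unfolding dt_def by (rule der_pderiv)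

lemma dz_dt_simps [simp]: "dz [:[:0,1:]:] = 1" "dz [:0,1:] = 0" "dt [:[:0,1:]:] = 0" "dt [:0,1:] = 1"
  by (simp_all add: dz_def dt_def map_poly_pCons pderiv_pCons one_pCons)

lemmas dz_simps = der_simps[OF der_dz]
lemmas dt_simps = der_simps[OF der_dt]

lemma der_E2:
  assumes "der D"
  shows "D (E2 a b p) = E2 a b (dz p) * D a + E2 a b (dt p) * D b"
  by (induction p rule: bp_induct)
    (simp_all add: der_simps[OF assms] dz_simps dt_simps E_hom algebra_simps)

definition Dz :: "S \<Rightarrow> S" where "Dz = map_poly dz"
definition Dt :: "S \<Rightarrow> S" where "Dt = map_poly dt"

lemma der_Dz: "der Dz" unfolding Dz_def by (intro der_map_poly der_dz)
lemma der_Dt: "der Dt" unfolding Dt_def by (intro der_map_poly der_dt)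
lemmas Dz_simps = der_simps[OF der_Dz]
lemmas Dt_simps = der_simps[OF der_Dt]

lemma coeff_Dz: "coeff (Dz p) n = dz (coeff p n)"
  by (simp add: Dz_def coeff_map_poly dz_simps)
lemma coeff_Dt: "coeff (Dt p) n = dt (coeff p n)"
  by (simp add: Dt_def coeff_map_poly dt_simps)

lemma Dz_const: "Dz [:c:] = [:dz c:]"
  by (simp add: Dz_def map_poly_pCons_der[OF der_dz])
lemma Dt_const: "Dt [:c:] = [:dt c:]"
  by (simp add: Dt_def map_poly_pCons_der[OF der_dt])

lemma Dz_Dt_vars [simp]:
  "Dz [:[:[:0,1:]:]:] = 1" "Dz [:[:0,1:]:] = 0" "Dz [:0,1:] = 0"
  "Dt [:[:[:0,1:]:]:] = 0" "Dt [:[:0,1:]:] = 1" "Dt [:0,1:] = 0"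
  by (simp_all only: Dz_const Dt_const dz_dt_simps)
    (simp_all add: Dz_def Dt_def map_poly_pCons_der[OF der_dz] map_poly_pCons_der[OF der_dt] dz_simps dt_simps
      der_1[OF der_map_poly[OF der_dz]] der_1[OF der_map_poly[OF der_dt]] flip: one_pCons)

lemma der_E3:
  assumes "der D"
  shows "D (E3 a b c p) = E3 a b c (Dz p) * D a + E3 a b c (Dt p) * D b + E3 a b c (pderiv p) * D c"
  by (induction p rule: S_induct)
    (simp_all add: der_simps[OF assms] Dz_simps Dt_simps der_simps[OF der_pderiv] pderiv_pCons E_hom algebra_simps)

section \<open>Locally nilpotent derivations\<close>

definition zv :: bp where "zv = [:[:0,1:]:]"
definition tv :: bp where "tv = [:0,1:]"

lemma dzt_vars [simp]: "dz zv = 1" "dz tv = 0" "dt zv = 0" "dt tv = 1"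
  by (simp_all add: zv_def tv_def)

lemma zv_neq_0 [simp]: "zv \<noteq> 0" and tv_neq_0 [simp]: "tv \<noteq> 0"
  by (simp_all add: zv_def tv_def)

text \<open>A property of one element, because the derivations of Laurent series used below are
  locally nilpotent only on a subring.\<close>

definition nilp :: "('a::zero \<Rightarrow> 'a) \<Rightarrow> 'a \<Rightarrow> bool" where
  "nilp D f \<longleftrightarrow> (\<exists>n. (D ^^ n) f = 0)"

text \<open>The degree function of a locally nilpotent derivation; at 0 its value is 0 rather than
  minus infinity.\<close>

definition ndeg :: "('a::zero \<Rightarrow> 'a) \<Rightarrow> 'a \<Rightarrow> nat" where
  "ndeg D f = (LEAST n. (D ^^ Suc n) f = 0)"

lemma der_funpow_0: "der D \<Longrightarrow> (D ^^ n) 0 = 0"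
  by (induction n) (simp_all add: der_0)

lemma der_funpow_add: "der D \<Longrightarrow> (D ^^ n) (f + g) = (D ^^ n) f + (D ^^ n) g"
  by (induction n) (simp_all add: der_add)

lemma der_funpow_diff: "der D \<Longrightarrow> (D ^^ n) (f - g) = (D ^^ n) f - (D ^^ n) g"
  by (induction n) (simp_all add: der_diff)

lemma der_funpow_mono:
  assumes "der D" "(D ^^ n) f = 0" "n \<le> m"
  shows "(D ^^ m) f = 0"
proof -
  have "(D ^^ m) f = (D ^^ (m - n)) ((D ^^ n) f)"
    using assms(3) by (metis comp_apply funpow_add le_add_diff_inverse2)
  then show ?thesis using assms by (simp add: der_funpow_0)
qed

lemma ndeg_ge:
  assumes "der D" "nilp D f" "f \<noteq> 0"
  shows "(D ^^ ndeg D f) f \<noteq> 0" "(D ^^ Suc (ndeg D f)) f = 0"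
proof -
  from assms obtain m where "(D ^^ Suc m) f = 0"
    unfolding nilp_def by (metis der_funpow_mono lessI less_imp_le)
  then show "(D ^^ Suc (ndeg D f)) f = 0" unfolding ndeg_def by (rule LeastI)
  show "(D ^^ ndeg D f) f \<noteq> 0"
  proof (cases "ndeg D f")
    case (Suc m)
    then have "\<not> (D ^^ Suc m) f = 0" unfolding ndeg_def by (intro not_less_Least) simp
    then show ?thesis using Suc by simp
  qed (use assms in simp)
qed

lemma ndeg_eqI:
  assumes "der D" "(D ^^ n) f \<noteq> 0" "(D ^^ Suc n) f = 0"
  shows "ndeg D f = n"
  unfolding ndeg_def
proof (rule Least_equality)
  fix m assume "(D ^^ Suc m) f = 0"
  then show "n \<le> m" using assms der_funpow_mono by (metis not_less_eq_eq)
qed (fact assms(3))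

lemma ndeg_leI: "(D ^^ Suc n) f = 0 \<Longrightarrow> ndeg D f \<le> n"
  unfolding ndeg_def by (rule Least_le)

text \<open>In the Leibniz formula of order a + b all other terms contain a vanishing power. The
  induction obtains the binomial coefficient from Pascal's rule.\<close>

lemma leibniz_top:
  assumes D: "der D"
  shows "(D ^^ Suc a) f = 0 \<Longrightarrow> (D ^^ Suc b) g = 0 \<Longrightarrow>
    (D ^^ (a + b)) (f * g) = of_nat ((a + b) choose a) * (D ^^ a) f * (D ^^ b) g"
proof (induction "a + b" arbitrary: a b f g)
  case 0
  then show ?case by simp
next
  case (Suc n)
  have step: "(D ^^ (a + b)) (f * g) = (D ^^ n) (D f * g) + (D ^^ n) (f * D g)"
    using Suc(2) D by (simp add: funpow_swap1 der_mult der_funpow_add flip: Suc(2))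
  have A: "(D ^^ n) (D f * g) = (if a = 0 then 0 else of_nat (n choose (a - 1)) * (D ^^ a) f * (D ^^ b) g)"
  proof (cases a)
    case 0
    then show ?thesis using Suc.prems D by (simp add: der_funpow_0)
  next
    case (Suc a')
    have "(D ^^ n) (D f * g) = of_nat ((a' + b) choose a') * (D ^^ a') (D f) * (D ^^ b) g"
      using Suc.hyps(1)[of a' b "D f" g] Suc.hyps(2) Suc Suc.prems by (simp add: funpow_swap1)
    then show ?thesis using Suc Suc.hyps(2) by (simp add: funpow_swap1)
  qed
  have B: "(D ^^ n) (f * D g) = (if b = 0 then 0 else of_nat (n choose a) * (D ^^ a) f * (D ^^ b) g)"
  proof (cases b)
    case 0
    then show ?thesis using Suc.prems D by (simp add: der_funpow_0)
  next
    case (Suc b')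
    have "(D ^^ n) (f * D g) = of_nat ((a + b') choose a) * (D ^^ a) f * (D ^^ b') (D g)"
      using Suc.hyps(1)[of a b' f "D g"] Suc.hyps(2) Suc Suc.prems by (simp add: funpow_swap1)
    then show ?thesis using Suc Suc.hyps(2) by (simp add: funpow_swap1)
  qed
  show ?case
    using Suc.hyps(2) unfolding step A B
    by (cases a; cases b) (auto simp: algebra_simps)
qed

text \<open>The top term of \<open>leibniz_top\<close> does not vanish in a domain of characteristic
  0.\<close>

lemma ndeg_mult:
  fixes f g :: "'a::{calg,idom}"
  assumes D: "der D" and f: "nilp D f" "f \<noteq> 0" and g: "nilp D g" "g \<noteq> 0"
  shows "nilp D (f * g)" "ndeg D (f * g) = ndeg D f + ndeg D g"
proof -
  let ?a = "ndeg D f" and ?b = "ndeg D g"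
  note F = ndeg_ge[OF D f] and G = ndeg_ge[OF D g]
  have top: "(D ^^ (?a + ?b)) (f * g) = of_nat ((?a + ?b) choose ?a) * (D ^^ ?a) f * (D ^^ ?b) g"
    by (rule leibniz_top[OF D F(2) G(2)])
  have "(D ^^ Suc (?a + ?b)) (f * g) = 0"
    using F(2) G(2) by (simp add: top der_simps[OF D])
  moreover have "(D ^^ (?a + ?b)) (f * g) \<noteq> 0"
    unfolding top using F G by (auto simp: calg_of_nat_neq_0)
  ultimately show "nilp D (f * g)" "ndeg D (f * g) = ?a + ?b"
    using ndeg_eqI[OF D] unfolding nilp_def by blast+
qed

lemma ndeg_power:
  fixes f :: "'a::{calg,idom}"
  assumes D: "der D" and f: "nilp D f" "f \<noteq> 0"
  shows "nilp D (f ^ n) \<and> ndeg D (f ^ n) = n * ndeg D f"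
proof (induction n)
  case 0
  have "(D ^^ Suc 0) 1 = 0" using D by (simp add: der_1)
  then show ?case using ndeg_eqI[OF D, of 0 1] unfolding nilp_def by (metis funpow_0 mult_0 power_0 zero_neq_one)
next
  case (Suc n)
  then show ?case using ndeg_mult[OF D f, of "f ^ n"] f by simp
qed

lemma ndeg_der:
  assumes D: "der D" and f: "nilp D f" "D f \<noteq> 0"
  shows "nilp D (D f)" "ndeg D f = Suc (ndeg D (D f))"
proof -
  have f0: "f \<noteq> 0" using f D by (auto simp: der_0)
  note F = ndeg_ge[OF D f(1) f0]
  from F f obtain m where m: "ndeg D f = Suc m" by (cases "ndeg D f") auto
  show "nilp D (D f)" using F(2) unfolding nilp_def by (metis funpow_simps_right(2) o_apply)
  have "ndeg D (D f) = m"
    by (rule ndeg_eqI[OF D]) (use F m in \<open>simp_all add: funpow_swap1\<close>)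
  then show "ndeg D f = Suc (ndeg D (D f))" using m by simp
qed

lemma ndeg_0: "D f = 0 \<Longrightarrow> ndeg D f = 0"
  using ndeg_leI[of 0 D f] by simp

lemma ndeg_eq_0: "der D \<Longrightarrow> nilp D f \<Longrightarrow> ndeg D f = 0 \<Longrightarrow> D f = 0"
  using ndeg_der(2)[of D f] by auto

lemma ndeg_diff_le:
  assumes D: "der D" and "nilp D f" "nilp D g" "ndeg D f \<le> n" "ndeg D g \<le> n"
  shows "ndeg D (f - g) \<le> n"
proof (rule ndeg_leI)
  have "(D ^^ Suc n) h = 0" if "nilp D h" "ndeg D h \<le> n" for h
    using that ndeg_ge(2)[OF D] der_funpow_mono[OF D] by (cases "h = 0") (metis der_funpow_0[OF D] Suc_le_mono)+
  then show "(D ^^ Suc n) (f - g) = 0"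
    using assms by (simp add: der_funpow_diff[OF D] del: funpow.simps)
qed

text \<open>
  The argument of Mason and Stothers for \<open>z\<^sup>k + t\<^sup>l\<close>, with the degree of a locally nilpotent
  derivation in place of the degree of a polynomial and the Wronskian \<open>W\<close> of \<open>z\<^sup>k\<close> and \<open>t\<^sup>l\<close>,
  up to a factor.
\<close>

lemma cusp_rigid:
  fixes z t :: "'a::{calg,idom}"
  assumes G: "der G" and nil: "\<And>f. nilp G f"
    and z: "z \<noteq> 0" and t: "t \<noteq> 0" and r: "r = z ^ k + t ^ l" "r \<noteq> 0" and GG: "G (G r) = 0"
    and kl: "k \<ge> 2" "l \<ge> 2" "\<not> (k = 2 \<and> l = 2)"
  shows "G z = 0 \<and> G t = 0"
proof -
  define c where "c = G r"
  define W where "W = of_nat l * G t * z - of_nat k * t * G z"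
  obtain k' l' where k': "k = Suc k'" "k' \<ge> 1" and l': "l = Suc l'" "l' \<ge> 1"
    using kl by (cases k; cases l) auto
  have c: "c = of_nat k * z ^ k' * G z + of_nat l * t ^ l' * G t"
    unfolding c_def r(1) by (simp only: der_add[OF G] der_power[OF G] k' l' diff_Suc_1)
  \<comment> \<open>Eliminating t^l, respectively z^k, from r and c = G r leaves the Wronskian times
    a pure power of z or of t.\<close>
  have 1: "of_nat l * G t * r - t * c = z ^ k' * W"
    unfolding c r(1) W_def k' l' by (simp add: algebra_simps)
  have 2: "z * c - of_nat k * G z * r = t ^ l' * W"
    unfolding c r(1) W_def k' l' by (simp add: algebra_simps)
  have Gc: "G c = 0" using GG by (simp add: c_def)
  have rdeg: "ndeg G r \<le> 1" by (rule ndeg_leI) (simp add: GG)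
  have bound: "ndeg G (of_nat m * G f * r) \<le> ndeg G f" "ndeg G (f * c) \<le> ndeg G f"
    if "f \<noteq> 0" "m > 0" for f m
  proof -
    show "ndeg G (f * c) \<le> ndeg G f"
      using ndeg_mult(2)[OF G nil that(1) nil, of c] ndeg_0[of G c] Gc ndeg_leI[of 0 G 0]
      by (cases "c = 0") (auto simp: der_0[OF G])
    show "ndeg G (of_nat m * G f * r) \<le> ndeg G f"
    proof (cases "G f = 0")
      case False
      have m: "(of_nat m :: 'a) \<noteq> 0" "ndeg G (of_nat m) = 0"
        using that by (auto simp: calg_of_nat_neq_0 ndeg_0 der_of_nat[OF G])
      have "ndeg G (of_nat m * G f * r) = ndeg G (G f) + ndeg G r"
        using ndeg_mult(2)[OF G nil _ nil] m False r by simp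
      then show ?thesis using ndeg_der(2)[OF G nil False] rdeg by simp
    qed (use ndeg_leI[of 0 G 0] in \<open>simp add: der_0[OF G]\<close>)
  qed
  have W0: "W = 0"
  proof (rule ccontr)
    assume W: "W \<noteq> 0"
    have "ndeg G (z ^ k' * W) = k' * ndeg G z + ndeg G W" "ndeg G (t ^ l' * W) = l' * ndeg G t + ndeg G W"
      using ndeg_mult(2)[OF G nil _ nil W] ndeg_power[OF G nil] z t by simp_all
    moreover have "ndeg G (z ^ k' * W) \<le> ndeg G t" "ndeg G (t ^ l' * W) \<le> ndeg G z"
      unfolding 1[symmetric] 2[symmetric]
      using bound[OF t] bound[OF z] kl by (auto intro!: ndeg_diff_le[OF G nil nil])
    \<comment> \<open>Composed, the two inequalities give (k-1)(l-1) <= 1 once the degrees are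
      positive; only k = l = 2 would satisfy this.\<close>
    ultimately have ineq: "k' * ndeg G z \<le> ndeg G t" "l' * ndeg G t \<le> ndeg G z" by auto
    have "ndeg G z \<noteq> 0"
    proof
      assume "ndeg G z = 0"
      with ineq l' have "ndeg G t = 0" by simp
      with \<open>ndeg G z = 0\<close> have "G z = 0" "G t = 0" using ndeg_eq_0[OF G nil] by auto
      then show False using W by (simp add: W_def)
    qed
    have "k' * (l' * ndeg G t) \<le> ndeg G t" using ineq by (meson le_trans mult_le_mono2)
    moreover have "ndeg G t > 0" using ineq \<open>ndeg G z \<noteq> 0\<close> k' by (cases "ndeg G t") auto
    ultimately have "k' * l' \<le> 1" by (simp add: mult.assoc[symmetric])
    then show False using k' l' kl by (cases k'; cases l') auto
  qed
  \<comment> \<open>For W = 0 both equations read m (G f) r = f c. Applying G i times gives m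
    G^(i+1) f r = (1 - i m) G^i f c; at i = deg f the left side vanishes while 1 - i m is nonzero,
    so c = 0.\<close>
  have *: "G f = 0" if eq: "of_nat m * G f * r = f * c" and "f \<noteq> 0" "m \<ge> 2" for f m
  proof (rule ccontr)
    assume Gf: "G f \<noteq> 0"
    have i: "of_nat m * (G ^^ Suc i) f * r = (1 - of_nat (i * m)) * (G ^^ i) f * c" for i
    proof (induction i)
      case 0 then show ?case using eq by simp
    next
      case (Suc i)
      have "G (of_nat m * (G ^^ Suc i) f * r) = G ((1 - of_nat (i * m)) * (G ^^ i) f * c)"
        using Suc by simp
      then have "of_nat m * (G ^^ Suc (Suc i)) f * r + of_nat m * (G ^^ Suc i) f * c
          = (1 - of_nat (i * m)) * (G ^^ Suc i) f * c"
        by (simp add: der_simps[OF G] Gc algebra_simps flip: c_def)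
      then show ?case by (simp add: algebra_simps)
    qed
    define n where "n = ndeg G f"
    have n: "(G ^^ n) f \<noteq> 0" "(G ^^ Suc n) f = 0" using ndeg_ge[OF G nil that(2)] by (auto simp: n_def)
    have "n > 0" using ndeg_der(2)[OF G nil Gf] by (simp add: n_def)
    then have "(1 - of_nat (n * m) :: 'a) \<noteq> 0"
      using calg_of_int_neq_0[of "1 - int (n * m)", where 'a='a] \<open>m \<ge> 2\<close>
      by (auto simp: zmult_eq_1_iff) 
    then have "c = 0" using i[of n] n by simp
    then show False using eq Gf r(2) calg_of_nat_neq_0[of m, where 'a='a] \<open>m \<ge> 2\<close> by auto
  qed
  show ?thesis using *[of l t] *[of k z] 1 2 W0 kl z t by (auto simp: algebra_simps)
qed

section \<open>Homogeneous derivations\<close>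

text \<open>The bounds need not be the exact orders, so that zero series and cancelled leading terms
  require no separate treatment.\<close>

lemma fls_times_nth_bounds:
  fixes f g :: "'a::comm_ring_1 fls"
  assumes "\<And>i. i < a \<Longrightarrow> f $$ i = 0" "\<And>i. i < b \<Longrightarrow> g $$ i = 0"
  shows "(f * g) $$ n = (\<Sum>i=a..n-b. f $$ i * g $$ (n - i))"
proof (cases "f = 0 \<or> g = 0")
  case False
  then have "a \<le> fls_subdegree f" "b \<le> fls_subdegree g"
    using assms by (auto intro: fls_subdegree_geI)
  then show ?thesis
    unfolding fls_times_nth(2) by (intro sum.mono_neutral_left) auto
qed auto

lemma fls_times_nth_0:
  fixes f g :: "'a::comm_ring_1 fls"
  assumes "\<And>i. i < a \<Longrightarrow> f $$ i = 0" "\<And>i. i < b \<Longrightarrow> g $$ i = 0" "n < a + b"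
  shows "(f * g) $$ n = 0"
  using fls_times_nth_bounds[OF assms(1,2), where n = n] assms(3) by auto

lemma fls_times_nth_lead:
  fixes f g :: "'a::comm_ring_1 fls"
  assumes "\<And>i. i < a \<Longrightarrow> f $$ i = 0" "\<And>i. i < b \<Longrightarrow> g $$ i = 0"
  shows "(f * g) $$ (a + b) = f $$ a * g $$ b"
  using fls_times_nth_bounds[OF assms, where n = "a + b"] by simp

definition fls_map :: "('a::zero \<Rightarrow> 'a) \<Rightarrow> 'a fls \<Rightarrow> 'a fls" where
  "fls_map h f = Abs_fls (\<lambda>n. h (f $$ n))"

lemma fls_map_nth: "h 0 = 0 \<Longrightarrow> fls_map h f $$ n = h (f $$ n)"
  unfolding fls_map_def by (rule nth_Abs_fls_lower_bound[of "fls_subdegree f"]) auto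

lemma der_fls_map:
  fixes D :: "'a::{calg} \<Rightarrow> 'a"
  assumes D: "der D"
  shows "der (fls_map D)"
proof (rule derI)
  note nth = fls_map_nth[of D, OF der_0[OF D]]
  show "fls_map D (cst c) = 0" for c
    by (rule fls_eqI) (simp add: nth cst_fls_def der_simps[OF D])
  show "fls_map D (x + y) = fls_map D x + fls_map D y" for x y
    by (rule fls_eqI) (simp add: nth der_simps[OF D])
  show "fls_map D (x * y) = fls_map D x * y + x * fls_map D y" for x y
  proof (rule fls_eqI)
    fix n
    let ?a = "fls_subdegree x" and ?b = "fls_subdegree y"
    have z: "x $$ i = 0" "fls_map D x $$ i = 0" if "i < ?a" for i
      using that by (simp_all add: nth der_0[OF D])
    have w: "y $$ i = 0" "fls_map D y $$ i = 0" if "i < ?b" for i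
      using that by (simp_all add: nth der_0[OF D])
    show "fls_map D (x * y) $$ n = (fls_map D x * y + x * fls_map D y) $$ n"
      by (simp add: nth fls_times_nth_bounds[OF z(1) w(1)] fls_times_nth_bounds[OF z(2) w(1)]
          fls_times_nth_bounds[OF z(1) w(2)] der_simps[OF D] sum.distrib)
  qed
qed

lemma der_fls_deriv: "der (fls_deriv :: 'a::{calg,idom} fls \<Rightarrow> _)"
  by (rule derI) (simp_all add: cst_fls_def algebra_simps)

text \<open>The field P x d/dx + Q d/dz + T d/dt. Like d/dz and d/dt, the Euler field x d/dx does
  not lower the order in x; hence the leading part is read off from \<open>P\<close>,
  \<open>Q\<close>, \<open>T\<close> at one common index.\<close>

definition vf :: "bp fls \<Rightarrow> bp fls \<Rightarrow> bp fls \<Rightarrow> bp fls \<Rightarrow> bp fls" where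
  "vf P Q T f = P * (fls_X * fls_deriv f) + Q * fls_map dz f + T * fls_map dt f"

lemma der_vf: "der (vf P Q T)"
  unfolding vf_def by (intro der_plus der_times der_fls_deriv der_fls_map der_dz der_dt)

definition lmon :: "int \<Rightarrow> bp \<Rightarrow> bp fls" where
  "lmon e c = fls_shift (- e) (fls_const c)"

lemma lmon_nth [simp]: "lmon e c $$ n = (if n = e then c else 0)"
  by (auto simp: lmon_def)

lemma lmon_eq_0_iff [simp]: "lmon e c = 0 \<longleftrightarrow> c = 0"
  by (auto simp: lmon_def fls_shift_eq0_iff)

lemma lmon_mult: "lmon e c * lmon e' c' = lmon (e + e') (c * c')"
  by (simp add: lmon_def fls_times_both_shifted_simp)

lemma lmon_add: "lmon e c + lmon e c' = lmon e (c + c')"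
  by (rule fls_eqI) simp

lemma lmon_0 [simp]: "lmon e 0 = 0" by simp

lemma lmon_power: "lmon e c ^ n = lmon (int n * e) (c ^ n)"
proof (induction n)
  case 0
  show ?case by (rule fls_eqI) simp
qed (simp add: lmon_mult algebra_simps)

lemma fls_map_lmon: "D 0 = 0 \<Longrightarrow> fls_map D (lmon e c) = lmon e (D c)"
  by (rule fls_eqI) (simp add: fls_map_nth)

lemma X_deriv_nth: "(fls_X * fls_deriv f) $$ n = of_int n * f $$ n" for f :: "bp fls"
  by (simp add: fls_X_times_conv_shift)

lemma X_deriv_lmon: "fls_X * fls_deriv (lmon e c) = lmon e (of_int e * c)"
  by (rule fls_eqI) (simp add: X_deriv_nth)

lemma vf_lead_0:
  assumes "\<And>i. i < n \<Longrightarrow> P $$ i = 0" "\<And>i. i < n \<Longrightarrow> Q $$ i = 0" "\<And>i. i < n \<Longrightarrow> T $$ i = 0"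
    and "\<And>i. i < e \<Longrightarrow> f $$ i = 0" and "m < n + e"
  shows "vf P Q T f $$ m = 0"
  using assms fls_times_nth_0[of n P e "fls_X * fls_deriv f" m]
    fls_times_nth_0[of n Q e "fls_map dz f" m] fls_times_nth_0[of n T e "fls_map dt f" m]
  by (simp add: vf_def X_deriv_nth fls_map_nth dz_simps dt_simps)

definition TT :: "bp \<Rightarrow> bp \<Rightarrow> bp \<Rightarrow> int \<Rightarrow> bp \<Rightarrow> bp" where
  "TT p q s e c = of_int e * p * c + q * dz c + s * dt c"

lemma vf_lead:
  assumes "\<And>i. i < n \<Longrightarrow> P $$ i = 0" "\<And>i. i < n \<Longrightarrow> Q $$ i = 0" "\<And>i. i < n \<Longrightarrow> T $$ i = 0"
    and "\<And>i. i < e \<Longrightarrow> f $$ i = 0"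
  shows "vf P Q T f $$ (n + e) = TT (P $$ n) (Q $$ n) (T $$ n) e (f $$ e)"
  using assms fls_times_nth_lead[of n P e "fls_X * fls_deriv f"]
    fls_times_nth_lead[of n Q e "fls_map dz f"] fls_times_nth_lead[of n T e "fls_map dt f"]
  by (simp add: vf_def X_deriv_nth fls_map_nth dz_simps dt_simps TT_def algebra_simps)

lemma vf_lmon: "vf (lmon n p) (lmon n q) (lmon n s) (lmon e c) = lmon (n + e) (TT p q s e c)"
  by (simp add: vf_def X_deriv_lmon fls_map_lmon dz_simps dt_simps lmon_mult lmon_add TT_def algebra_simps)

text \<open>
  In the graded ring of the \<open>x\<close>-adic filtration on \<open>A = \<complex>[x,y,z,t]/(x\<^sup>d y + F)\<close>, where \<open>y = - r / x\<^sup>d\<close>, the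
  element \<open>x\<^sup>e c\<close> occurs iff \<open>r\<close> to the power \<open>rx d e\<close> divides \<open>c\<close>; \<open>TT\<close> describes a homogeneous derivation
  of it by its action on coefficients.
\<close>

definition rx :: "nat \<Rightarrow> int \<Rightarrow> nat" where
  "rx d e = nat (- (e div int d))"

text \<open>The exponent i - d j is that of x^i y^j. Every exponent below d has this form in exactly
  one way with 0 <= i < d, and j counts the factors y needed to reach it.\<close>

lemma rx_eq: "d > 0 \<Longrightarrow> 0 \<le> i \<Longrightarrow> i < int d \<Longrightarrow> rx d (i - int d * int j) = j"
proof -
  assume i: "0 \<le> i" "i < int d"
  have "(i - int d * int j) div int d = - int j"
    using i by (intro int_div_pos_eq[of _ _ _ i]) (simp_all add: algebra_simps)
  then show ?thesis by (simp add: rx_def)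
qed

lemma rx_nonneg: "d > 0 \<Longrightarrow> e \<ge> 0 \<Longrightarrow> rx d e = 0"
  by (simp add: rx_def pos_imp_zdiv_nonneg_iff)

definition cusp :: "nat \<Rightarrow> nat \<Rightarrow> bp" where
  "cusp k l = zv ^ k + tv ^ l"

lemma cusp_neq_0: "k > 0 \<Longrightarrow> l > 0 \<Longrightarrow> cusp k l \<noteq> 0"
proof
  assume "k > 0" "l > 0" "cusp k l = 0"
  then have "E2 1 0 (cusp k l) = (0::complex)" by (simp add: E_hom)
  then show False using \<open>k > 0\<close> \<open>l > 0\<close> by (simp add: cusp_def zv_def tv_def E_hom zero_power)
qed

lemma der_qs: "der (\<lambda>c. q * dz c + s * dt c)"
  by (intro der_plus der_times der_dz der_dt)

text \<open>What remains of a locally nilpotent derivation in the graded ring: a nonzero homogeneous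
  field of degree n that preserves this ring and is nilpotent on its homogeneous elements.\<close>

locale graded =
  fixes d k l :: nat and n :: int and p q s :: bp
  assumes d: "d \<ge> 2" and kl: "k \<ge> 2" "l \<ge> 2" "\<not> (k = 2 \<and> l = 2)"
    and nz: "p \<noteq> 0 \<or> q \<noteq> 0 \<or> s \<noteq> 0"
    and nil: "\<And>e c. cusp k l ^ rx d e dvd c \<Longrightarrow> nilp (vf (lmon n p) (lmon n q) (lmon n s)) (lmon e c)"
    and stable: "\<And>e c. cusp k l ^ rx d e dvd c \<Longrightarrow> cusp k l ^ rx d (n + e) dvd TT p q s e c"
begin

abbreviation "r \<equiv> cusp k l"
definition "D = vf (lmon n p) (lmon n q) (lmon n s)"

lemma der_D: "der D" unfolding D_def by (rule der_vf)
lemma D_lmon: "D (lmon e c) = lmon (n + e) (TT p q s e c)" unfolding D_def by (rule vf_lmon)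
lemma nilD: "r ^ rx d e dvd c \<Longrightarrow> nilp D (lmon e c)" unfolding D_def by (rule nil)
lemma r0: "r \<noteq> 0" using kl by (simp add: cusp_neq_0)

lemma d_pos: "d > 0" using d by simp
lemmas rx_eq' = rx_eq[OF d_pos] and rx_nonneg' = rx_nonneg[OF d_pos]

lemma nilD0: "e \<ge> 0 \<Longrightarrow> nilp D (lmon e c)"
  by (rule nilD) (simp add: rx_nonneg')

text \<open>Degrees add in products and D lowers them by one, so a nonzero D f cannot be f times a
  nilpotent element.\<close>

lemma no_self_dvd:
  assumes "nilp D f" "nilp D g" "f \<noteq> 0" "D f = f * g"
  shows "g = 0"
proof (rule ccontr)
  assume "g \<noteq> 0"
  then have "ndeg D f = Suc (ndeg D f + ndeg D g)"
    using ndeg_der(2)[OF der_D assms(1)] ndeg_mult(2)[OF der_D assms(1,3,2)] assms by simp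
  then show False by simp
qed

lemma D_x: "D (lmon 1 1) = lmon (n + 1) p"
  by (simp add: D_lmon TT_def dz_simps dt_simps)

lemma p_dvd: "r ^ rx d (n + 1) dvd p"
  using stable[of 1 1] by (simp add: TT_def dz_simps dt_simps rx_nonneg')
lemma q_dvd: "r ^ rx d n dvd q"
  using stable[of 0 zv] by (simp add: TT_def rx_nonneg')
lemma s_dvd: "r ^ rx d n dvd s"
  using stable[of 0 tv] by (simp add: TT_def rx_nonneg')

lemma rigid_qs:
  assumes nilG: "\<And>f. nilp (\<lambda>c. q' * dz c + s' * dt c) f"
    and "(\<lambda>c. q' * dz c + s' * dt c) ((\<lambda>c. q' * dz c + s' * dt c) r) = 0"
  shows "q' = 0 \<and> s' = 0"
  using cusp_rigid[OF der_qs nilG zv_neq_0 tv_neq_0 cusp_def r0 assms(2) kl] by simp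

text \<open>If x is not killed, its image is no multiple of x in the graded ring, which forces n =
  -1 modulo d. On \<complex>[z,t] the derivation is then x^(d-1) y^j G with G locally nilpotent and
  G (G r) = 0, and \<open>cusp_rigid\<close> leaves only G = 0.\<close>

lemma p_0: "p = 0"
proof (rule ccontr)
  assume p: "p \<noteq> 0"
  have "\<not> r ^ rx d n dvd p"
  proof
    assume "r ^ rx d n dvd p"
    moreover have "D (lmon 1 1) = lmon 1 1 * lmon n p"
      by (simp add: D_x lmon_mult add.commute)
    ultimately show False
      using no_self_dvd[of "lmon 1 1" "lmon n p"] nilD0[of 1 1] nilD[of n p] p by simp
  qed
  with p_dvd have ne: "rx d (n + 1) \<noteq> rx d n" by auto
  define j where "j = rx d n"
  \<comment> \<open>x^(n+1) p lies in the graded ring and x^n p does not, so the required power of r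
    drops between n and n + 1. This happens only for negative n congruent to -1 modulo d.\<close>
  have nj: "n = int d - 1 - int d * int j" and jpos: "j \<ge> 1"
  proof -
    have "n div int d < 0"
    proof (rule ccontr)
      assume "\<not> n div int d < 0"
      then have "n \<ge> 0" using d by (simp add: pos_imp_zdiv_neg_iff)
      then show False using ne by (simp add: rx_nonneg')
    qed
    then have j: "int j = - (n div int d)" "j \<ge> 1" by (auto simp: j_def rx_def)
    have "n mod int d = int d - 1"
    proof (rule ccontr)
      assume "n mod int d \<noteq> int d - 1"
      moreover have "n mod int d < int d" "0 \<le> n mod int d" using d by simp_all
      ultimately have "n mod int d + 1 < int d" "0 \<le> n mod int d" by auto
      then have "(n + 1) div int d = n div int d"
        by (intro int_div_pos_eq[of _ _ _ "n mod int d + 1"]) (simp_all add: algebra_simps)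
      then show False using ne by (simp add: rx_def)
    qed
    then have "n = int d * (n div int d) + (int d - 1)" using mult_div_mod_eq[of "int d" n] by argo
    moreover have "n div int d = - int j" using j by simp
    ultimately have "n = int d * (- int j) + (int d - 1)" by metis
    then show "n = int d - 1 - int d * int j" by (simp only: mult_minus_right)
    show "j \<ge> 1" by (fact j(2))
  qed
  have n1: "n + 1 = 0 - int d * int (j - 1)" using nj jpos by (simp add: algebra_simps of_nat_diff)
  have "rx d (n + 1) = j - 1" unfolding n1 using d by (intro rx_eq') auto
  then obtain p' where p': "p = r ^ (j - 1) * p'" using p_dvd by (auto elim: dvdE)
  obtain q' where q': "q = r ^ j * q'" using q_dvd unfolding j_def by (auto elim: dvdE)
  obtain s' where s': "s = r ^ j * s'" using s_dvd unfolding j_def by (auto elim: dvdE)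
  define G where "G = (\<lambda>c. q' * dz c + s' * dt c)"
  define x where "x = lmon 1 1"
  define y where "y = lmon (- int d) r"
  have rj: "r ^ j = r * r ^ (j - 1)" using jpos by (cases j) auto
  have nx: "nilp D x" "x \<noteq> 0" by (auto simp: x_def nilD0)
  have "rx d (- int d) = 1" using rx_eq'[of 0 1] d by simp
  then have ny: "nilp D y" "y \<noteq> 0" by (auto simp: y_def r0 intro!: nilD)
  have nb: "nilp D (lmon 0 f)" for f by (rule nilD0) simp
  have T: "TT p q s (- int d) r = r ^ j * (G r - of_nat d * p')"
    unfolding TT_def p' q' s' G_def by (simp add: rj algebra_simps)
  have "rx d (n + - int d) = j + 1"
  proof -
    have "n + - int d = (int d - 1) - int d * int (j + 1)" using nj by (simp add: algebra_simps)
    then show ?thesis using rx_eq'[of "int d - 1" "j + 1"] d by (simp only:)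
  qed
  then have "r ^ (j + 1) dvd TT p q s (- int d) r"
    using stable[of "- int d" r] \<open>rx d (- int d) = 1\<close> by simp
  then obtain w where w: "TT p q s (- int d) r = r ^ (j + 1) * w" by (auto elim: dvdE)
  \<comment> \<open>By stability y divides D y, hence D y = 0; this is the identity G r = d
    p'.\<close>
  have "D y = y * lmon n (r ^ j * w)"
    unfolding y_def D_lmon w lmon_mult by (simp add: algebra_simps)
  moreover have "nilp D (lmon n (r ^ j * w))" by (rule nilD) (simp add: j_def)
  ultimately have "lmon n (r ^ j * w) = 0" using no_self_dvd ny by blast
  then have "w = 0" using r0 by simp
  with w T have Gr: "G r = of_nat d * p'" using r0 by simp
  have DG: "D (lmon 0 f) = x ^ (d - 1) * (y ^ j * lmon 0 (G f))" for f
  proof -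
    have "TT p q s 0 f = r ^ j * G f" unfolding TT_def q' s' G_def by (simp add: algebra_simps)
    then show ?thesis
      unfolding D_lmon x_def y_def lmon_power lmon_mult using d
      by (simp add: nj algebra_simps of_nat_diff)
  qed
  have deg: "ndeg D (lmon 0 f) = Suc ((d - 1) * ndeg D x + (j * ndeg D y + ndeg D (lmon 0 (G f))))"
    if "G f \<noteq> 0" for f
  proof -
    have "D (lmon 0 f) \<noteq> 0" using DG[of f] that nx ny by simp
    then have "ndeg D (lmon 0 f) = Suc (ndeg D (D (lmon 0 f)))" by (rule ndeg_der(2)[OF der_D nb])
    also have "ndeg D (D (lmon 0 f)) = (d - 1) * ndeg D x + (j * ndeg D y + ndeg D (lmon 0 (G f)))"
      unfolding DG using that nx ny nb ndeg_power[OF der_D nx] ndeg_power[OF der_D ny] ndeg_mult[OF der_D]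
      by simp
    finally show ?thesis .
  qed
  have nilG: "nilp G f" for f
  proof (induction "ndeg D (lmon 0 f)" arbitrary: f rule: less_induct)
    case less
    show ?case
    proof (cases "G f = 0")
      case True
      then have "(G ^^ 1) f = 0" by simp
      then show ?thesis unfolding nilp_def by blast
    next
      case False
      then have "nilp G (G f)" using deg by (intro less) simp
      then obtain m where "(G ^^ m) (G f) = 0" by (auto simp: nilp_def)
      then have "(G ^^ Suc m) f = 0" by (simp add: funpow_swap1)
      then show ?thesis unfolding nilp_def by blast
    qed
  qed
  have "p' \<noteq> 0" using p p' by auto
  have "lmon (n + 1) p = y ^ (j - 1) * lmon 0 p'"
    unfolding y_def lmon_power lmon_mult p' n1 by (simp add: algebra_simps)
  then have "D x = y ^ (j - 1) * lmon 0 p'" unfolding x_def D_x .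
  then have degx: "ndeg D x = Suc ((j - 1) * ndeg D y + ndeg D (lmon 0 p'))"
    using ndeg_der(2)[OF der_D nx(1)] \<open>p' \<noteq> 0\<close> ny nb ndeg_power[OF der_D ny] ndeg_mult[OF der_D]
    by simp
  \<comment> \<open>Otherwise deg p' > (d-1) deg x >= deg x > deg p'; here d >= 2 enters.\<close>
  have "G p' = 0"
  proof (rule ccontr)
    assume "G p' \<noteq> 0"
    from deg[OF this] have "ndeg D (lmon 0 p') \<ge> (d - 1) * ndeg D x" by simp
    moreover have "(d - 1) * ndeg D x \<ge> 1 * ndeg D x" using d by (intro mult_right_mono) auto
    ultimately show False using degx by simp
  qed
  moreover have "der G" unfolding G_def by (rule der_qs)
  ultimately have "G (G r) = 0" unfolding Gr by (simp add: der_mult der_of_nat)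
  with nilG have "q' = 0 \<and> s' = 0" unfolding G_def by (intro rigid_qs)
  then have "G r = 0" by (simp add: G_def)
  then show False using Gr \<open>p' \<noteq> 0\<close> calg_of_nat_neq_0[of d, where 'a=bp] d by simp
qed

text \<open>The kernel of a locally nilpotent derivation is closed under factors. A pole makes y a
  factor of x^e c, so D y = 0; by \<open>p_0\<close> this says that q d/dz + s d/dt kills r, and
  \<open>cusp_rigid\<close> makes it zero.\<close>

lemma no_kernel:
  assumes "e < 0" "c \<noteq> 0" "r ^ rx d e dvd c"
  shows "TT p q s e c \<noteq> 0"
proof
  assume T: "TT p q s e c = 0"
  define j where "j = rx d e"
  define y where "y = lmon (- int d) r"
  obtain c' where c': "c = r ^ j * c'" using assms(3) unfolding j_def by (auto elim: dvdE)
  have "e div int d < 0" using assms(1) d by (simp add: pos_imp_zdiv_neg_iff)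
  then have j: "int j = - (e div int d)" "j > 0" by (auto simp: j_def rx_def)
  have "e + int d * int j = e mod int d" using j by (simp add: algebra_simps minus_div_mult_eq_mod[symmetric])
  then have "e + int d * int j \<ge> 0" using d by simp
  then have nc: "nilp D (lmon (e + int d * int j) c')" by (rule nilD0)
  have "rx d (- int d) = 1" using rx_eq'[of 0 1] d by simp
  then have ny: "nilp D y" "y \<noteq> 0" by (auto simp: y_def r0 intro!: nilD)
  have eq: "lmon e c = y ^ j * lmon (e + int d * int j) c'"
    unfolding y_def lmon_power lmon_mult c' by simp
  have "D (lmon e c) = 0" by (simp add: D_lmon T)
  then have "ndeg D (lmon e c) = 0" by (rule ndeg_0)
  moreover have "ndeg D (lmon e c) = j * ndeg D y + ndeg D (lmon (e + int d * int j) c')"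
    unfolding eq using ndeg_mult[OF der_D _ _ nc] ndeg_power[OF der_D ny] ny assms(2) c' by simp
  ultimately have "ndeg D y = 0" using j by simp
  then have "D y = 0" by (rule ndeg_eq_0[OF der_D ny(1)])
  then have "TT p q s (- int d) r = 0" by (simp add: y_def D_lmon)
  then have G: "q * dz r + s * dt r = 0" by (simp add: TT_def p_0)
  have T0: "TT p q s e f = q * dz f + s * dt f" for e f by (simp add: TT_def p_0)
  have pow: "(D ^^ m) (lmon 0 f) = lmon (int m * n) (((\<lambda>c. q * dz c + s * dt c) ^^ m) f)" for m f
    by (induction m) (simp_all add: D_lmon T0 algebra_simps)
  have "nilp (\<lambda>c. q * dz c + s * dt c) f" for f
    using nilD0[of 0 f] unfolding nilp_def pow by simp
  then have "q = 0 \<and> s = 0" by (rule rigid_qs) (simp add: G dz_simps dt_simps)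
  then show False using nz p_0 by simp
qed

end

section \<open>The coordinate ring as a ring of Laurent series\<close>

definition emb :: "S \<Rightarrow> bp fls" where
  "emb p = fps_to_fls (fps_of_poly p)"

lemma emb_nth: "emb p $$ n = (if n < 0 then 0 else coeff p (nat n))"
  by (simp add: emb_def)

lemma emb_const: "emb [:c:] = fls_const c"
  by (rule fls_eqI) (auto simp: emb_nth coeff_pCons split: nat.split)

lemma emb_X: "emb [:0, 1:] = fls_X"
  by (rule fls_eqI) (auto simp: emb_nth coeff_pCons split: nat.split)

lemma chom_emb: "chom emb"
proof (rule chomI)
  show "emb (cst c) = cst c" for c
    by (simp add: cst_poly_def[where 'a="complex poly poly"] cst_fls_def emb_const)
qed (simp_all add: emb_def fps_of_poly_add fps_of_poly_mult fls_times_fps_to_fls)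

lemmas emb_hom = chom_simps[OF chom_emb]

lemma emb_inj: "emb p = emb q \<longleftrightarrow> p = q"
proof
  assume "emb p = emb q"
  then have "emb p $$ int n = emb q $$ int n" for n by simp
  then show "p = q" by (intro poly_eqI) (simp add: emb_nth)
qed simp

text \<open>
  The coordinate ring of \<open>x\<^sup>d y + Fx = 0\<close> is realized inside \<open>\<complex>[z,t]((x))\<close> as the subalgebra
  generated by \<open>\<complex>[x,z,t]\<close> and \<open>y = - Fx / x\<^sup>d\<close>.
\<close>

definition yF :: "nat \<Rightarrow> S \<Rightarrow> bp fls" where
  "yF d Fx = fls_shift (int d) (- emb Fx)"

lemma X_yF: "fls_X ^ d * yF d Fx = - emb Fx"
  by (simp add: yF_def fls_X_power_times_conv_shift fls_shifted_times_simps)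

lemma yF_nth: "yF d Fx $$ n = (if n < - int d then 0 else - coeff Fx (nat (n + int d)))"
  by (simp add: yF_def emb_nth)

definition Aset :: "nat \<Rightarrow> S \<Rightarrow> bp fls set" where
  "Aset d Fx = range (lift emb (yF d Fx))"

lemma chom_A: "chom (lift emb (yF d Fx))"
  by (rule chom_lift[OF chom_emb])

lemma Aset_emb: "emb p \<in> Aset d Fx"
  unfolding Aset_def by (rule range_eqI[of _ _ "[:p:]"]) (simp add: chom_emb)

lemma Aset_y: "yF d Fx \<in> Aset d Fx"
  unfolding Aset_def by (rule range_eqI[of _ _ "[:0, 1:]"]) (simp add: chom_emb)

lemma Aset_add: "f \<in> Aset d Fx \<Longrightarrow> g \<in> Aset d Fx \<Longrightarrow> f + g \<in> Aset d Fx"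
  unfolding Aset_def using chom_add[OF chom_A, symmetric] by auto

lemma Aset_mult: "f \<in> Aset d Fx \<Longrightarrow> g \<in> Aset d Fx \<Longrightarrow> f * g \<in> Aset d Fx"
  unfolding Aset_def using chom_mult[OF chom_A, symmetric] by auto

lemma Aset_power: "f \<in> Aset d Fx \<Longrightarrow> f ^ n \<in> Aset d Fx"
proof (induction n)
  case 0
  show ?case using Aset_emb[of 1] by (simp add: emb_hom)
qed (simp add: Aset_mult)

lemma Aset_induct [consumes 1, case_names emb y add mult]:
  assumes "f \<in> Aset d Fx" "\<And>p. P (emb p)" "P (yF d Fx)"
    "\<And>f g. f \<in> Aset d Fx \<Longrightarrow> g \<in> Aset d Fx \<Longrightarrow> P f \<Longrightarrow> P g \<Longrightarrow> P (f + g)"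
    "\<And>f g. f \<in> Aset d Fx \<Longrightarrow> g \<in> Aset d Fx \<Longrightarrow> P f \<Longrightarrow> P g \<Longrightarrow> P (f * g)"
  shows "P f"
proof -
  obtain h where "f = lift emb (yF d Fx) h" using assms(1) by (auto simp: Aset_def)
  moreover have "P (lift emb (yF d Fx) h)"
  proof (induction h rule: poly_gen_induct)
    case (const c) show ?case using assms(2) by (simp add: chom_emb)
  next
    case var show ?case using assms(3) by (simp add: chom_emb)
  next
    case (add p q) then show ?case by (simp only: chom_add[OF chom_A]) (rule assms(4), auto simp: Aset_def)
  next
    case (mult p q) then show ?case by (simp only: chom_mult[OF chom_A]) (rule assms(5), auto simp: Aset_def)
  qed
  ultimately show ?thesis by simp
qed

section \<open>Leading terms in the coordinate ring\<close>

lemma lift_A_lower: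
  "degree h \<le> N \<Longrightarrow> i < - int d * int N \<Longrightarrow> lift emb (yF d Fx) h $$ i = 0"
proof (induction h arbitrary: N i)
  case (pCons c h)
  have "int d * int N \<ge> 0" by simp
  then have "i < 0" using pCons(4) by linarith
  then have c: "emb c $$ i = 0" by (simp add: emb_nth)
  have "(yF d Fx * lift emb (yF d Fx) h) $$ i = 0"
  proof (cases "h = 0")
    case False
    then obtain M where M: "N = Suc M" "degree h \<le> M" using pCons(3) by (cases N) auto
    show ?thesis
      by (rule fls_times_nth_0[of "- int d" _ "- int d * int M"])
        (use pCons M in \<open>auto simp: yF_nth algebra_simps\<close>)
  qed simp
  with c show ?case by (simp add: lift_pCons chom_emb)
qed simp

lemma yF_power_lead:
  "(\<forall>i < - int d * int N. (yF d Fx ^ N) $$ i = 0) \<and> (yF d Fx ^ N) $$ (- int d * int N) = (- coeff Fx 0) ^ N"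
proof (induction N)
  case (Suc N)
  have y: "i < - int d \<Longrightarrow> yF d Fx $$ i = 0" for i by (simp add: yF_nth)
  have e: "- int d * int (Suc N) = - int d + - int d * int N" by (simp add: algebra_simps)
  show ?case
    unfolding power_Suc e using fls_times_nth_lead[OF y, where b = "- int d * int N" and g = "yF d Fx ^ N"]
      fls_times_nth_0[OF y, where b = "- int d * int N" and g = "yF d Fx ^ N"] Suc
    by (auto simp: yF_nth)
qed simp

lemma poly_split_monom: fixes c :: "'a::comm_ring_1 poly"
  obtains c0 c1 where "c = c0 + monom 1 d * c1" "\<And>i. i \<ge> d \<Longrightarrow> coeff c0 i = 0"
proof
  show "c = poly_cutoff d c + monom 1 d * poly_shift d c"
    by (rule poly_eqI) (simp add: coeff_poly_cutoff coeff_monom_mult coeff_poly_shift)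
  show "coeff (poly_cutoff d c) i = 0" if "i \<ge> d" for i
    using that by (simp add: coeff_poly_cutoff)
qed

lemma emb_monom_1: "emb (monom 1 d) = fls_X ^ d"
  by (simp add: monom_altdef emb_hom emb_X)

text \<open>
  Modulo \<open>x\<^sup>d y + Fx\<close> the coefficients of the positive powers of \<open>y\<close> can be taken of degree less
  than \<open>d\<close> in \<open>x\<close>; then no two powers of \<open>y\<close> contribute to the same leading term.
\<close>

lemma A_lead:
  assumes d: "d > 0" and Fx: "coeff Fx 0 \<noteq> 0" and f: "f \<in> Aset d Fx" and z: "\<And>i. i < e \<Longrightarrow> f $$ i = 0"
  shows "coeff Fx 0 ^ rx d e dvd f $$ e"
proof -
  let ?y = "yF d Fx"
  have "\<And>e. (\<And>i. i < e \<Longrightarrow> lift emb ?y h $$ i = 0) \<Longrightarrow> coeff Fx 0 ^ rx d e dvd lift emb ?y h $$ e"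
    if "degree h \<le> N" for h N
    using that
  proof (induction N arbitrary: h)
    case 0
    then obtain c where "h = [:c:]" by (auto elim: degree_eq_zeroE)
    then show ?case using d by (cases "e < 0") (simp_all add: chom_emb emb_nth rx_nonneg)
  next
    case (Suc N)
    define c where "c = coeff h (Suc N)"
    define h1 where "h1 = h - monom c (Suc N)"
    have h1: "degree h1 \<le> N"
    proof (rule degree_le, intro allI impI)
      fix i assume "N < i"
      then show "coeff h1 i = 0"
        using Suc.prems by (cases "i = Suc N") (auto simp: h1_def c_def coeff_eq_0)
    qed
    obtain c0 c1 where c: "c = c0 + monom 1 d * c1" and c0: "\<And>i. i \<ge> d \<Longrightarrow> coeff c0 i = 0"
      using poly_split_monom[of c d] by blast
    define h2 where "h2 = h1 - monom (c1 * Fx) N"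
    have h2: "degree h2 \<le> N" unfolding h2_def using h1
      by (intro degree_diff_le) (auto simp: degree_monom_le)
    have mon: "lift emb ?y (monom b m) = emb b * ?y ^ m" for b m
    proof -
      have "monom b m = [:b:] * [:0,1:] ^ m" by (simp add: monom_altdef)
      then show ?thesis by (simp only: chom_mult[OF chom_A] chom_power[OF chom_A] lift_const[OF chom_emb] lift_X[OF chom_emb])
    qed
    have "lift emb ?y h = emb c * ?y ^ Suc N + lift emb ?y h1"
      by (simp add: h1_def chom_diff[OF chom_A] mon)
    \<comment> \<open>The relation x^d y = - Fx turns the part c1 of the top coefficient into a term
      with one factor y less.\<close>
    also have "emb c * ?y ^ Suc N = emb c0 * ?y ^ Suc N + emb c1 * (fls_X ^ d * ?y) * ?y ^ N"
      by (simp add: c emb_hom emb_monom_1 algebra_simps)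
    also have "\<dots> = emb c0 * ?y ^ Suc N - emb (c1 * Fx) * ?y ^ N"
      by (simp only: X_yF) (simp add: emb_hom)
    finally have f: "lift emb ?y h = emb c0 * ?y ^ Suc N + lift emb ?y h2"
      by (simp add: h2_def chom_diff[OF chom_A] mon)
    show ?case
    proof (cases "c0 = 0")
      case True
      with Suc(1)[OF _ h2, of e] Suc.prems(1) f show ?thesis by (simp add: emb_hom)
    next
      case False
      define i where "i = (LEAST i. coeff c0 i \<noteq> 0)"
      have "\<exists>i. coeff c0 i \<noteq> 0" using False by (auto simp: poly_eq_iff)
      then have i: "coeff c0 i \<noteq> 0" unfolding i_def by (rule LeastI_ex)
      have i0: "coeff c0 m = 0" if "m < i" for m using not_less_Least[of m] that unfolding i_def by blast
      have id: "i < d" using i c0 by (meson not_le_imp_less)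
      define e0 where "e0 = int i - int d * int (Suc N)"
      have ee: "e0 = int i + (- int d * int (Suc N))" by (simp add: e0_def)
      have z1: "m < int i \<Longrightarrow> emb c0 $$ m = 0" for m using i0 by (simp add: emb_nth)
      have z2: "m < - int d * int (Suc N) \<Longrightarrow> (?y ^ Suc N) $$ m = 0" for m
        using yF_power_lead[of d "Suc N" Fx] by blast
      \<comment> \<open>Since i < d, the order of c0 y^(N+1) lies below the bound -d N for
        polynomials of degree N in y, so its leading term cannot cancel.\<close>
      have "e0 < - int d * int N" using id by (simp add: e0_def algebra_simps)
      then have z3: "m \<le> e0 \<Longrightarrow> lift emb ?y h2 $$ m = 0" for m using lift_A_lower[OF h2] by simp
      have lead: "lift emb ?y h $$ e0 = coeff c0 i * (- coeff Fx 0) ^ Suc N"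
        unfolding f using z3[of e0] fls_times_nth_lead[where a = "int i" and b = "- int d * int (Suc N)" and f = "emb c0" and g = "?y ^ Suc N", OF z1 z2] yF_power_lead[of d "Suc N" Fx]
        by (simp add: ee emb_nth del: power_Suc)
      have low: "lift emb ?y h $$ m = 0" if "m < e0" for m
        unfolding f using z3[of m] fls_times_nth_0[where a = "int i" and b = "- int d * int (Suc N)" and f = "emb c0" and g = "?y ^ Suc N" and n = m, OF z1 z2] that by (simp add: ee)
      consider "e < e0" | "e = e0" | "e > e0" by linarith
      then show ?thesis
      proof cases
        case 1 then show ?thesis using low by simp
      next
        case 2
        have "rx d e0 = Suc N" unfolding e0_def using id d by (intro rx_eq) auto
        moreover have "coeff Fx 0 ^ Suc N dvd (- coeff Fx 0) ^ Suc N"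
          by (metis dvd_refl minus_dvd_iff dvd_minus_iff dvd_power_same)
        ultimately show ?thesis unfolding 2 lead by simp
      next
        case 3
        then have "lift emb ?y h $$ e0 = 0" using Suc.prems(1) by blast
        then show ?thesis using lead i Fx by simp
      qed
    qed
  qed
  then show ?thesis using f z by (auto simp: Aset_def)
qed


lemma Aset_bounded:
  assumes "f \<in> Aset d Fx"
  shows "\<exists>N p. fls_X ^ N * f = emb p"
  using assms
proof (induction rule: Aset_induct)
  case (emb p)
  show ?case by (rule exI[of _ 0]) auto
next
  case y
  show ?case using X_yF[of d Fx] by (metis chom_minus[OF chom_emb])
next
  case (add f g)
  then obtain N p M q where "fls_X ^ N * f = emb p" "fls_X ^ M * g = emb q" by blast
  then have "fls_X ^ (N + M) * (f + g) = emb ([:0,1:] ^ M * p + [:0,1:] ^ N * q)"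
    by (simp only: emb_hom emb_X power_add distrib_left flip: \<open>fls_X ^ N * f = emb p\<close> \<open>fls_X ^ M * g = emb q\<close>)
      (simp only: ac_simps)
  then show ?case by blast
next
  case (mult f g)
  then obtain N p M q where "fls_X ^ N * f = emb p" "fls_X ^ M * g = emb q" by blast
  then have "fls_X ^ (N + M) * (f * g) = emb (p * q)"
    by (simp only: emb_hom power_add flip: \<open>fls_X ^ N * f = emb p\<close> \<open>fls_X ^ M * g = emb q\<close>)
      (simp only: ac_simps)
  then show ?case by blast
qed

lemma Aset_nonneg:
  assumes "f \<in> Aset d Fx" "\<And>i. i < 0 \<Longrightarrow> f $$ i = 0"
  shows "\<exists>p. f = emb p"
proof -
  obtain N p where N: "fls_X ^ N * f = emb p" using Aset_bounded[OF assms(1)] by blast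
  have nth: "f $$ i = emb p $$ (i + int N)" for i
    using arg_cong[OF N, of "\<lambda>h. h $$ (i + int N)"] by (simp add: fls_X_power_times_conv_shift)
  have "f = emb (poly_shift N p)"
  proof (rule fls_eqI)
    fix i
    show "f $$ i = emb (poly_shift N p) $$ i"
      using nth[of i] assms(2)[of i] by (cases "i < 0") (simp_all add: emb_nth coeff_poly_shift nat_add_distrib add.commute)
  qed
  then show ?thesis ..
qed

text \<open>A pole of order m between 1 and d has a leading coefficient divisible by r, so a
  multiple of x^(d-m) y removes it. Applied to the image of y under an isomorphism, this yields the
  statement about the ideal generated by F and x^d.\<close>

lemma Aset_le_d:
  assumes d: "d > 0" and Fx: "coeff Fx 0 \<noteq> 0"
  shows "m \<le> d \<Longrightarrow> f \<in> Aset d Fx \<Longrightarrow> (\<And>i. i < - int m \<Longrightarrow> f $$ i = 0) \<Longrightarrow> \<exists>p h. f = emb p + emb h * yF d Fx"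
proof (induction m arbitrary: f)
  case 0
  then obtain p where "f = emb p" using Aset_nonneg[of f d Fx] by auto
  then have "f = emb p + emb 0 * yF d Fx" by (simp add: emb_hom)
  then show ?case by blast
next
  case (Suc m)
  have "rx d (int (d - Suc m) - int d * int 1) = 1" using Suc(2) d by (intro rx_eq) auto
  then have rx: "rx d (- int (Suc m)) = 1" using Suc(2) by (simp add: of_nat_diff)
  obtain c where c: "f $$ (- int (Suc m)) = coeff Fx 0 * c"
    using A_lead[OF d Fx Suc(3), of "- int (Suc m)"] Suc(4) unfolding rx power_one_right by (auto elim!: dvdE)
  define b where "b = monom c (d - Suc m)"
  have b0: "i < int (d - Suc m) \<Longrightarrow> emb b $$ i = 0" for i by (cases "i < 0") (auto simp: b_def emb_nth)
  have y0: "i < - int d \<Longrightarrow> yF d Fx $$ i = 0" for i by (simp add: yF_nth)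
  have dm: "- int (Suc m) = int (d - Suc m) + - int d" using Suc(2) by (simp add: of_nat_diff)
  have lead: "(emb b * yF d Fx) $$ - int (Suc m) = - (coeff Fx 0 * c)"
    unfolding dm
    by (rule trans[OF fls_times_nth_lead[where a = "int (d - Suc m)" and b = "- int d", OF b0 y0]])
      (simp_all add: b_def emb_nth yF_nth)
  have low: "(emb b * yF d Fx) $$ i = 0" if "i < - int (Suc m)" for i
    by (rule fls_times_nth_0[where a = "int (d - Suc m)" and b = "- int d", OF b0 y0]) (use that dm in linarith)+
  have "\<exists>p h. f + emb b * yF d Fx = emb p + emb h * yF d Fx"
  proof (rule Suc(1))
    show "f + emb b * yF d Fx \<in> Aset d Fx" using Suc(3) by (intro Aset_add Aset_mult Aset_emb Aset_y)
    show "(f + emb b * yF d Fx) $$ i = 0" if "i < - int m" for i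
    proof (cases "i = - int (Suc m)")
      case True then show ?thesis using c lead by simp
    next
      case False
      then have "i < - int (Suc m)" using that by simp
      then show ?thesis using low Suc(4) by simp
    qed
  qed (use Suc(2) in simp)
  then obtain p h where "f + emb b * yF d Fx = emb p + emb h * yF d Fx" by blast
  then have "f = emb p + emb (h - b) * yF d Fx" by (simp add: emb_hom algebra_simps)
  then show ?case by blast
qed

section \<open>Leading parts of locally nilpotent derivations of the coordinate ring\<close>

locale A_lnd =
  fixes d k l :: nat and Fx :: S and D :: "bp fls \<Rightarrow> bp fls"
  assumes d: "d \<ge> 2" and kl: "k \<ge> 2" "l \<ge> 2" "\<not> (k = 2 \<and> l = 2)" and F0: "coeff Fx 0 = cusp k l"
    and D_A: "f \<in> Aset d Fx \<Longrightarrow> D f \<in> Aset d Fx"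
    and D_cst: "D (cst c) = 0"
    and D_add: "f \<in> Aset d Fx \<Longrightarrow> g \<in> Aset d Fx \<Longrightarrow> D (f + g) = D f + D g"
    and D_mult: "f \<in> Aset d Fx \<Longrightarrow> g \<in> Aset d Fx \<Longrightarrow> D (f * g) = D f * g + f * D g"
    and D_nil: "f \<in> Aset d Fx \<Longrightarrow> \<exists>n. (D ^^ n) f = 0"
    and D_nz: "\<exists>f\<in>Aset d Fx. D f \<noteq> 0"
begin

abbreviation "A \<equiv> Aset d Fx"

lemma F_nz: "coeff Fx 0 \<noteq> 0" using kl by (simp add: F0 cusp_neq_0)

text \<open>D x divided by x, because \<open>vf\<close> pairs its first argument with the Euler
  field.\<close>

definition "P = fls_shift 1 (D fls_X)"
definition "Q = D (fls_const zv)"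
definition "T = D (fls_const tv)"

lemma X_P: "fls_X * P = D fls_X"
  by (simp add: P_def fls_shifted_times_simps fls_X_times_conv_shift)

lemma vf_vars: "vf P Q T fls_X = D fls_X" "vf P Q T (fls_const zv) = D (fls_const zv)"
  "vf P Q T (fls_const tv) = D (fls_const tv)"
proof -
  have m: "fls_map h (fls_const c) = fls_const (h c)" "fls_map h fls_X = fls_X * fls_const (h 1)" if "h 0 = 0" for h :: "bp \<Rightarrow> bp" and c
    using that by (auto intro!: fls_eqI simp: fls_map_nth fls_X_times_conv_shift)
  show "vf P Q T fls_X = D fls_X" "vf P Q T (fls_const zv) = D (fls_const zv)"
  "vf P Q T (fls_const tv) = D (fls_const tv)"
    by (simp_all add: vf_def m dz_simps dt_simps X_P[symmetric] Q_def T_def mult.commute)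
qed

lemma D_vf_emb: "D (emb p) = vf P Q T (emb p)"
proof (induction p rule: S_induct)
  case (const c)
  then show ?case by (simp add: emb_hom D_cst der_simps[OF der_vf])
next
  case (add p q) then show ?case by (simp add: emb_hom D_add Aset_emb der_simps[OF der_vf])
next
  case (mult p q) then show ?case by (simp add: emb_hom D_mult Aset_emb der_simps[OF der_vf])
qed (use vf_vars in \<open>simp_all add: emb_const emb_X flip: zv_def tv_def\<close>)

text \<open>The values on x, z, t determine the value on y too: x^d y is a polynomial and x^d is not
  a zero divisor.\<close>

lemma D_vf: "f \<in> A \<Longrightarrow> D f = vf P Q T f"
proof (induction rule: Aset_induct)
  case (emb p) show ?case by (rule D_vf_emb)
next
  case y
  let ?y = "yF d Fx" and ?X = "emb (monom 1 d)"
  have e: "?X * ?y = emb (- Fx)" by (simp add: emb_monom_1 X_yF emb_hom)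
  have "D (?X * ?y) = vf P Q T (?X * ?y)" unfolding e by (rule D_vf_emb)
  then have "D ?X * ?y + ?X * D ?y = vf P Q T ?X * ?y + ?X * vf P Q T ?y"
    by (simp add: D_mult Aset_emb Aset_y der_mult[OF der_vf])
  then have "?X * D ?y = ?X * vf P Q T ?y" by (simp add: D_vf_emb)
  moreover have "?X \<noteq> 0" by (simp add: emb_monom_1)
  ultimately show ?case by simp
qed (simp_all add: D_add D_mult der_simps[OF der_vf])

text \<open>Converse of \<open>A_lead\<close>: a multiple of x^i y^j does it, where (-1)^j
  compensates the leading coefficient -r of y.\<close>

lemma lead_exists:
  assumes "cusp k l ^ rx d e dvd c"
  shows "\<exists>f\<in>A. (\<forall>i<e. f $$ i = 0) \<and> f $$ e = c"
proof -
  define j where "j = rx d e"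
  obtain c' where c': "c = cusp k l ^ j * c'" using assms by (auto simp: j_def elim: dvdE)
  have "e + int d * int j \<ge> 0"
  proof (cases "e \<ge> 0")
    case False
    then have "e div int d < 0" using d by (simp add: pos_imp_zdiv_neg_iff)
    then have "int j = - (e div int d)" by (simp add: j_def rx_def)
    then have "e + int d * int j = e mod int d" by (simp add: minus_mult_div_eq_mod[symmetric])
    then show ?thesis using d by simp
  qed simp
  then obtain i where i: "e + int d * int j = int i" using nonneg_int_cases by blast
  define g where "g = emb (monom ((-1) ^ j * c') i)"
  have z1: "m < int i \<Longrightarrow> g $$ m = 0" for m by (cases "m < 0") (auto simp: g_def emb_nth)
  have z2: "m < - int d * int j \<Longrightarrow> (yF d Fx ^ j) $$ m = 0" for m using yF_power_lead[of d j Fx] by blast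
  have e: "e = int i + - int d * int j" using i by simp
  have "(g * yF d Fx ^ j) $$ e = ((-1) ^ j * c') * (- cusp k l) ^ j"
    unfolding e using fls_times_nth_lead[where a = "int i" and b = "- int d * int j" and f = g and g = "yF d Fx ^ j", OF z1 z2] yF_power_lead[of d j Fx]
    by (simp add: g_def emb_nth F0)
  also have "\<dots> = c"
    unfolding c' power_minus[of "cusp k l"] by (simp add: algebra_simps flip: power_add)
  finally have "(g * yF d Fx ^ j) $$ e = c" .
  moreover have "(g * yF d Fx ^ j) $$ m = 0" if "m < e" for m
    using fls_times_nth_0[where a = "int i" and b = "- int d * int j" and f = g and g = "yF d Fx ^ j", OF z1 z2] that e by simp
  moreover have "g * yF d Fx ^ j \<in> A" unfolding g_def by (intro Aset_mult Aset_emb Aset_power Aset_y)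
  ultimately show ?thesis by blast
qed

text \<open>For the least order n of P, Q and T, their coefficients at n satisfy
  \<open>graded\<close>. An element of the kernel with a pole would have a leading term killed by
  this leading part, against \<open>no_kernel\<close>.\<close>

theorem kernel_nonneg:
  assumes f: "f \<in> A" and Df: "D f = 0"
  shows "\<exists>p. f = emb p"
proof (rule Aset_nonneg[OF f])
  define M where "M = {P, Q, T} - {0}"
  have "M \<noteq> {}"
  proof
    assume "M = {}"
    then have "P = 0" "Q = 0" "T = 0" by (auto simp: M_def)
    then show False using D_nz D_vf by (simp add: vf_def)
  qed
  define n where "n = Min (fls_subdegree ` M)"
  have fin: "finite (fls_subdegree ` M)" by (simp add: M_def)
  then have "n \<in> fls_subdegree ` M" unfolding n_def using \<open>M \<noteq> {}\<close> by (intro Min_in) auto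
  then obtain h where h: "h \<in> M" "n = fls_subdegree h" by auto
  have low: "i < n \<Longrightarrow> h $$ i = 0" if "h \<in> {P, Q, T}" for h i
  proof -
    assume i: "i < n"
    show "h $$ i = 0"
    proof (cases "h = 0")
      case False
      then have "n \<le> fls_subdegree h" unfolding n_def using fin that by (intro Min_le) (auto simp: M_def)
      then show ?thesis using i by simp
    qed simp
  qed
  define p where "p = P $$ n"
  define q where "q = Q $$ n"
  define s where "s = T $$ n"
  have lead: "(\<forall>i<n + e. D g $$ i = 0) \<and> D g $$ (n + e) = TT p q s e (g $$ e)"
    if "g \<in> A" "\<forall>i<e. g $$ i = 0" for g e
    unfolding D_vf[OF that(1)] p_def q_def s_def
    using vf_lead[where n = n and P = P and Q = Q and T = T and f = g and e = e] vf_lead_0[where n = n and P = P and Q = Q and T = T and f = g and e = e] low that(2) by blast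
  interpret graded d k l n p q s
  proof
    show "p \<noteq> 0 \<or> q \<noteq> 0 \<or> s \<noteq> 0"
      using h nth_fls_subdegree_nonzero[of h] unfolding p_def q_def s_def M_def by auto
    fix e c assume "cusp k l ^ rx d e dvd c"
    then obtain g where g: "g \<in> A" "\<forall>i<e. g $$ i = 0" "g $$ e = c" using lead_exists by blast
    \<comment> \<open>The coefficient of D^m g at m n + e may be zero; the claim is only that it
      agrees with the iterate of the leading part.\<close>
    have iter: "(D ^^ m) g \<in> A \<and> (\<forall>i<int m * n + e. (D ^^ m) g $$ i = 0) \<and>
        (vf (lmon n p) (lmon n q) (lmon n s) ^^ m) (lmon e c) = lmon (int m * n + e) ((D ^^ m) g $$ (int m * n + e))" for m
    proof (induction m)
      case (Suc m)
      have e: "int (Suc m) * n + e = n + (int m * n + e)" by (simp add: algebra_simps)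
      show ?case unfolding e using Suc lead[of "(D ^^ m) g" "int m * n + e"] by (simp add: D_A vf_lmon)
    qed (use g in simp)
    obtain m where "(D ^^ m) g = 0" using D_nil[OF g(1)] by blast
    then show "nilp (vf (lmon n p) (lmon n q) (lmon n s)) (lmon e c)"
      unfolding nilp_def using iter[of m] by auto
    have "coeff Fx 0 ^ rx d (n + e) dvd D g $$ (n + e)"
      using lead[OF g(1,2)] d by (intro A_lead[OF _ F_nz D_A[OF g(1)]]) auto
    then show "cusp k l ^ rx d (n + e) dvd TT p q s e c" using lead[OF g(1,2)] g(3) by (simp add: F0)
  qed (use d kl in auto)
  have sub: "fls_subdegree f \<ge> 0"
  proof (rule ccontr)
    assume neg: "\<not> fls_subdegree f \<ge> 0"
    let ?e = "fls_subdegree f"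
    have f0: "f \<noteq> 0" using neg by auto
    have "cusp k l ^ rx d ?e dvd f $$ ?e"
      using A_lead[OF _ F_nz f, of ?e] d by (simp add: F0)
    then have "TT p q s ?e (f $$ ?e) \<noteq> 0" using no_kernel neg f0 by simp
    moreover have "D f $$ (n + ?e) = TT p q s ?e (f $$ ?e)" using lead[OF f, of ?e] by simp
    ultimately show False by (simp add: Df)
  qed
  show "f $$ i = 0" if "i < 0" for i using sub that by simp
qed

end

section \<open>Isomorphisms of hypersurfaces and their pullbacks\<close>

lemma E1_eq_poly: "E1 a p = poly p a" for a :: complex
  by (simp add: E1_def lift_def map_poly_idI)

lemma E2_eq_0:
  assumes "\<And>z t :: complex. E2 z t p = 0"
  shows "p = 0"
proof -
  have "map_poly (E1 z) p = 0" for z :: complex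
    using assms[of z] poly_all_0_iff_0[of "map_poly (E1 z) p"] by (simp add: E2_def lift_def)
  then have "coeff (map_poly (E1 z) p) n = 0" for z :: complex and n by simp
  then have "poly (coeff p n) z = 0" for z n by (simp add: coeff_map_poly E_hom E1_eq_poly)
  then have "coeff p n = 0" for n using poly_all_0_iff_0 by blast
  then show ?thesis by (simp add: poly_eq_iff)
qed

text \<open>Points with nonzero x suffice, and over these the hypersurface always has a
  point.\<close>

lemma E3_eq_0:
  assumes "\<And>x z t :: complex. x \<noteq> 0 \<Longrightarrow> E3 z t x p = 0"
  shows "p = 0"
proof -
  have "map_poly (E2 z t) p = 0" for z t :: complex
  proof (rule ccontr)
    assume "map_poly (E2 z t) p \<noteq> 0"
    then have "finite {x. poly (map_poly (E2 z t) p) x = 0}" by (rule poly_roots_finite)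
    moreover have "- {0} \<subseteq> {x. poly (map_poly (E2 z t) p) x = 0}"
      using assms[of _ z t] by (auto simp: E3_def lift_def)
    ultimately have "finite (- {0::complex})" by (rule finite_subset[rotated])
    then show False by (simp add: finite_compl infinite_UNIV_char_0)
  qed
  then have "coeff (map_poly (E2 z t) p) n = 0" for z t :: complex and n by simp
  then have "E2 z t (coeff p n) = 0" for z t :: complex and n by (simp add: coeff_map_poly E_hom)
  then have "coeff p n = 0" for n by (intro E2_eq_0)
  then show ?thesis by (simp add: poly_eq_iff)
qed

lemma chom_eval_xyzt: "chom (\<lambda>p. eval_xyzt p v)"
  by (cases v, rule chomI) (simp_all add: cst_poly_def)

lemma eval_xyzt_E4: "eval_xyzt p (x, y, z, t) = E4 x y z t p"
  using chom_E4_eq[OF chom_eval_xyzt[of "(x, y, z, t)"], of p] by simp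

definition VF :: "nat \<Rightarrow> S \<Rightarrow> A4 set" where
  "VF d Fx = {(x, y, z, t). x ^ d * y + E3 z t x Fx = 0}"

text \<open>Restriction of polynomial functions to the hypersurface, with values in the Laurent
  series model of the coordinate ring.\<close>

definition iota :: "nat \<Rightarrow> S \<Rightarrow> poly_xyzt \<Rightarrow> bp fls" where
  "iota d Fx = E4 fls_X (yF d Fx) (fls_const zv) (fls_const tv)"

lemma chom_iota: "chom (iota d Fx)"
  unfolding iota_def by (rule chom_E4)

lemmas iota_hom = chom_simps[OF chom_iota]

lemma iota_vars [simp]:
  "iota d Fx [:[:[:[:0,1:]:]:]:] = fls_X" "iota d Fx [:[:[:0,1:]:]:] = yF d Fx"
  "iota d Fx [:[:0,1:]:] = fls_const zv" "iota d Fx [:0,1:] = fls_const tv"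
  by (simp_all add: iota_def)

lemma iota_in_A: "iota d Fx p \<in> Aset d Fx"
proof (induction p rule: P4_induct)
  case (const c)
  show ?case using Aset_emb[of "cst c"] by (simp add: iota_hom emb_hom)
next
  case x show ?case using Aset_emb[of "[:0,1:]"] by (simp add: emb_X)
next
  case z show ?case using Aset_emb[of "[:zv:]"] by (simp add: emb_const)
next
  case t show ?case using Aset_emb[of "[:tv:]"] by (simp add: emb_const)
qed (simp_all add: iota_hom Aset_y Aset_add Aset_mult)

text \<open>The inclusion of \<open>S\<close> into the polynomials in four variables; it also has to
  change the nesting order of the variables.\<close>

definition up :: "S \<Rightarrow> poly_xyzt" where
  "up = E3 [:[:0,1:]:] [:0,1:] [:[:[:[:0,1:]:]:]:]"

lemma iota_up: "iota d Fx (up p) = emb p"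
  by (induction p rule: S_induct) (simp_all add: up_def E_hom iota_hom emb_hom emb_const emb_X zv_def tv_def)

lemma E4_up: "E4 x y z t (up p) = E3 z t x p"
  unfolding up_def by (simp add: chom_E3_comp[OF chom_E4])

lemma A_iota:
  assumes "f \<in> Aset d Fx" shows "\<exists>p. f = iota d Fx p"
  using assms
proof (induction rule: Aset_induct)
  case (emb p) show ?case by (rule exI[of _ "up p"]) (simp add: iota_up)
next
  case y show ?case by (rule exI[of _ "[:[:[:0,1:]:]:]"]) simp
next
  case (add f g) then show ?case by (metis iota_hom(2))
next
  case (mult f g) then show ?case by (metis iota_hom(3))
qed

text \<open>One power of x and one polynomial q clear the denominators both in the Laurent series
  and at the points, which links the two meanings of vanishing on the hypersurface.\<close>

lemma iota_clear:
  "\<exists>N q. fls_X ^ N * iota d Fx p = emb q \<and> (\<forall>x y z t. (x, y, z, t) \<in> VF d Fx \<longrightarrow> E3 z t x q = x ^ N * E4 x y z t p)"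
proof (induction p rule: P4_induct)
  case (const c)
  show ?case by (rule exI[of _ 0], rule exI[of _ "cst c"]) (simp add: iota_hom emb_hom E_hom)
next
  case x
  show ?case by (rule exI[of _ 0], rule exI[of _ "[:0,1:]"]) (simp add: emb_X)
next
  case z
  show ?case by (rule exI[of _ 0], rule exI[of _ "[:zv:]"]) (simp add: emb_const zv_def)
next
  case t
  show ?case by (rule exI[of _ 0], rule exI[of _ "[:tv:]"]) (simp add: emb_const tv_def)
next
  case y
  show ?case by (rule exI[of _ d], rule exI[of _ "- Fx"])
      (auto simp: X_yF emb_hom E_hom VF_def neg_eq_iff_add_eq_0 add.commute)
next
  case (add p q)
  then obtain N p' M q' where
    1: "fls_X ^ N * iota d Fx p = emb p'" "\<And>x y z t. (x, y, z, t) \<in> VF d Fx \<Longrightarrow> E3 z t x p' = x ^ N * E4 x y z t p"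
    "fls_X ^ M * iota d Fx q = emb q'" "\<And>x y z t. (x, y, z, t) \<in> VF d Fx \<Longrightarrow> E3 z t x q' = x ^ M * E4 x y z t q"
    by blast
  show ?case
  proof (rule exI[of _ "N + M"], rule exI[of _ "[:0,1:] ^ M * p' + [:0,1:] ^ N * q'"], intro conjI allI impI)
    show "fls_X ^ (N + M) * iota d Fx (p + q) = emb ([:0,1:] ^ M * p' + [:0,1:] ^ N * q')"
      by (simp only: iota_hom emb_hom emb_X power_add distrib_left flip: 1) (simp only: ac_simps)
  qed (simp add: E_hom 1 power_add algebra_simps)
next
  case (mult p q)
  then obtain N p' M q' where
    1: "fls_X ^ N * iota d Fx p = emb p'" "\<And>x y z t. (x, y, z, t) \<in> VF d Fx \<Longrightarrow> E3 z t x p' = x ^ N * E4 x y z t p"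
    "fls_X ^ M * iota d Fx q = emb q'" "\<And>x y z t. (x, y, z, t) \<in> VF d Fx \<Longrightarrow> E3 z t x q' = x ^ M * E4 x y z t q"
    by blast
  show ?case
  proof (rule exI[of _ "N + M"], rule exI[of _ "p' * q'"], intro conjI allI impI)
    show "fls_X ^ (N + M) * iota d Fx (p * q) = emb (p' * q')"
      by (simp only: iota_hom emb_hom power_add flip: 1) (simp only: ac_simps)
  qed (simp add: E_hom 1 power_add algebra_simps)
qed

text \<open>Takes the place of the Nullstellensatz: the cleared polynomial vanishes wherever x is
  nonzero, hence identically.\<close>

lemma iota_eq_0I:
  assumes "\<And>x y z t. (x, y, z, t) \<in> VF d Fx \<Longrightarrow> E4 x y z t p = 0"
  shows "iota d Fx p = 0"
proof -
  obtain N q where q: "fls_X ^ N * iota d Fx p = emb q"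
    "\<And>x y z t. (x, y, z, t) \<in> VF d Fx \<Longrightarrow> E3 z t x q = x ^ N * E4 x y z t p"
    using iota_clear by blast
  have "q = 0"
  proof (rule E3_eq_0)
    fix x z t :: complex assume "x \<noteq> 0"
    then have "(x, - E3 z t x Fx / x ^ d, z, t) \<in> VF d Fx" by (simp add: VF_def)
    with q(2) assms show "E3 z t x q = 0" by simp
  qed
  then show ?thesis using q(1) by (simp add: emb_hom)
qed

text \<open>As in \<open>A_lead\<close>, subtracting a multiple of x^d y + Fx leaves a top
  coefficient c0 of degree less than d in x. A nonzero c0 would contribute a term of lower order
  than all the others, so the value could not be zero.\<close>

lemma lift_A_kernel:
  assumes d: "d > 0" and F0: "coeff Fx 0 \<noteq> 0"
  shows "degree h \<le> N \<Longrightarrow> lift emb (yF d Fx) h = 0 \<Longrightarrow> [:Fx, monom 1 d:] dvd h"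
proof (induction N arbitrary: h)
  case 0
  then obtain c where "h = [:c:]" by (auto elim: degree_eq_zeroE)
  then show ?case using 0 emb_inj[of c 0] by (simp add: chom_emb emb_hom)
next
  case (Suc N)
  let ?y = "yF d Fx"
  define c where "c = coeff h (Suc N)"
  obtain c0 c1 where c: "c = c0 + monom 1 d * c1" and c0: "\<And>i. i \<ge> d \<Longrightarrow> coeff c0 i = 0"
    using poly_split_monom[of c d] by blast
  let ?f = "[:Fx, monom 1 d:]"
  define h2 where "h2 = h - ?f * monom c1 N - monom c0 (Suc N)"
  have cf: "coeff (?f * monom c1 N) i = (if i = N then Fx * c1 else if i = Suc N then monom 1 d * c1 else 0)" for i
    by (auto simp: mult.commute[of _ "monom c1 N"] coeff_monom_mult coeff_pCons split: nat.splits)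
  have h2: "degree h2 \<le> N"
  proof (rule degree_le, intro allI impI)
    fix i assume "N < i"
    then show "coeff h2 i = 0"
      using Suc.prems c cf[of i] by (cases "i = Suc N") (auto simp: h2_def c_def coeff_eq_0 simp del: mult_pCons_left)
  qed
  have f0: "lift emb ?y ?f = 0"
    by (simp add: lift_pCons chom_emb emb_monom_1 X_yF mult.commute[of ?y])
  have "monom c0 (Suc N) = [:c0:] * [:0,1:] ^ Suc N" by (simp add: monom_altdef)
  then have mon: "lift emb ?y (monom c0 (Suc N)) = emb c0 * ?y ^ Suc N"
    by (simp only: chom_mult[OF chom_A] chom_power[OF chom_A] lift_const[OF chom_emb] lift_X[OF chom_emb])
  have l2: "lift emb ?y h2 = - (emb c0 * ?y ^ Suc N)"
    unfolding h2_def by (simp add: chom_diff[OF chom_A] chom_mult[OF chom_A] f0 mon Suc.prems del: mult_pCons_left)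
  have "c0 = 0"
  proof (rule ccontr)
    assume "c0 \<noteq> 0"
    then obtain i where i: "coeff c0 i \<noteq> 0" by (auto simp: poly_eq_iff)
    with c0 have "i < d" by (meson not_le_imp_less)
    moreover have "fls_subdegree (emb c0) \<le> int i" using i by (intro fls_subdegree_leI) (simp add: emb_nth)
    moreover have y: "fls_subdegree ?y = - int d"
      by (rule fls_subdegree_eqI) (use F0 in \<open>simp_all add: yF_nth\<close>)
    moreover have nz: "emb c0 \<noteq> 0" "?y \<noteq> 0"
      using \<open>c0 \<noteq> 0\<close> emb_inj[of c0 0] y d by (auto simp: emb_hom)
    ultimately have "fls_subdegree (emb c0 * ?y ^ Suc N) < - int d * int N"
      by (simp add: fls_subdegree_pow algebra_simps del: power_Suc)
    then have "lift emb ?y h2 $$ fls_subdegree (emb c0 * ?y ^ Suc N) = 0" by (intro lift_A_lower[OF h2])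
    then have "emb c0 * ?y ^ Suc N = 0" unfolding l2 by (simp add: nth_fls_subdegree_zero_iff del: power_Suc)
    then show False using nz by simp
  qed
  then have "lift emb ?y h2 = 0" using l2 by (simp add: emb_hom)
  then have "?f dvd h2" using Suc.IH h2 by blast
  moreover have "h = h2 + ?f * monom c1 N" using \<open>c0 = 0\<close> by (simp add: h2_def)
  ultimately show ?case by (metis dvd_add dvd_triv_left)
qed

lemma iota_eq_0D:
  assumes d: "d > 0" and F0: "coeff Fx 0 \<noteq> 0" and p: "iota d Fx p = 0" and v: "(x, y, z, t) \<in> VF d Fx"
  shows "E4 x y z t p = 0"
proof -
  \<comment> \<open>The same polynomial with y as outermost variable over \<open>S\<close>, the form
    required by \<open>lift_A_kernel\<close>.\<close>
  define h where "h = E4 [:[:0,1:]:] [:0,1:] [:[:zv:]:] [:[:tv:]:] p"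
  have "lift emb (yF d Fx) h = E4 fls_X (yF d Fx) (fls_const zv) (fls_const tv) p"
    unfolding h_def by (simp add: chom_E4_comp[OF chom_A] lift_pCons[OF chom_emb] emb_hom emb_const emb_X chom_emb)
  then have "lift emb (yF d Fx) h = 0" using p by (simp add: iota_def)
  then have "[:Fx, monom 1 d:] dvd h" using lift_A_kernel[OF d F0 order_refl] by blast
  then obtain g where g: "h = [:Fx, monom 1 d:] * g" by (rule dvdE)
  note ch = chom_E3[of z t x]
  have "E4 x y z t p = lift (E3 z t x) y h"
    unfolding h_def by (simp add: chom_E4_comp[OF chom_lift[OF ch]] lift_pCons[OF ch] E_hom zv_def tv_def ch)
  also have "\<dots> = 0"
    using v unfolding g by (simp add: chom_mult[OF chom_lift[OF ch]] lift_pCons[OF ch] E_hom monom_altdef VF_def mult.commute add.commute del: mult_pCons_left mult_pCons_right)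
  finally show ?thesis .
qed

lemma regular_mapD:
  assumes "regular_map V W \<phi>"
  obtains P1 P2 P3 P4 where "\<And>v. v \<in> V \<Longrightarrow> \<phi> v \<in> W"
    "\<And>x y z t p. (x, y, z, t) \<in> V \<Longrightarrow> eval_xyzt p (\<phi> (x, y, z, t)) = E4 x y z t (E4 P1 P2 P3 P4 p)"
proof -
  obtain P1 P2 P3 P4 where P: "\<And>v. v \<in> V \<Longrightarrow> \<phi> v \<in> W"
    "\<And>v. v \<in> V \<Longrightarrow> \<phi> v = (eval_xyzt P1 v, eval_xyzt P2 v, eval_xyzt P3 v, eval_xyzt P4 v)"
    using assms unfolding regular_map_def by blast
  show thesis
    by (rule that[of P1 P2 P3 P4]) (use P in \<open>simp_all add: eval_xyzt_E4 E4_comp del: eval_xyzt.simps\<close>)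
qed

definition A_hom :: "bp fls set \<Rightarrow> bp fls set \<Rightarrow> (bp fls \<Rightarrow> bp fls) \<Rightarrow> bool" where
  "A_hom A A' h \<longleftrightarrow> (\<forall>f\<in>A. h f \<in> A') \<and> (\<forall>c. h (cst c) = cst c) \<and>
     (\<forall>f\<in>A. \<forall>g\<in>A. h (f + g) = h f + h g \<and> h (f * g) = h f * h g)"

lemma pullback:
  assumes d: "d > 0" and Fa: "coeff Fa 0 \<noteq> 0" and Fb: "coeff Fb 0 \<noteq> 0"
    and iso: "isomorphic_varieties (VF d Fa) (VF d Fb)"
  obtains h h' where "A_hom (Aset d Fb) (Aset d Fa) h" "A_hom (Aset d Fa) (Aset d Fb) h'"
    "\<And>f. f \<in> Aset d Fb \<Longrightarrow> h' (h f) = f" "\<And>f. f \<in> Aset d Fa \<Longrightarrow> h (h' f) = f"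
proof -
  have pull: "\<exists>\<Phi>. chom \<Phi> \<and> (\<forall>p v. v \<in> VF d F1 \<longrightarrow> eval_xyzt (\<Phi> p) v = eval_xyzt p (\<phi> v)) \<and>
      (\<forall>p. iota d F2 p = 0 \<longrightarrow> iota d F1 (\<Phi> p) = 0)"
    if reg: "regular_map (VF d F1) (VF d F2) \<phi>" and nz: "coeff F2 0 \<noteq> 0" for F1 F2 \<phi>
  proof -
    obtain P1 P2 P3 P4 where P: "\<And>v. v \<in> VF d F1 \<Longrightarrow> \<phi> v \<in> VF d F2"
      "\<And>x y z t p. (x, y, z, t) \<in> VF d F1 \<Longrightarrow> eval_xyzt p (\<phi> (x, y, z, t)) = E4 x y z t (E4 P1 P2 P3 P4 p)"
      using regular_mapD[OF reg] by metis
    have ev: "eval_xyzt (E4 P1 P2 P3 P4 p) v = eval_xyzt p (\<phi> v)" if "v \<in> VF d F1" for p v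
    proof -
      obtain x y z t where v: "v = (x, y, z, t)" by (metis prod.exhaust)
      show ?thesis unfolding v eval_xyzt_E4 using P(2) that v by simp
    qed
    have "iota d F1 (E4 P1 P2 P3 P4 p) = 0" if "iota d F2 p = 0" for p
    proof (rule iota_eq_0I)
      fix x y z t assume v: "(x, y, z, t) \<in> VF d F1"
      obtain x' y' z' t' where v': "\<phi> (x, y, z, t) = (x', y', z', t')" by (metis prod.exhaust)
      have "E4 x' y' z' t' p = 0" using P(1)[OF v] unfolding v' by (rule iota_eq_0D[OF d nz that])
      then show "E4 x y z t (E4 P1 P2 P3 P4 p) = 0" using P(2)[OF v, of p] unfolding v' eval_xyzt_E4 by simp
    qed
    with ev show ?thesis by (intro exI[of _ "E4 P1 P2 P3 P4"]) (simp add: chom_E4)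
  qed
  obtain \<phi> \<psi> where iso: "regular_map (VF d Fa) (VF d Fb) \<phi>" "regular_map (VF d Fb) (VF d Fa) \<psi>"
    "\<And>v. v \<in> VF d Fa \<Longrightarrow> \<psi> (\<phi> v) = v" "\<And>v. v \<in> VF d Fb \<Longrightarrow> \<phi> (\<psi> v) = v"
    using iso unfolding isomorphic_varieties_def by blast
  have maps: "\<And>v. v \<in> VF d Fa \<Longrightarrow> \<phi> v \<in> VF d Fb" "\<And>v. v \<in> VF d Fb \<Longrightarrow> \<psi> v \<in> VF d Fa"
    using iso(1,2) by (auto simp: regular_map_def)
  obtain \<Phi> where \<Phi>: "chom \<Phi>" "\<And>p v. v \<in> VF d Fa \<Longrightarrow> eval_xyzt (\<Phi> p) v = eval_xyzt p (\<phi> v)"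
    "\<And>p. iota d Fb p = 0 \<Longrightarrow> iota d Fa (\<Phi> p) = 0" using pull[OF iso(1) Fb] by blast
  obtain \<Psi> where \<Psi>: "chom \<Psi>" "\<And>p v. v \<in> VF d Fb \<Longrightarrow> eval_xyzt (\<Psi> p) v = eval_xyzt p (\<psi> v)"
    "\<And>p. iota d Fa p = 0 \<Longrightarrow> iota d Fb (\<Psi> p) = 0" using pull[OF iso(2) Fa] by blast
  have inv1: "iota d Fa (\<Phi> (\<Psi> p)) = iota d Fa p" for p
  proof -
    have "iota d Fa (\<Phi> (\<Psi> p) - p) = 0"
    proof (rule iota_eq_0I)
      fix x y z t assume v: "(x, y, z, t) \<in> VF d Fa"
      show "E4 x y z t (\<Phi> (\<Psi> p) - p) = 0"
        using \<Phi>(2)[OF v] \<Psi>(2)[OF maps(1)[OF v]] iso(3)[OF v] by (simp only: E_hom eval_xyzt_E4[symmetric] chom_diff[OF chom_eval_xyzt] diff_self)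
    qed
    then show ?thesis by (simp add: iota_hom)
  qed
  have inv2: "iota d Fb (\<Psi> (\<Phi> p)) = iota d Fb p" for p
  proof -
    have "iota d Fb (\<Psi> (\<Phi> p) - p) = 0"
    proof (rule iota_eq_0I)
      fix x y z t assume v: "(x, y, z, t) \<in> VF d Fb"
      show "E4 x y z t (\<Psi> (\<Phi> p) - p) = 0"
        using \<Psi>(2)[OF v] \<Phi>(2)[OF maps(2)[OF v]] iso(4)[OF v] by (simp only: E_hom eval_xyzt_E4[symmetric] chom_diff[OF chom_eval_xyzt] diff_self)
    qed
    then show ?thesis by (simp add: iota_hom)
  qed
  \<comment> \<open>The choice is harmless: \<Phi> maps the kernel of \<open>iota d Fb\<close> into
    that of \<open>iota d Fa\<close>.\<close>
  define h where "h f = iota d Fa (\<Phi> (SOME p. f = iota d Fb p))" for f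
  define h' where "h' f = iota d Fb (\<Psi> (SOME p. f = iota d Fa p))" for f
  have h: "h (iota d Fb p) = iota d Fa (\<Phi> p)" for p
  proof -
    have "iota d Fb p = iota d Fb (SOME q. iota d Fb p = iota d Fb q)" by (rule someI) simp
    then have "iota d Fb (p - (SOME q. iota d Fb p = iota d Fb q)) = 0" by (simp add: iota_hom)
    from \<Phi>(3)[OF this] show ?thesis by (simp add: h_def chom_diff[OF \<Phi>(1)] iota_hom)
  qed
  have h': "h' (iota d Fa p) = iota d Fb (\<Psi> p)" for p
  proof -
    have "iota d Fa p = iota d Fa (SOME q. iota d Fa p = iota d Fa q)" by (rule someI) simp
    then have "iota d Fa (p - (SOME q. iota d Fa p = iota d Fa q)) = 0" by (simp add: iota_hom)
    from \<Psi>(3)[OF this] show ?thesis by (simp add: h'_def chom_diff[OF \<Psi>(1)] iota_hom)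
  qed
  have H: "A_hom (Aset d F2) (Aset d F1) g"
    if g: "\<And>p. g (iota d F2 p) = iota d F1 (\<Theta> p)" and \<Theta>: "chom \<Theta>" for F1 F2 g and \<Theta> :: "poly_xyzt \<Rightarrow> poly_xyzt"
    unfolding A_hom_def
  proof (intro conjI ballI allI)
    show "g (cst c) = cst c" for c using g[of "cst c"] by (simp add: iota_hom chom_cst[OF \<Theta>])
    fix f f' assume f: "f \<in> Aset d F2" "f' \<in> Aset d F2"
    then obtain p p' where p: "f = iota d F2 p" "f' = iota d F2 p'" using A_iota by blast
    show "g (f + f') = g f + g f'" "g (f * f') = g f * g f'"
      unfolding p using g[of "p + p'"] g[of "p * p'"] by (simp_all add: g iota_hom chom_simps[OF \<Theta>])
  next
    fix f assume "f \<in> Aset d F2"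
    then show "g f \<in> Aset d F1" using A_iota g iota_in_A by metis
  qed
  show thesis
  proof (rule that)
    show "A_hom (Aset d Fb) (Aset d Fa) h" by (rule H[OF h \<Phi>(1)])
    show "A_hom (Aset d Fa) (Aset d Fb) h'" by (rule H[OF h' \<Psi>(1)])
    show "h' (h f) = f" if "f \<in> Aset d Fb" for f using A_iota[OF that] by (auto simp: h h' inv2)
    show "h (h' f) = f" if "f \<in> Aset d Fa" for f using A_iota[OF that] by (auto simp: h h' inv1)
  qed
qed

section \<open>Isomorphisms preserve the polynomial subring and the coordinate x\<close>

lemma cst_inverse_cancel:
  assumes "c \<noteq> 0" shows "cst (inverse c) * (cst c * g) = (g :: 'a::calg)"
proof -
  have "cst (inverse c) * (cst c * g) = (cst c * cst (inverse c)) * g" by (simp only: ac_simps)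
  then show ?thesis by (simp only: cst_inverse[OF assms] mult_1)
qed

lemma unit_poly:
  fixes p q :: "'a::idom poly"
  assumes "p * q = 1"
  obtains c where "p = [:c:]" "c * coeff q 0 = 1"
proof -
  have "p \<noteq> 0" "q \<noteq> 0" using assms by auto
  then have "degree p + degree q = 0" using assms degree_mult_eq[of p q] by simp
  then have "degree p = 0" by simp
  then obtain c where c: "p = [:c:]" by (auto elim: degree_eq_zeroE)
  have "coeff (p * q) 0 = 1" using assms by simp
  then show thesis using that c by simp
qed

lemma unit_bp:
  fixes p q :: bp
  assumes "p * q = 1"
  obtains c where "c \<noteq> 0" "p = cst c"
proof -
  obtain a where a: "p = [:a:]" "a * coeff q 0 = 1" using assms by (rule unit_poly)
  obtain c where c: "a = [:c:]" "c * coeff (coeff q 0) 0 = 1" using a(2) by (rule unit_poly)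
  show thesis by (rule that[of c]) (use a c in \<open>auto simp: cst_poly_def\<close>)
qed

lemma unit_S:
  fixes p q :: S
  assumes "p * q = 1"
  obtains c where "c \<noteq> 0" "p = cst c"
proof -
  obtain a where a: "p = [:a:]" "a * coeff q 0 = 1" using assms by (rule unit_poly)
  obtain c where c: "c \<noteq> 0" "a = cst c" using a(2) by (rule unit_bp)
  show thesis by (rule that[of c]) (use a c in \<open>auto simp: cst_poly_def\<close>)
qed

lemma nilp_add:
  assumes D: "der D" and "nilp D f" "nilp D g"
  shows "nilp D (f + g)"
proof -
  obtain n m where "(D ^^ n) f = 0" "(D ^^ m) g = 0" using assms by (auto simp: nilp_def)
  then have "(D ^^ max n m) f = 0" "(D ^^ max n m) g = 0" using der_funpow_mono[OF D] by (metis max.cobounded1 max.cobounded2)+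
  then have "(D ^^ max n m) (f + g) = 0" by (simp add: der_funpow_add[OF D])
  then show ?thesis unfolding nilp_def ..
qed

lemma nilp_mult:
  fixes f g :: "'a::{calg,idom}"
  assumes "der D" "nilp D f" "nilp D g"
  shows "nilp D (f * g)"
proof (cases "f = 0 \<or> g = 0")
  case True
  then have "(D ^^ 0) (f * g) = 0" by auto
  then show ?thesis unfolding nilp_def ..
qed (use ndeg_mult(1)[OF assms(1,2) _ assms(3)] in auto)

lemma nilp_of_der: "nilp D (D f) \<Longrightarrow> nilp D f"
  unfolding nilp_def by (metis funpow_simps_right(2) o_apply)

lemma fls_map_emb: "fls_map dz (emb p) = emb (Dz p)" "fls_map dt (emb p) = emb (Dt p)"
  by (auto intro!: fls_eqI simp: fls_map_nth emb_nth dz_simps dt_simps coeff_Dz coeff_Dt)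

lemma fls_map_X: "fls_map dz fls_X = 0" "fls_map dt fls_X = 0"
  by (auto intro!: fls_eqI simp: fls_map_nth dz_simps dt_simps)

lemma emb_X_power: "emb ([:0,1:] ^ n) = fls_X ^ n"
  by (simp add: emb_hom emb_X)

text \<open>The derivations x^d d/dz and x^d d/dt; the factor x^d makes the image of y a polynomial,
  namely - E Fx. They are nilpotent on generators, hence on the whole coordinate ring.\<close>

lemma std_lnd:
  assumes \<delta>: "\<delta> = (\<lambda>f. fls_X ^ d * fls_map e f)" and e: "e = dz \<and> E = Dz \<or> e = dt \<and> E = Dt"
  shows "der \<delta>" "f \<in> Aset d Fx \<Longrightarrow> \<delta> f \<in> Aset d Fx" "f \<in> Aset d Fx \<Longrightarrow> nilp \<delta> f"
    "\<delta> (emb p) = emb ([:0,1:] ^ d * E p)"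
proof -
  have de: "der e" "der E" using e der_dz der_dt der_Dz der_Dt by auto
  show der: "der \<delta>" unfolding \<delta> by (intro der_times der_fls_map de)
  have eE: "fls_map e (emb p) = emb (E p)" for p using e fls_map_emb by auto
  have eX: "fls_map e fls_X = 0" using e fls_map_X by auto
  show emb: "\<delta> (emb p) = emb ([:0,1:] ^ d * E p)" for p
    unfolding \<delta> by (simp add: eE emb_hom emb_X)
  have "fls_map e (fls_X ^ d * yF d Fx) = fls_X ^ d * fls_map e (yF d Fx)"
    by (simp add: der_mult[OF der_fls_map[OF de(1)]] der_power[OF der_fls_map[OF de(1)]] eX)
  then have dy: "\<delta> (yF d Fx) = emb (- E Fx)"
    unfolding \<delta> X_yF by (simp add: der_minus[OF der_fls_map[OF de(1)]] eE emb_hom)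
  show "\<delta> f \<in> Aset d Fx" if "f \<in> Aset d Fx" using that
    by (induction rule: Aset_induct)
      (simp_all only: emb dy der_add[OF der] der_mult[OF der] Aset_emb Aset_add Aset_mult)
  have E: "E [:0,1:] = 0" "E [:[:0,1:]:] = 0 \<or> E [:[:0,1:]:] = 1" "E [:[:[:0,1:]:]:] = 0 \<or> E [:[:[:0,1:]:]:] = 1"
    using e by auto
  have Xn: "\<delta> (emb ([:0,1:] ^ d)) = 0" "\<delta> (emb [:0,1:]) = 0"
    unfolding emb der_power[OF de(2)] E by (simp_all add: chom_0[OF chom_emb])
  have z0: "nilp \<delta> f" if "\<delta> f = 0" for f
    unfolding nilp_def using that by (intro exI[of _ 1]) simp
  have zz: "nilp \<delta> (emb v)" if "E v = 0 \<or> E v = 1" for v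
  proof (rule nilp_of_der, rule z0)
    show "\<delta> (\<delta> (emb v)) = 0"
      using that Xn(1) unfolding emb[of v] by (auto simp: chom_0[OF chom_emb] der_0[OF der])
  qed
  have nemb: "nilp \<delta> (emb p)" for p
  proof (induction p rule: S_induct)
    case (const c) show ?case by (rule z0) (simp add: emb_hom der_cst[OF der])
  next
    case x show ?case by (rule z0) (rule Xn)
  next
    case z show ?case by (rule zz) (rule E(3))
  next
    case t show ?case by (rule zz) (rule E(2))
  next
    case (add p q) then show ?case by (simp add: emb_hom nilp_add[OF der])
  next
    case (mult p q) then show ?case by (simp add: emb_hom nilp_mult[OF der])
  qed
  show "nilp \<delta> f" if "f \<in> Aset d Fx" using that
  proof (induction rule: Aset_induct)
    case y show ?case by (rule nilp_of_der) (simp only: dy nemb)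
  qed (simp_all add: nemb nilp_add[OF der] nilp_mult[OF der])
qed

locale alg_iso =
  fixes d k l :: nat and Fa Fb :: S and h h' :: "bp fls \<Rightarrow> bp fls"
  assumes d: "d \<ge> 2" and kl: "k \<ge> 2" "l \<ge> 2" "\<not> (k = 2 \<and> l = 2)"
    and Fa0: "coeff Fa 0 = cusp k l" and Fb0: "coeff Fb 0 = cusp k l"
    and hom: "A_hom (Aset d Fb) (Aset d Fa) h" and hom': "A_hom (Aset d Fa) (Aset d Fb) h'"
    and inv': "f \<in> Aset d Fb \<Longrightarrow> h' (h f) = f" and inv: "f \<in> Aset d Fa \<Longrightarrow> h (h' f) = f"
begin

lemma swap: "alg_iso d k l Fb Fa h' h"
  by unfold_locales (fact d kl Fa0 Fb0 hom hom' inv inv')+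

lemma h_A: "f \<in> Aset d Fb \<Longrightarrow> h f \<in> Aset d Fa"
  and h_cst: "h (cst c) = cst c"
  and h_add: "f \<in> Aset d Fb \<Longrightarrow> g \<in> Aset d Fb \<Longrightarrow> h (f + g) = h f + h g"
  and h_mult: "f \<in> Aset d Fb \<Longrightarrow> g \<in> Aset d Fb \<Longrightarrow> h (f * g) = h f * h g"
  using hom by (auto simp: A_hom_def)

lemma h'_A: "f \<in> Aset d Fa \<Longrightarrow> h' f \<in> Aset d Fb"
  and h'_cst: "h' (cst c) = cst c"
  and h'_add: "f \<in> Aset d Fa \<Longrightarrow> g \<in> Aset d Fa \<Longrightarrow> h' (f + g) = h' f + h' g"
  and h'_mult: "f \<in> Aset d Fa \<Longrightarrow> g \<in> Aset d Fa \<Longrightarrow> h' (f * g) = h' f * h' g"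
  using hom' by (auto simp: A_hom_def)

lemma h_0: "h 0 = 0" using h_cst[of 0] by simp

text \<open>Conjugation by the isomorphism turns \<delta> into a nonzero locally nilpotent
  derivation of the other ring that kills the image of p, so \<open>kernel_nonneg\<close>
  applies.\<close>

lemma h_emb_of_kernel:
  assumes \<delta>: "\<delta> = (\<lambda>f. fls_X ^ d * fls_map e f)" and e: "e = dz \<and> E = Dz \<or> e = dt \<and> E = Dt"
    and p: "E p = 0"
  shows "\<exists>q. h (emb p) = emb q"
proof -
  note st = std_lnd[OF \<delta> e]
  define D where "D = (\<lambda>f. h (\<delta> (h' f)))"
  have pow: "(\<delta> ^^ n) f \<in> Aset d Fb" if "f \<in> Aset d Fb" for n f
    by (induction n) (use that st(2) in auto)
  have pow2: "(D ^^ n) f = h ((\<delta> ^^ n) (h' f))" if "f \<in> Aset d Fa" for n f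
    by (induction n) (use that inv inv' pow st(2) h'_A in \<open>auto simp: D_def\<close>)
  interpret A_lnd d k l Fa D
  proof
    show "D (cst c) = 0" for c by (simp add: D_def h'_cst der_cst[OF st(1)] h_0)
    show "\<exists>n. (D ^^ n) f = 0" if "f \<in> Aset d Fa" for f
      using st(3)[OF h'_A[OF that]] pow2[OF that] h_0 unfolding nilp_def by metis
    obtain v where "E v = 1"
      using e by (metis Dz_Dt_vars(1,5))
    then have v: "\<delta> (emb v) = fls_X ^ d" by (simp add: st(4) emb_hom emb_X)
    have "D (h (emb v)) = h (emb ([:0,1:] ^ d))" by (simp add: D_def inv' Aset_emb v emb_X_power)
    moreover have "h (emb ([:0,1:] ^ d)) \<noteq> 0"
    proof
      assume "h (emb ([:0,1:] ^ d)) = 0"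
      then have "emb ([:0,1:] ^ d) = h' 0" using inv'[OF Aset_emb] by metis
      then show False using h'_cst[of 0] by (simp add: emb_X_power)
    qed
    ultimately show "\<exists>f\<in>Aset d Fa. D f \<noteq> 0" using h_A[OF Aset_emb] by metis
  qed (use d kl Fa0 h_A h'_A st in \<open>auto simp: D_def h_add h_mult h'_add h'_mult inv Aset_mult der_add[OF st(1)] der_mult[OF st(1)]\<close>)
  show ?thesis
  proof (rule kernel_nonneg[OF h_A[OF Aset_emb]])
    show "D (h (emb p)) = 0" by (simp add: D_def inv' Aset_emb st(4) p emb_hom h_0)
  qed
qed

lemma U_exist: "\<exists>U1 U2 U3. h fls_X = emb U1 \<and> h (fls_const zv) = emb U2 \<and> h (fls_const tv) = emb U3"
  using h_emb_of_kernel[OF refl, of dz Dz "[:0,1:]"] h_emb_of_kernel[OF refl, of dt Dt "[:[:[:0,1:]:]:]"]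
    h_emb_of_kernel[OF refl, of dz Dz "[:[:0,1:]:]"]
  by (auto simp: emb_X emb_const zv_def tv_def)

lemma h_emb:
  assumes "h fls_X = emb U1" "h (fls_const zv) = emb U2" "h (fls_const tv) = emb U3"
  shows "h (emb p) = emb (E3 U2 U3 U1 p)"
proof (induction p rule: S_induct)
  case (const c)
  show ?case by (simp add: emb_hom E_hom h_cst)
next
  case (add p q) then show ?case by (simp add: emb_hom E_hom h_add Aset_emb)
next
  case (mult p q) then show ?case by (simp add: emb_hom E_hom h_mult Aset_emb)
qed (use assms in \<open>simp_all add: emb_X emb_const zv_def tv_def\<close>)

text \<open>Some x^N times the image of y under \<open>h'\<close> is a polynomial. Mapped back, U1^N
  y would be a polynomial; yet its coefficient at x^-d is -r times the value of U1^N at x =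
  0.\<close>

lemma X_dvd:
  assumes U: "h fls_X = emb U1" "h (fls_const zv) = emb U2" "h (fls_const tv) = emb U3"
  shows "coeff U1 0 = 0"
proof (rule ccontr)
  assume nz: "coeff U1 0 \<noteq> 0"
  have A: "h' (yF d Fa) \<in> Aset d Fb" by (rule h'_A[OF Aset_y])
  obtain N q where q: "fls_X ^ N * h' (yF d Fa) = emb q" using Aset_bounded[OF A] by blast
  have "h (emb ([:0,1:] ^ N) * h' (yF d Fa)) = h (emb ([:0,1:] ^ N)) * h (h' (yF d Fa))"
    by (rule h_mult[OF Aset_emb A])
  moreover have "emb ([:0,1:] ^ N) * h' (yF d Fa) = emb q" by (simp only: emb_X_power q)
  moreover have "E3 U2 U3 U1 ([:0,1:] ^ N) = U1 ^ N" by (simp add: E_hom)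
  ultimately have "emb (U1 ^ N) * yF d Fa = emb (E3 U2 U3 U1 q)"
    by (simp only: inv[OF Aset_y] h_emb[OF U])
  then have "(emb (U1 ^ N) * yF d Fa) $$ (0 + - int d) = 0" using d by (simp add: emb_nth)
  moreover have "(emb (U1 ^ N) * yF d Fa) $$ (0 + - int d) = emb (U1 ^ N) $$ 0 * yF d Fa $$ (- int d)"
    by (rule fls_times_nth_lead) (simp_all add: emb_nth yF_nth)
  ultimately have "emb (U1 ^ N) $$ 0 * yF d Fa $$ (- int d) = 0" by simp
  moreover have "yF d Fa $$ (- int d) \<noteq> 0" using kl by (simp add: yF_nth Fa0 cusp_neq_0)
  moreover have "emb (U1 ^ N) $$ 0 \<noteq> 0" using nz by (simp add: emb_nth coeff_0_power)
  ultimately show False by simp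
qed

text \<open>As x goes to \<mu> x, the image of y has a pole of order at most d.
  \<open>Aset_le_d\<close> writes it as p + q y, and multiplication by x^d gives the
  relation.\<close>

lemma F_relation:
  assumes U: "h fls_X = emb U1" "h (fls_const zv) = emb U2" "h (fls_const tv) = emb U3"
    and U1: "U1 = cst \<mu> * [:0,1:]" and \<mu>: "\<mu> \<noteq> 0"
  shows "\<exists>p q. E3 U2 U3 U1 Fb = [:0,1:] ^ d * p + q * Fa"
proof -
  define f where "f = h (yF d Fb)"
  have fA: "f \<in> Aset d Fa" unfolding f_def by (rule h_A[OF Aset_y])
  have "h (emb ([:0,1:] ^ d) * yF d Fb) = h (emb ([:0,1:] ^ d)) * f"
    unfolding f_def by (rule h_mult[OF Aset_emb Aset_y])
  moreover have "emb ([:0,1:] ^ d) * yF d Fb = emb (- Fb)" by (simp add: emb_X_power X_yF emb_hom emb_X)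
  moreover have "E3 U2 U3 U1 ([:0,1:] ^ d) = U1 ^ d" by (simp add: E_hom)
  ultimately have "emb (E3 U2 U3 U1 (- Fb)) = emb (U1 ^ d) * f"
    by (simp only: h_emb[OF U])
  then have rel: "- emb (E3 U2 U3 U1 Fb) = cst (\<mu> ^ d) * (fls_X ^ d * f)"
    unfolding U1 by (simp only: E_hom emb_hom power_mult_distrib cst_power emb_X mult.assoc)
  moreover have "cst (inverse (\<mu> ^ d)) * (cst (\<mu> ^ d) * (fls_X ^ d * f)) = fls_X ^ d * f"
    by (rule cst_inverse_cancel) (simp add: \<mu>)
  ultimately have "fls_X ^ d * f = emb (cst (inverse (\<mu> ^ d)) * (- E3 U2 U3 U1 Fb))"
    by (simp only: emb_hom)
  then have "f $$ (i - int d) = emb (cst (inverse (\<mu> ^ d)) * (- E3 U2 U3 U1 Fb)) $$ i" for i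
    by (metis fls_X_power_times_conv_shift(1) fls_shift_nth diff_conv_add_uminus)
  from this[of "i + int d" for i] have low: "f $$ i = 0" if "i < - int d" for i
    using that by (simp add: emb_nth)
  have "coeff Fa 0 \<noteq> 0" using kl by (simp add: Fa0 cusp_neq_0)
  then obtain p q where f: "f = emb p + emb q * yF d Fa"
    using Aset_le_d[OF _ _ order_refl fA low] d by auto
  have "fls_X ^ d * f = fls_X ^ d * emb p + emb q * (fls_X ^ d * yF d Fa)"
    unfolding f by (simp add: algebra_simps)
  also have "\<dots> = emb ([:0,1:] ^ d * p - q * Fa)" by (simp add: X_yF emb_hom emb_X)
  finally have "emb (E3 U2 U3 U1 Fb) = emb (- (cst (\<mu> ^ d) * ([:0,1:] ^ d * p - q * Fa)))"
    using rel by (simp only: emb_hom) (metis minus_minus)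
  then have "E3 U2 U3 U1 Fb = [:0,1:] ^ d * (- (cst (\<mu> ^ d) * p)) + (cst (\<mu> ^ d) * q) * Fa"
    unfolding emb_inj by (simp add: algebra_simps)
  then show ?thesis by blast
qed

end

text \<open>The images of x in both directions are divisible by x; composing them shows that the
  cofactors are units of \<complex>[x,z,t], that is, constants.\<close>

lemma (in alg_iso) iso_structure:
  obtains \<mu> Z T Z' T' p q p' q' where "\<mu> \<noteq> 0"
    "E3 Z T (cst \<mu> * [:0,1:]) Fb = [:0,1:] ^ d * p + q * Fa"
    "E3 Z' T' (cst (inverse \<mu>) * [:0,1:]) Fa = [:0,1:] ^ d * p' + q' * Fb"
    "\<And>f. E3 Z T (cst \<mu> * [:0,1:]) (E3 Z' T' (cst (inverse \<mu>) * [:0,1:]) f) = f"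
proof -
  interpret S: alg_iso d k l Fb Fa h' h by (rule swap)
  obtain U1 U2 U3 where U: "h fls_X = emb U1" "h (fls_const zv) = emb U2" "h (fls_const tv) = emb U3"
    using U_exist by blast
  obtain V1 V2 V3 where V: "h' fls_X = emb V1" "h' (fls_const zv) = emb V2" "h' (fls_const tv) = emb V3"
    using S.U_exist by blast
  have UV: "E3 U2 U3 U1 (E3 V2 V3 V1 f) = f" for f
    using inv[OF Aset_emb, of f] by (simp add: h_emb[OF U] S.h_emb[OF V] emb_inj)
  obtain u where u: "U1 = [:0,1:] * u" using X_dvd[OF U] by (cases U1) auto
  obtain v where v: "V1 = [:0,1:] * v" using S.X_dvd[OF V] by (cases V1) auto
  have "[:0,1:] = E3 U2 U3 U1 (E3 V2 V3 V1 [:0,1:])" by (rule UV[symmetric])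
  also have "\<dots> = U1 * E3 U2 U3 U1 v" by (simp only: E_simps v E_hom)
  finally have uv: "[:0,1:] * (u * E3 U2 U3 U1 v) = [:0,1:] * 1" unfolding u by (simp only: mult.assoc mult_1_right)
  then have "u * E3 U2 U3 U1 v = 1" by (simp only: mult_cancel_left) simp
  then obtain \<mu> where \<mu>: "\<mu> \<noteq> 0" "u = cst \<mu>" by (rule unit_S)
  have U1: "U1 = cst \<mu> * [:0,1:]" using u \<mu> by (metis mult.commute)
  have "E3 U2 U3 U1 v = cst (inverse \<mu>)"
    using \<open>u * _ = 1\<close> \<mu> cst_inverse[OF \<mu>(1), where 'a=S] by (metis mult_cancel_left cst_eq_0_iff)
  have "E3 V2 V3 V1 (E3 U2 U3 U1 v) = v"
    using inv'[OF Aset_emb, of v] by (simp add: h_emb[OF U] S.h_emb[OF V] emb_inj)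
  then have "v = cst (inverse \<mu>)" unfolding \<open>E3 U2 U3 U1 v = _\<close> by (simp add: E_hom)
  then have V1: "V1 = cst (inverse \<mu>) * [:0,1:]" using v by (metis mult.commute)
  obtain p q where pq: "E3 U2 U3 U1 Fb = [:0,1:] ^ d * p + q * Fa" using F_relation[OF U U1 \<mu>(1)] by blast
  obtain p' q' where pq': "E3 V2 V3 V1 Fa = [:0,1:] ^ d * p' + q' * Fb"
    using S.F_relation[OF V V1] \<mu>(1) by (metis nonzero_imp_inverse_nonzero)
  show thesis
    by (rule that[OF \<mu>(1) pq[unfolded U1] pq'[unfolded V1] UV[unfolded U1 V1]])
qed

section \<open>Plane automorphisms preserving the cuspidal curve\<close>

lemma bp_induct_mod [case_names const z t add]:
  fixes p :: bp
  assumes const: "\<And>c. P (cst c)" and z: "\<And>p. P p \<Longrightarrow> P (zv * p)" and t: "\<And>p. P p \<Longrightarrow> P (tv * p)"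
    and add: "\<And>p q. P p \<Longrightarrow> P q \<Longrightarrow> P (p + q)"
  shows "P p"
proof (induction p)
  case 0
  show ?case using const[of 0] by simp
next
  case (pCons a p)
  have "P [:a:]"
  proof (induction a)
    case 0
    show ?case using const[of 0] by simp
  next
    case (pCons c a)
    have "[:pCons c a:] = cst c + zv * [:a:]" by (simp add: cst_poly_def zv_def)
    then show ?case using add[OF const z[OF pCons(2)]] by metis
  qed
  moreover have "pCons a p = [:a:] + tv * p" by (simp add: tv_def)
  ultimately show ?case using add t pCons by metis
qed

section \<open>Normal forms and pole orders on the curves z^k + t^l = c\<close>

lemma E2_vars [simp]: "E2 a b zv = a" "E2 a b tv = b"
  by (simp_all add: zv_def tv_def)

lemma E1_X_power: "E1 a ([:0,1:] ^ n) = a ^ n"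
  by (simp add: E_hom)

lemma E1_smult: "E1 a (smult c p) = cst c * E1 a p"
proof -
  have "smult c p = [:c:] * p" by simp
  then show ?thesis by (simp only: E1_hom E_simps)
qed

text \<open>Division with remainder by z^k + t^l - c, which is monic in z.\<close>

lemma cusp_reduce:
  assumes k: "k > 0"
  shows "\<exists>a w. f = (\<Sum>i<k. E1 tv (a i) * zv ^ i) + (cusp k l - cst c) * w"
proof (induction f rule: bp_induct_mod)
  case (const b)
  have "cst b = (\<Sum>i<k. E1 tv (if i = 0 then [:b:] else 0) * zv ^ i) + (cusp k l - cst c) * 0"
    using k by (simp add: E_hom if_distrib[of "E1 tv"] if_distrib[of "\<lambda>x. x * _"] cong: if_cong)
  then show ?case by (intro exI[of _ "\<lambda>i. if i = 0 then [:b:] else 0"] exI[of _ 0])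
next
  case (z p)
  then obtain a w where p: "p = (\<Sum>i<k. E1 tv (a i) * zv ^ i) + (cusp k l - cst c) * w" by blast
  \<comment> \<open>Multiplication by z shifts the coefficients; the overflowing z^k is replaced by
    c - t^l.\<close>
  define b where "b i = (if i = 0 then a (k - 1) * ([:c:] - [:0,1:] ^ l) else a (i - 1))" for i
  obtain k' where k': "k = Suc k'" using k by (cases k) auto
  have "zv * p = (\<Sum>i<k. E1 tv (a i) * zv ^ Suc i) + (cusp k l - cst c) * (zv * w)"
    unfolding p by (simp add: sum_distrib_left algebra_simps)
  also have "(\<Sum>i<k. E1 tv (a i) * zv ^ Suc i) = (\<Sum>i<k'. E1 tv (a i) * zv ^ Suc i) + E1 tv (a k') * zv ^ k"
    by (simp add: k')
  also have "zv ^ k = (cusp k l - cst c) + (cst c - tv ^ l)" by (simp add: cusp_def)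
  also have "(\<Sum>i<k'. E1 tv (a i) * zv ^ Suc i) = (\<Sum>i<k'. E1 tv (b (Suc i)) * zv ^ Suc i)" by (simp add: b_def)
  also have "E1 tv (a k') * ((cusp k l - cst c) + (cst c - tv ^ l)) = (cusp k l - cst c) * E1 tv (a k') + E1 tv (b 0) * zv ^ 0"
    by (simp add: b_def k' E_hom E1_smult algebra_simps)
  finally have "zv * p = (\<Sum>i<k. E1 tv (b i) * zv ^ i) + (cusp k l - cst c) * (E1 tv (a k') + zv * w)"
    unfolding k' sum.lessThan_Suc_shift by (simp only: algebra_simps)
  then show ?case by blast
next
  case (t p)
  then obtain a w where p: "p = (\<Sum>i<k. E1 tv (a i) * zv ^ i) + (cusp k l - cst c) * w" by blast
  have "tv * p = (\<Sum>i<k. E1 tv ([:0,1:] * a i) * zv ^ i) + (cusp k l - cst c) * (tv * w)"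
    unfolding p by (simp only: E_hom E_simps sum_distrib_left algebra_simps)
  then show ?case by (intro exI[of _ "\<lambda>i. [:0,1:] * a i"] exI[of _ "tv * w"])
next
  case (add p q)
  then obtain a w b v where pq: "p = (\<Sum>i<k. E1 tv (a i) * zv ^ i) + (cusp k l - cst c) * w"
    "q = (\<Sum>i<k. E1 tv (b i) * zv ^ i) + (cusp k l - cst c) * v" by blast
  have "p + q = (\<Sum>i<k. E1 tv (a i + b i) * zv ^ i) + (cusp k l - cst c) * (w + v)"
    unfolding pq by (simp add: E_hom sum.distrib algebra_simps)
  then show ?case by (intro exI[of _ "\<lambda>i. a i + b i"] exI[of _ "w + v"])
qed

lemma subdegree_E1:
  fixes \<tau> :: "complex fls"
  assumes \<tau>: "fls_subdegree \<tau> = - int n" "n > 0" and p: "p \<noteq> 0"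
  shows "E1 \<tau> p \<noteq> 0 \<and> fls_subdegree (E1 \<tau> p) = - int (n * degree p)"
  using p
proof (induction p)
  case (pCons c p)
  have \<tau>0: "\<tau> \<noteq> 0" using \<tau> by auto
  have e: "E1 \<tau> (pCons c p) = cst c + \<tau> * E1 \<tau> p"
    by (simp add: E1_def lift_pCons chom_cst_fun)
  show ?case
  proof (cases "p = 0")
    case True
    then show ?thesis using pCons by (simp add: e E_hom cst_fls_def fls_const_nonzero)
  next
    case False
    then have IH: "E1 \<tau> p \<noteq> 0" "fls_subdegree (E1 \<tau> p) = - int (n * degree p)" using pCons by auto
    define g where "g = \<tau> * E1 \<tau> p"
    have g: "g \<noteq> 0" "fls_subdegree g = - int (n * degree (pCons c p))"
      using IH \<tau> \<tau>0 False by (simp_all add: g_def algebra_simps)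
    have "fls_subdegree (cst c + g) = fls_subdegree g"
    proof (cases "c = 0")
      case False
      have "fls_subdegree g < fls_subdegree (cst c :: complex fls)"
      proof -
        have "int (n * degree (pCons c p)) > 0" using \<tau> False \<open>p \<noteq> 0\<close> by (simp del: of_nat_mult)
        then have "fls_subdegree g < 0" using g(2) by linarith
        then show ?thesis by (simp add: cst_fls_def)
      qed
      then show ?thesis using fls_subdegree_add_eq2[of g "cst c"] g(1) by simp
    qed simp
    moreover have "int (n * degree (pCons c p)) > 0" using \<tau> False \<open>p \<noteq> 0\<close> by (simp del: of_nat_mult)
    then have "fls_subdegree g \<noteq> 0" using g(2) by linarith
    then have "cst c + g \<noteq> 0" using calculation by auto
    ultimately show ?thesis unfolding e g_def[symmetric] using g by simp
  qed
qed simp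

text \<open>The terms have distinct orders, because \<open>k\<close> and \<open>l\<close> are coprime and \<open>i < k\<close>.\<close>

lemma subdegree_normal_form:
  fixes \<zeta> \<tau> :: "complex fls"
  assumes kl: "coprime k l" and m: "m > 0" "k > 0" "l > 0"
    and \<zeta>: "fls_subdegree \<zeta> = - int (m * l)" and \<tau>: "fls_subdegree \<tau> = - int (m * k)"
    and nz: "\<exists>i<k. a i \<noteq> 0"
  shows "\<exists>i<k. a i \<noteq> 0 \<and> (\<Sum>i<k. E1 \<tau> (a i) * \<zeta> ^ i) \<noteq> 0 \<and>
     fls_subdegree (\<Sum>i<k. E1 \<tau> (a i) * \<zeta> ^ i) = - int (m * (k * degree (a i) + l * i)) \<and>
     (\<forall>i'<k. a i' \<noteq> 0 \<longrightarrow> k * degree (a i') + l * i' \<le> k * degree (a i) + l * i)"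
proof -
  define w where "w i = k * degree (a i) + l * i" for i
  define M where "M = {i. i < k \<and> a i \<noteq> 0}"
  have fin: "finite M" "M \<noteq> {}" using nz by (auto simp: M_def)
  have "Max (w ` M) \<in> w ` M" using fin by (intro Max_in) auto
  then obtain i where "i \<in> M" "w i = Max (w ` M)" by auto
  then have i: "i \<in> M" "\<And>i'. i' \<in> M \<Longrightarrow> w i' \<le> w i" using fin by auto
  have inj: "w i' \<noteq> w i''" if "i' < k" "i'' < k" "i' \<noteq> i''" for i' i''
  proof
    assume "w i' = w i''"
    then have "int (w i') = int (w i'')" by simp
    then have "int l * (int i' - int i'') = int k * (int (degree (a i'')) - int (degree (a i')))"
      by (simp add: w_def algebra_simps)
    then have "int k dvd int i' - int i''"
      using kl by (metis coprime_dvd_mult_right_iff coprime_int_iff dvd_triv_left)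
    moreover have "\<bar>int i' - int i''\<bar> < int k" using that by auto
    ultimately show False using that by (metis dvd_imp_le_int eq_iff_diff_eq_0 not_le of_nat_eq_iff abs_of_nat)
  qed
  have nz: "\<zeta> \<noteq> 0" "\<tau> \<noteq> 0" using \<zeta> \<tau> m by auto
  have tm: "E1 \<tau> (a i') * \<zeta> ^ i' \<noteq> 0 \<and> fls_subdegree (E1 \<tau> (a i') * \<zeta> ^ i') = - int (m * w i')" if "i' \<in> M" for i'
  proof -
    have "E1 \<tau> (a i') \<noteq> 0 \<and> fls_subdegree (E1 \<tau> (a i')) = - int (m * k * degree (a i'))"
      using that m by (intro subdegree_E1[OF \<tau>]) (auto simp: M_def)
    then show ?thesis using nz \<zeta> by (simp add: fls_subdegree_pow w_def algebra_simps)
  qed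
  have other: "(E1 \<tau> (a i') * \<zeta> ^ i') $$ j = 0" if "i' < k" "i' \<noteq> i" "j \<le> - int (m * w i)" for i' j
  proof (cases "i' \<in> M")
    case True
    have "w i' < w i" using inj[of i' i] i(2)[OF True] that i(1) by (force simp: M_def)
    then have "j < fls_subdegree (E1 \<tau> (a i') * \<zeta> ^ i')" using tm[OF True] that m by (simp add: algebra_simps) (smt (verit, best) mult_strict_left_mono of_nat_less_iff of_nat_0_less_iff)
    then show ?thesis by simp
  qed (use that in \<open>simp add: M_def E_hom\<close>)
  let ?s = "\<Sum>i<k. E1 \<tau> (a i) * \<zeta> ^ i"
  have split: "?s $$ j = (E1 \<tau> (a i) * \<zeta> ^ i) $$ j" if "j \<le> - int (m * w i)" for j
  proof -
    have "?s $$ j = (\<Sum>i'<k. if i' = i then (E1 \<tau> (a i) * \<zeta> ^ i) $$ j else 0)"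
      unfolding fls_nth_sum by (rule sum.cong) (use other that in auto)
    then show ?thesis using i(1) by (simp add: M_def)
  qed
  have lead: "?s $$ (- int (m * w i)) \<noteq> 0"
    unfolding split[OF order_refl] using tm[OF i(1)] nth_fls_subdegree_nonzero by metis
  then have "?s \<noteq> 0" by auto
  moreover have "fls_subdegree ?s = - int (m * w i)"
  proof (rule fls_subdegree_eqI[OF lead])
    fix j assume j: "j < - int (m * w i)"
    have "?s $$ j = (E1 \<tau> (a i) * \<zeta> ^ i) $$ j" by (rule split) (use j in simp)
    also have "\<dots> = 0" using tm[OF i(1)] j by (metis fls_eq0_below_subdegree)
    finally show "?s $$ j = 0" .
  qed
  ultimately show ?thesis using i by (intro exI[of _ i]) (auto simp: M_def w_def)
qed

text \<open>The parametrization at infinity is \<tau> = X^-k and \<zeta> = \<omega> X^-l (1 - c X^(k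
  l))^(1/k), where \<omega>^k = -1 and the root is a power series with constant term 1.\<close>

lemma curve_param:
  fixes c :: complex
  assumes kl: "k > 0" "l > 0"
  obtains \<zeta> \<tau> :: "complex fls" where "\<zeta> ^ k + \<tau> ^ l = cst c"
    "fls_subdegree \<zeta> = - int l" "fls_subdegree \<tau> = - int k"
proof -
  obtain k' where k': "k = Suc k'" using kl by (cases k) auto
  define A where "A = (1 - fps_const c * fps_X ^ (k * l) :: complex fps)"
  have A0: "A $ 0 = 1" using kl by (simp add: A_def)
  define \<rho> where "\<rho> = fps_radical (\<lambda>_ _. 1) k A"
  have \<rho>: "\<rho> ^ k = A" unfolding \<rho>_def k' using A0 by (subst power_radical[symmetric]) auto
  have \<rho>0: "\<rho> $ 0 = 1" by (simp add: \<rho>_def k')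
  define \<omega> where "\<omega> = cis (pi / real k)"
  have \<omega>: "\<omega> ^ k = -1" unfolding \<omega>_def using kl by (simp add: DeMoivre)
  define \<zeta> where "\<zeta> = fls_const \<omega> * fls_shift (int l) (fps_to_fls \<rho>)"
  define \<tau> where "\<tau> = (fls_shift (int k) 1 :: complex fls)"
  have "\<zeta> ^ k = - fls_shift (int k * int l) (fps_to_fls A)"
    unfolding \<zeta>_def power_mult_distrib fls_const_power[symmetric] \<omega> fls_shifted_pow fps_to_fls_power[symmetric] \<rho>
    by simp
  also have "fps_to_fls A = 1 - fls_const c * fls_X ^ (k * l)"
    by (simp add: A_def fps_to_fls_power fls_times_fps_to_fls)
  also have "fls_X ^ (k * l) = fls_shift (- (int k * int l)) (1 :: complex fls)"
    by (simp add: fls_X_power_conv_shift_1)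
  finally have "\<zeta> ^ k = fls_const c - fls_shift (int k * int l) 1"
    by (simp add: fls_shifted_times_simps)
  moreover have "\<tau> ^ l = fls_shift (int k * int l) 1"
    unfolding \<tau>_def fls_shifted_pow by (simp add: mult.commute)
  ultimately have "\<zeta> ^ k + \<tau> ^ l = cst c" by (simp add: cst_fls_def)
  moreover have "\<omega> \<noteq> 0" using \<omega> kl by (auto simp: zero_power)
  then have "fls_subdegree \<zeta> = - int l"
  proof -
    have "fls_subdegree (fps_to_fls \<rho>) = 0"
      using \<rho>0 by (intro fls_subdegree_eqI) auto
    moreover have "fps_to_fls \<rho> \<noteq> 0" using \<rho>0 by auto
    ultimately show ?thesis using \<open>\<omega> \<noteq> 0\<close> unfolding \<zeta>_def by (simp add: fls_shift_eq0_iff)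
  qed
  moreover have "fls_subdegree \<tau> = - int k" by (simp add: \<tau>_def)
  ultimately show thesis by (rule that)
qed

text \<open>
  \<open>Z\<close> and \<open>T\<close> are the images of the coordinates under an automorphism of the plane that maps the
  curve \<open>z\<^sup>k + t\<^sup>l = C c\<close> to the curve \<open>z\<^sup>k + t\<^sup>l = c\<close>. The pole orders at infinity of the regular
  functions form the semigroup generated by \<open>k\<close> and \<open>l\<close>, and those of \<open>Z\<close> and \<open>T\<close> are \<open>m l\<close> and
  \<open>m k\<close>; hence \<open>m = 1\<close>.
\<close>

lemma pole_orders:
  fixes Z T :: bp and \<zeta> \<tau> :: "complex fls"
  assumes kl: "k \<ge> 2" "l \<ge> 2" "coprime k l"
    and surj: "\<And>f. \<exists>g. E2 Z T g = f"
    and rel: "Z ^ k + T ^ l = cst C * cusp k l"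
    and par: "\<zeta> ^ k + \<tau> ^ l = cst c" "fls_subdegree \<zeta> = - int l" "fls_subdegree \<tau> = - int k"
  shows "fls_subdegree (E2 \<zeta> \<tau> Z) = - int l \<and> fls_subdegree (E2 \<zeta> \<tau> T) = - int k"
proof -
  define x where "x = E2 \<zeta> \<tau> Z"
  define y where "y = E2 \<zeta> \<tau> T"
  have "E2 \<zeta> \<tau> (Z ^ k + T ^ l) = cst C * cst c"
    unfolding rel using par(1) by (simp add: E_hom cusp_def)
  then have xy: "x ^ k + y ^ l = cst (C * c)" by (simp add: x_def y_def E_hom cst_mult)
  have comp: "E2 \<zeta> \<tau> (E2 Z T g) = E2 x y g" for g
    by (simp add: E2_comp x_def y_def)
  have kl0: "k > 0" "l > 0" using kl by auto
  have nf: "f = 0 \<or> (\<exists>i n. fls_subdegree f = - int (m * (k * n + l * i)))" 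
    if "f = E2 a b g" "m > 0" "a ^ k + b ^ l = cst e" "fls_subdegree a = - int (m * l)" "fls_subdegree b = - int (m * k)"
    for f a b :: "complex fls" and g m e
  proof -
    obtain u w where g: "g = (\<Sum>i<k. E1 tv (u i) * zv ^ i) + (cusp k l - cst e) * w"
      using cusp_reduce[OF kl0(1), of g l e] by blast
    have "f = (\<Sum>i<k. E1 b (u i) * a ^ i)"
      unfolding that(1) g using that(3) by (simp add: E_hom cusp_def chom_E1_comp[OF chom_E2])
    then show ?thesis
      using subdegree_normal_form[OF kl(3) that(2) kl0 that(4,5), of u]
      by (cases "\<exists>i<k. u i \<noteq> 0") (auto simp: E_hom)
  qed
  \<comment> \<open>If neither Z nor T had a pole, no polynomial in them would have one; by
    surjectivity the coordinate z, which restricts to \<zeta>, is such a polynomial.\<close>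
  have pos: "fls_subdegree x < 0 \<or> fls_subdegree y < 0"
  proof (rule ccontr)
    assume "\<not> ?thesis"
    then have nn: "fls_subdegree x \<ge> 0" "fls_subdegree y \<ge> 0" by auto
    have "\<forall>i<0. E2 x y g $$ i = 0" for g
    proof (induction g rule: bp_induct_mod)
      case (z p) then show ?case using fls_times_nth_0[of 0 x 0 "E2 x y p"] nn by (auto simp: E_hom)
    next
      case (t p) then show ?case using fls_times_nth_0[of 0 y 0 "E2 x y p"] nn by (auto simp: E_hom)
    qed (auto simp: E_hom cst_fls_def)
    moreover obtain g where "E2 Z T g = zv" using surj by blast
    then have "\<zeta> = E2 x y g" using comp[of g] by simp
    ultimately have "fls_subdegree \<zeta> \<ge> 0" by (intro fls_subdegree_ge0I) auto
    then show False using par kl by simp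
  qed
  have deg: "int k * fls_subdegree x = int l * fls_subdegree y"
  proof -
    have *: "fls_subdegree f = fls_subdegree g" if "f + g = cst e" "fls_subdegree f < 0" for f g :: "complex fls" and e
    proof -
      have g: "g = cst e - f" using that by (simp add: algebra_simps)
      have "f \<noteq> 0" using that by auto
      show ?thesis
      proof (cases "e = 0")
        case False
        then show ?thesis unfolding g using fls_subdegree_diff_eq2[of f "cst e"] that(2) \<open>f \<noteq> 0\<close> by (simp add: cst_fls_def)
      qed (simp add: g)
    qed
    show ?thesis
    proof (cases "fls_subdegree x < 0")
      case True
      then have "fls_subdegree (x ^ k) < 0" using kl0 by (simp add: fls_subdegree_pow mult_pos_neg)
      from *[OF xy this] show ?thesis by (simp add: fls_subdegree_pow)
    next
      case False
      then have "fls_subdegree (y ^ l) < 0" using pos kl0 by (simp add: fls_subdegree_pow mult_pos_neg)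
      from *[of "y ^ l" "x ^ k", OF _ this] xy show ?thesis by (simp add: fls_subdegree_pow add.commute)
    qed
  qed
  have "int l dvd fls_subdegree x"
    using deg kl(3) by (metis coprime_dvd_mult_right_iff coprime_int_iff coprime_commute dvd_triv_left)
  then obtain e where e: "fls_subdegree x = int l * e" by (auto elim: dvdE)
  then have e': "fls_subdegree y = int k * e" using deg kl0 by (simp add: algebra_simps)
  have "e < 0" using pos e e' kl0 by (auto simp: mult_less_0_iff)
  then obtain m where m: "e = - int m" "m > 0" by (metis neg_int_cases)
  have "m dvd n" if "n > 0" "fls_subdegree f = - int n" "f = E2 \<zeta> \<tau> h" for n f h
  proof -
    obtain g where "E2 Z T g = h" using surj by blast
    then have "f = E2 x y g" using comp[of g] that by simp
    moreover have "f \<noteq> 0" using that by auto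
    moreover have "fls_subdegree x = - int (m * l)" "fls_subdegree y = - int (m * k)"
      using e e' m by (simp_all add: mult.commute)
    ultimately obtain i n' where "fls_subdegree f = - int (m * (k * n' + l * i))"
      using nf[of f x y g m "C * c"] m xy by blast
    then show ?thesis using that by (metis dvd_triv_left neg_equal_iff_equal of_nat_eq_iff)
  qed
  from this[of l \<zeta> zv] this[of k \<tau> tv] have "m dvd l" "m dvd k" using par kl0 by simp_all
  then have "m = 1" using kl(3) by (metis coprime_common_divisor_nat nat_dvd_1_iff_1 coprime_def)
  then show ?thesis using e e' m by (simp add: x_def y_def)
qed


text \<open>On the curve Z has pole order l and T has pole order k, so Z = p z + a_0(t), and T =
  b_0(t) is linear in t; k < l keeps z out of T. The relation then removes a_0 and the constant term
  of b_0.\<close>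

lemma torus_on_curve:
  fixes Z T :: bp
  assumes kl: "k \<ge> 2" "k < l" "coprime k l"
    and surj: "\<And>f. \<exists>g. E2 Z T g = f"
    and rel: "Z ^ k + T ^ l = cst C * cusp k l"
  shows "\<exists>p q w v. Z = cst p * zv + (cusp k l - cst c) * w \<and> T = cst q * tv + (cusp k l - cst c) * v \<and>
    (c \<noteq> 0 \<longrightarrow> p ^ k = C \<and> q ^ l = C)"
proof -
  have kl0: "k > 0" "l > 0" "l \<ge> 2" using kl by auto
  obtain \<zeta> \<tau> :: "complex fls" where par: "\<zeta> ^ k + \<tau> ^ l = cst c"
    "fls_subdegree \<zeta> = - int l" "fls_subdegree \<tau> = - int k" using curve_param[OF kl0(1,2)] by metis
  have ord: "fls_subdegree (E2 \<zeta> \<tau> Z) = - int l" "fls_subdegree (E2 \<zeta> \<tau> T) = - int k"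
    using pole_orders[OF kl(1) kl0(3) kl(3) surj rel par] by auto
  obtain a w where Z: "Z = (\<Sum>i<k. E1 tv (a i) * zv ^ i) + (cusp k l - cst c) * w"
    using cusp_reduce[OF kl0(1)] by blast
  obtain b v where T: "T = (\<Sum>i<k. E1 tv (b i) * zv ^ i) + (cusp k l - cst c) * v"
    using cusp_reduce[OF kl0(1)] by blast
  have jnf: "E2 \<zeta> \<tau> ((\<Sum>i<k. E1 tv (u i) * zv ^ i) + (cusp k l - cst c) * x) = (\<Sum>i<k. E1 \<tau> (u i) * \<zeta> ^ i)" for u x
    using par(1) by (simp add: E_hom cusp_def chom_E1_comp[OF chom_E2])
  note nf = subdegree_normal_form[OF kl(3) zero_less_one kl0(1,2), of \<zeta> \<tau>, simplified, OF par(2,3)]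
  have jZ: "E2 \<zeta> \<tau> Z = (\<Sum>i<k. E1 \<tau> (a i) * \<zeta> ^ i)" unfolding Z by (rule jnf)
  have jT: "E2 \<zeta> \<tau> T = (\<Sum>i<k. E1 \<tau> (b i) * \<zeta> ^ i)" unfolding T by (rule jnf)
  have "\<exists>i<k. a i \<noteq> 0"
  proof (rule ccontr)
    assume "\<not> ?thesis"
    then have "E2 \<zeta> \<tau> Z = 0" unfolding jZ by (intro sum.neutral) (auto simp: E_hom)
    then show False using ord(1) kl0 by simp
  qed
  from nf[OF this] obtain i where i: "i < k" "a i \<noteq> 0" "int l = int (k * degree (a i) + l * i)"
    "\<And>i'. i' < k \<Longrightarrow> a i' \<noteq> 0 \<Longrightarrow> k * degree (a i') + l * i' \<le> k * degree (a i) + l * i"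
    using ord(1) unfolding jZ by fastforce
  have li: "l = k * degree (a i) + l * i" using i(3) by linarith
  have "i \<noteq> 0"
  proof
    assume "i = 0"
    then have "k dvd l" using li by simp
    then show False using kl coprime_absorb_left[of k l] by simp
  qed
  moreover have "\<not> i \<ge> 2" 
  proof
    assume "i \<ge> 2"
    then have "l * 2 \<le> l * i" by simp
    then show False using li kl0 by linarith
  qed
  ultimately have i1: "i = 1" by auto
  then have "degree (a 1) = 0" using li kl0 by simp
  then obtain p where p: "a 1 = [:p:]" "p \<noteq> 0" using i i1 by (auto elim: degree_eq_zeroE)
  have ai: "a i' = 0" if "i' < k" "i' \<ge> 2" for i'
  proof (rule ccontr)
    assume "a i' \<noteq> 0"
    then have "l * i' \<le> l" using i(4)[OF that(1)] li by linarith
    moreover have "l * 2 \<le> l * i'" using that by (intro mult_le_mono2)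
    ultimately show False using kl0 by linarith
  qed
  have sum2: "(\<Sum>i<k. f i) = f 0 + f 1" if "\<And>i. i < k \<Longrightarrow> i \<ge> 2 \<Longrightarrow> f i = 0" for f :: "nat \<Rightarrow> 'b::comm_monoid_add"
  proof -
    have "(\<Sum>i<k. f i) = (\<Sum>i\<in>{0,1}. f i)"
      using kl that by (intro sum.mono_neutral_right) (auto simp: not_less_eq_eq numeral_2_eq_2)
    then show ?thesis by simp
  qed
  have Z': "Z = E1 tv (a 0) + cst p * zv + (cusp k l - cst c) * w"
    using Z sum2[of "\<lambda>i. E1 tv (a i) * zv ^ i"] ai by (simp add: E_hom p(1)[unfolded One_nat_def])
  have "\<exists>i<k. b i \<noteq> 0"
  proof (rule ccontr)
    assume "\<not> ?thesis"
    then have "E2 \<zeta> \<tau> T = 0" unfolding jT by (intro sum.neutral) (auto simp: E_hom)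
    then show False using ord(2) kl0 by simp
  qed
  from nf[OF this] obtain i2 where i2: "i2 < k" "b i2 \<noteq> 0" "int k = int (k * degree (b i2) + l * i2)"
    "\<And>i'. i' < k \<Longrightarrow> b i' \<noteq> 0 \<Longrightarrow> k * degree (b i') + l * i' \<le> k * degree (b i2) + l * i2"
    using ord(2) unfolding jT by fastforce
  have ki: "k = k * degree (b i2) + l * i2" using i2(3) by linarith
  have "i2 = 0" using ki kl by (cases i2) auto
  then have "k * degree (b 0) = k * 1" using ki by (metis mult_0_right add_0_right mult_1_right)
  then have db: "degree (b 0) = 1" using kl0 by (simp only: mult_cancel1) simp
  obtain q0 b' where b': "b 0 = pCons q0 b'" by (rule pCons_cases)
  with db have "b' \<noteq> 0" "degree b' = 0" by (auto split: if_splits)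
  then obtain q1 where "b' = [:q1:]" "q1 \<noteq> 0" by (auto elim: degree_eq_zeroE)
  with b' have q: "b 0 = [:q0, q1:]" "q1 \<noteq> 0" by simp_all
  have bi: "b i' = 0" if "i' < k" "i' \<ge> 1" for i'
  proof (rule ccontr)
    assume "b i' \<noteq> 0"
    then have "l * i' \<le> k" using i2(4)[OF that(1)] ki by linarith
    moreover have "l * 1 \<le> l * i'" using that by (intro mult_le_mono2)
    ultimately show False using kl by linarith
  qed
  have T': "T = E1 tv (b 0) + (cusp k l - cst c) * v"
    using T sum2[of "\<lambda>i. E1 tv (b i) * zv ^ i"] bi kl by (simp add: E_hom)
  \<comment> \<open>The coefficients of the normal form of Z^k + T^l - C c, with \<zeta>^k replaced
    by c - \<tau>^l.\<close>
  define e where "e i = (if i = 0 then a 0 ^ k + [:p ^ k:] * ([:c:] - [:0,1:] ^ l) + b 0 ^ l - [:C * c:]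
     else [:of_nat (k choose i) * p ^ i:] * a 0 ^ (k - i))" for i
  obtain k' where k': "k = Suc k'" "k' > 0" using kl by (cases k) auto
  have "E2 \<zeta> \<tau> (Z ^ k + T ^ l) = cst C * cst c" unfolding rel using par(1) by (simp add: E_hom cusp_def)
  moreover have "E2 \<zeta> \<tau> Z = cst p * \<zeta> + E1 \<tau> (a 0)" "E2 \<zeta> \<tau> T = E1 \<tau> (b 0)"
    unfolding Z' T' using par(1) by (simp_all add: E_hom cusp_def chom_E1_comp[OF chom_E2])
  ultimately have rel': "(cst p * \<zeta> + E1 \<tau> (a 0)) ^ k + E1 \<tau> (b 0) ^ l = cst C * cst c" by (simp add: E_hom)
  define R where "R = (\<Sum>i<k'. of_nat (k choose Suc i) * (cst p * \<zeta>) ^ Suc i * E1 \<tau> (a 0) ^ (k - Suc i))"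
  have "(cst p * \<zeta> + E1 \<tau> (a 0)) ^ k = (\<Sum>i\<le>k. of_nat (k choose i) * (cst p * \<zeta>) ^ i * E1 \<tau> (a 0) ^ (k - i))"
    by (rule binomial_ring)
  also have "\<dots> = (\<Sum>i<k. of_nat (k choose i) * (cst p * \<zeta>) ^ i * E1 \<tau> (a 0) ^ (k - i)) + (cst p * \<zeta>) ^ k"
    by (simp add: lessThan_Suc_atMost[symmetric])
  also have "(\<Sum>i<k. of_nat (k choose i) * (cst p * \<zeta>) ^ i * E1 \<tau> (a 0) ^ (k - i)) = E1 \<tau> (a 0) ^ k + R"
    unfolding k'(1) sum.lessThan_Suc_shift R_def by simp
  also have "(cst p * \<zeta>) ^ k = cst p ^ k * (cst c - \<tau> ^ l)"
    using par(1) by (simp add: power_mult_distrib flip: par(1))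
  finally have expand: "(cst p * \<zeta> + E1 \<tau> (a 0)) ^ k = E1 \<tau> (a 0) ^ k + R + cst p ^ k * (cst c - \<tau> ^ l)" .
  have e0: "E1 \<tau> (e 0) = E1 \<tau> (a 0) ^ k + cst p ^ k * (cst c - \<tau> ^ l) + E1 \<tau> (b 0) ^ l - cst C * cst c"
    by (simp add: e_def E_hom E1_smult cst_mult cst_power)
  have "E1 \<tau> (e 0) + R = 0"
    unfolding e0 rel'[symmetric] expand by (simp only: algebra_simps add_0_left)
  moreover have "R = (\<Sum>i<k'. E1 \<tau> (e (Suc i)) * \<zeta> ^ Suc i)"
    unfolding R_def by (rule sum.cong) (simp_all add: e_def E_hom E1_smult cst_mult cst_power cst_of_nat power_mult_distrib algebra_simps)
  ultimately have "(\<Sum>i<k. E1 \<tau> (e i) * \<zeta> ^ i) = 0"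
    unfolding k'(1) sum.lessThan_Suc_shift by simp
  then have e: "e i = 0" if "i < k" for i using nf[of e] that by blast
  \<comment> \<open>The coefficient of \<zeta>^(k-1) is k p^(k-1) a_0.\<close>
  have "e k' = 0" by (rule e) (simp add: k')
  moreover have "1 + of_nat k' \<noteq> (0 :: complex)" by (metis of_nat_Suc of_nat_neq_0)
  ultimately have a0: "a 0 = 0" using k' p by (simp add: e_def)
  have "e 0 = 0" using e kl by simp
  then have "b 0 ^ l - ([:C * c:] - [:p ^ k:] * ([:c:] - [:0,1:] ^ l)) = 0"
    using kl0 by (simp add: e_def a0 zero_power algebra_simps)
  then have b0: "b 0 ^ l = [:C * c:] - [:p ^ k:] * ([:c:] - [:0,1:] ^ l)"
    by (simp only: eq_iff_diff_eq_0[symmetric])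
  \<comment> \<open>For l >= 2 the right side of \<open>b0\<close> has no linear term, while the
    derivative of (q0 + q1 t)^l at 0 is l q0^(l-1) q1.\<close>
  have "poly (pderiv (b 0 ^ l)) 0 = 0"
    unfolding b0 using kl0
    by (simp add: pderiv_diff pderiv_mult pderiv_pCons pderiv_power zero_power del: mult_pCons_left)
  then have "q0 = 0" using q kl0 by (simp add: pderiv_power pderiv_pCons)
  then have q': "b 0 = [:0, q1:]" using q by simp
  have "poly (b 0 ^ l) 0 = C * c - p ^ k * c" "poly (b 0 ^ l) 1 = C * c - p ^ k * c + p ^ k"
    unfolding b0 using kl0 by (simp_all add: zero_power algebra_simps)
  then have pk: "C * c = p ^ k * c" "q1 ^ l = p ^ k" using kl0 by (simp_all add: q' zero_power)
  have "E1 tv [:0, q1:] = cst q1 * tv" using E1_smult[of tv q1 "[:0,1:]"] by simp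
  then have "T = cst q1 * tv + (cusp k l - cst c) * v" using T' q' by simp
  moreover have "Z = cst p * zv + (cusp k l - cst c) * w" using Z' a0 by (simp add: E_hom)
  ultimately show ?thesis using pk by (intro exI[of _ p] exI[of _ q1] exI[of _ w] exI[of _ v]) auto
qed

text \<open>Each point lies on one curve r = c, so Z = p z and T = q t hold pointwise with p and q
  depending on c. Hence z divides Z and t divides T; the k-th and l-th powers of the quotients equal
  C, so the quotients are units and therefore constant.\<close>

lemma torus_lt:
  fixes Z T :: bp
  assumes kl: "k \<ge> 2" "k < l" "coprime k l" and C: "C \<noteq> 0"
    and surj: "\<And>f. \<exists>g. E2 Z T g = f"
    and rel: "Z ^ k + T ^ l = cst C * cusp k l"
  shows "\<exists>p q. Z = cst p * zv \<and> T = cst q * tv \<and> p ^ k = C \<and> q ^ l = C"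
proof -
  have ev: "\<exists>p q. E2 z t Z = p * z \<and> E2 z t T = q * t \<and> (z ^ k + t ^ l \<noteq> 0 \<longrightarrow> p ^ k = C \<and> q ^ l = C)" for z t :: complex
  proof -
    obtain p q w v where "Z = cst p * zv + (cusp k l - cst (z ^ k + t ^ l)) * w"
      "T = cst q * tv + (cusp k l - cst (z ^ k + t ^ l)) * v" "z ^ k + t ^ l \<noteq> 0 \<longrightarrow> p ^ k = C \<and> q ^ l = C"
      using torus_on_curve[OF kl surj rel] by blast
    then show ?thesis by (intro exI[of _ p] exI[of _ q]) (simp add: E_hom cusp_def)
  qed
  have kl0: "k > 0" "l > 0" using kl by auto
  have const: "\<exists>p. f = cst p \<and> p ^ n = C"
    if "\<And>z t :: complex. x \<noteq> 0 \<Longrightarrow> E2 z t x \<noteq> 0 \<Longrightarrow> z ^ k + t ^ l \<noteq> 0 \<Longrightarrow> E2 z t f ^ n = C" "x \<noteq> 0" "n > 0" for f x :: bp and n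
  proof -
    have "x * cusp k l * (f ^ n - cst C) = 0"
      by (rule E2_eq_0) (use that in \<open>auto simp: E_hom cusp_def\<close>)
    then have fn: "f ^ n = cst C" using that(2) cusp_neq_0[OF kl0] by simp
    have "f * (f ^ (n - 1) * cst (inverse C)) = f ^ n * cst (inverse C)"
      using that(3) by (cases n) (simp_all add: ac_simps)
    also have "\<dots> = 1" unfolding fn using C by (rule cst_inverse)
    finally obtain p where p: "f = cst p" by (rule unit_bp)
    then show ?thesis using fn by (simp add: cst_power[symmetric])
  qed
  have "poly (coeff Z n) 0 = 0" for n
  proof -
    have "map_poly (E1 0) Z = (0 :: complex poly)"
      using ev[of 0] by (intro poly_all_0_iff_0[THEN iffD1]) (auto simp: E2_def lift_def)
    then have "coeff (map_poly (E1 0) Z) n = (0::complex)" by simp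
    then show ?thesis by (simp add: coeff_map_poly E_hom E1_eq_poly)
  qed
  then have "[:0,1:] dvd coeff Z n" for n using poly_eq_0_iff_dvd[of "coeff Z n" 0] by simp
  then have "zv dvd Z" unfolding zv_def by (simp add: const_poly_dvd_iff)
  then obtain Z1 where Z1: "Z = zv * Z1" by (auto elim: dvdE)
  have "E2 z t Z1 ^ k = C" if "E2 z t zv \<noteq> 0" "z ^ k + t ^ l \<noteq> 0" for z t :: complex
    using ev[of z t] that unfolding Z1 by (auto simp: E_hom)
  then obtain p where p: "Z1 = cst p" "p ^ k = C" using const[of zv Z1 k] kl0 by auto
  have "coeff T 0 = 0"
  proof -
    have "poly (coeff T 0) z = 0" for z
      using ev[of z 0] by (auto simp: E2_def lift_def poly_0_coeff_0 coeff_map_poly E_hom E1_eq_poly)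
    then show ?thesis using poly_all_0_iff_0 by blast
  qed
  then obtain T1 where T1: "T = tv * T1" unfolding tv_def by (cases T) auto
  have "E2 z t T1 ^ l = C" if "E2 z t tv \<noteq> 0" "z ^ k + t ^ l \<noteq> 0" for z t :: complex
    using ev[of z t] that unfolding T1 by (auto simp: E_hom)
  then obtain q where q: "T1 = cst q" "q ^ l = C" using const[of tv T1 l] kl0 by auto
  show ?thesis using Z1 T1 p q by (intro exI[of _ p] exI[of _ q]) (simp add: mult.commute)
qed

lemma torus:
  fixes Z T :: bp
  assumes kl: "k \<ge> 2" "l \<ge> 2" "coprime k l" and C: "C \<noteq> 0"
    and surj: "\<And>f. \<exists>g. E2 Z T g = f"
    and rel: "Z ^ k + T ^ l = cst C * cusp k l"
  shows "\<exists>p q. Z = cst p * zv \<and> T = cst q * tv \<and> p ^ k = C \<and> q ^ l = C"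
proof (cases "k < l")
  case True
  then show ?thesis using torus_lt[OF kl(1) _ kl(3) C surj rel] by blast
next
  case False
  moreover have "k \<noteq> l" using kl by auto
  ultimately have "l < k" by simp
  define \<sigma> where "\<sigma> = E2 tv zv"
  have \<sigma>: "chom \<sigma>" unfolding \<sigma>_def by (rule chom_E2)
  have \<sigma>2: "\<sigma> (\<sigma> f) = f" for f
    unfolding \<sigma>_def E2_comp by (simp add: E2_id[folded zv_def tv_def])
  have "\<exists>p q. \<sigma> T = cst p * zv \<and> \<sigma> Z = cst q * tv \<and> p ^ l = C \<and> q ^ k = C"
  proof (rule torus_lt[OF kl(2) \<open>l < k\<close> _ C])
    show "coprime l k" using kl(3) by (simp add: coprime_commute)
    show "\<sigma> T ^ l + \<sigma> Z ^ k = cst C * cusp l k"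
      using arg_cong[OF rel, of \<sigma>] by (simp add: chom_simps[OF \<sigma>] cusp_def add.commute) (simp add: \<sigma>_def)
    show "\<exists>g. E2 (\<sigma> T) (\<sigma> Z) g = f" for f
    proof -
      obtain g where g: "E2 Z T g = \<sigma> f" using surj by blast
      have "E2 (\<sigma> T) (\<sigma> Z) (\<sigma> g) = E2 (\<sigma> Z) (\<sigma> T) g"
        unfolding \<sigma>_def[of ] by (simp add: E2_comp)
      also have "\<dots> = \<sigma> (E2 Z T g)" by (rule chom_E2_comp[OF \<sigma>, symmetric])
      also have "\<dots> = f" by (simp add: g \<sigma>2)
      finally show ?thesis by blast
    qed
  qed
  then obtain p q where "\<sigma> T = cst p * zv" "\<sigma> Z = cst q * tv" "p ^ l = C" "q ^ k = C" by blast
  moreover have "Z = \<sigma> (\<sigma> Z)" "T = \<sigma> (\<sigma> T)" by (simp_all add: \<sigma>2)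
  ultimately have "Z = cst q * zv" "T = cst p * tv" by (simp_all add: chom_simps[OF \<sigma>]) (simp_all add: \<sigma>_def)
  then show ?thesis using \<open>p ^ l = C\<close> \<open>q ^ k = C\<close> by blast
qed

section \<open>Hamiltonian vector fields\<close>

definition xS :: S where "xS = [:0,1:]"
definition zS :: S where "zS = [:zv:]"
definition tS :: S where "tS = [:tv:]"

lemma D_vars [simp]: "Dz xS = 0" "Dt xS = 0" "Dz zS = 1" "Dt zS = 0" "Dz tS = 0" "Dt tS = 1"
  by (simp_all add: xS_def zS_def tS_def zv_def tv_def)

lemma xS_power: "xS ^ n = monom 1 n"
  by (simp add: xS_def monom_altdef)

lemma coeff_xS_mult: "coeff (xS ^ n * f) i = (if i < n then 0 else coeff f (i - n))"
  by (simp add: xS_power coeff_monom_mult)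

lemma xS_dvd_iff: "xS ^ n dvd f \<longleftrightarrow> (\<forall>i<n. coeff f i = 0)"
  unfolding xS_power by (rule monom_1_dvd_iff')

lemma xS_dvd_E:
  assumes "xS ^ n dvd f - g"
  obtains u where "f = g + xS ^ n * u"
proof -
  from assms obtain u where "f - g = xS ^ n * u" by (rule dvdE)
  then have "f = g + xS ^ n * u" by (simp add: diff_eq_eq add.commute)
  then show thesis by (rule that)
qed

lemma xS_dvd_cancel:
  assumes "coeff f 0 \<noteq> 0" "xS ^ n dvd f * g"
  shows "xS ^ n dvd g"
  using assms(2)
proof (induction n arbitrary: g)
  case (Suc n)
  then obtain u where u: "f * g = xS ^ Suc n * u" by (auto elim: dvdE)
  then have "coeff (f * g) 0 = 0" by (simp add: coeff_xS_mult del: power_Suc)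
  then have "coeff g 0 = 0" using assms(1) by (simp add: coeff_mult)
  then obtain h where h: "g = xS * h" unfolding xS_def by (cases g) auto
  have "xS * (f * h) = xS * (xS ^ n * u)" using u h by (simp add: ac_simps)
  then have "f * h = xS ^ n * u" by (simp add: xS_def)
  then have "xS ^ n dvd h" using Suc.IH by (metis dvd_triv_left)
  then show ?case unfolding h by (simp add: mult_dvd_mono)
qed simp

text \<open>The Poisson bracket in z and t with x as a parameter; \<open>pb Z T\<close> is also the
  Jacobian determinant of the pair.\<close>

definition pb :: "S \<Rightarrow> S \<Rightarrow> S" where
  "pb f g = Dz f * Dt g - Dt f * Dz g"

lemma pb_add: "pb (f + f') g = pb f g + pb f' g" "pb f (g + g') = pb f g + pb f g'"
  by (simp_all add: pb_def Dz_simps Dt_simps algebra_simps)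

lemma pb_x: "pb (xS ^ n * f) g = xS ^ n * pb f g" "pb f (xS ^ n * g) = xS ^ n * pb f g"
  by (simp_all add: pb_def Dz_simps Dt_simps algebra_simps)

lemma pb_cst: "pb (cst c * f) g = cst c * pb f g" "pb f (cst c * g) = cst c * pb f g"
  by (simp_all add: pb_def Dz_simps Dt_simps algebra_simps)

lemma dz_dt_commute: "dz (dt f) = dt (dz f)"
  by (induction f rule: bp_induct) (simp_all add: dz_simps dt_simps algebra_simps)

lemma Dz_Dt_commute: "Dz (Dt f) = Dt (Dz f)"
  by (rule poly_eqI) (simp add: coeff_Dz coeff_Dt dz_dt_commute)

lemma der_pb: "der (pb g)"
  by (rule derI) (simp_all add: pb_def Dz_simps Dt_simps algebra_simps)

lemma pb_jacobi: "pb h (pb f g) = pb (pb h f) g + pb f (pb h g)"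
  by (simp add: pb_def Dz_simps Dt_simps Dz_Dt_commute algebra_simps)

section \<open>Truncated exponentials of derivations\<close>

definition dpow :: "('a::calg \<Rightarrow> 'a) \<Rightarrow> nat \<Rightarrow> 'a \<Rightarrow> 'a" where
  "dpow D n f = cst (1 / fact n) * (D ^^ n) f"

lemma dpow_0 [simp]: "dpow D 0 f = f"
  by (simp add: dpow_def)

lemma dpow_Suc: "dpow D n (D f) = of_nat (Suc n) * dpow D (Suc n) f"
proof -
  have "(of_nat (Suc n) :: 'a) * cst (1 / fact (Suc n)) = cst (1 / fact n)"
  proof -
    have "(of_nat (Suc n) :: 'a) * cst (1 / fact (Suc n)) = cst (of_nat (Suc n) * (1 / fact (Suc n)))"
      by (simp only: cst_mult cst_of_nat)
    also have "of_nat (Suc n) * (1 / fact (Suc n)) = (1 / fact n :: complex)"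
      by (simp add: field_simps del: of_nat_Suc)
    finally show ?thesis .
  qed
  then show ?thesis unfolding dpow_def funpow_Suc_right comp_def by (simp only: mult.assoc[symmetric])
qed

text \<open>Formulated for any bilinear operation obeying the product rule, because both the
  multiplication and the Poisson bracket are needed.\<close>

lemma dpow_leibniz:
  fixes D :: "'a::{calg,idom} \<Rightarrow> 'a"
  assumes D: "der D" and add: "\<And>f f' g. \<beta> (f + f') g = \<beta> f g + \<beta> f' g" "\<And>f g g'. \<beta> f (g + g') = \<beta> f g + \<beta> f g'"
    and cst: "\<And>c f g. \<beta> (cst c * f) g = cst c * \<beta> f g" "\<And>c f g. \<beta> f (cst c * g) = cst c * \<beta> f g"
    and leib: "\<And>f g. D (\<beta> f g) = \<beta> (D f) g + \<beta> f (D g)"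
  shows "dpow D n (\<beta> f g) = (\<Sum>i\<le>n. \<beta> (dpow D i f) (dpow D (n - i) g))"
proof (induction n arbitrary: f g)
  case (Suc n)
  have dadd: "dpow D n (a + b) = dpow D n a + dpow D n b" for n a b
    by (simp add: dpow_def der_funpow_add[OF D] algebra_simps)
  have nat: "\<beta> (of_nat m * a) b = of_nat m * \<beta> a b" "\<beta> a (of_nat m * b) = of_nat m * \<beta> a b" for m a b
    using cst(1)[of "of_nat m" a b] cst(2)[of a "of_nat m" b] by (simp_all only: cst_of_nat)
  let ?b = "\<lambda>i. \<beta> (dpow D i f) (dpow D (Suc n - i) g)"
  have "of_nat (Suc n) * dpow D (Suc n) (\<beta> f g) = dpow D n (\<beta> (D f) g) + dpow D n (\<beta> f (D g))"
    by (simp only: dpow_Suc[symmetric] leib dadd)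
  also have "dpow D n (\<beta> (D f) g) = (\<Sum>i\<le>n. of_nat (Suc i) * ?b (Suc i))"
    by (simp only: Suc dpow_Suc nat diff_Suc_Suc)
  also have "\<dots> = (\<Sum>i\<le>Suc n. of_nat i * ?b i)" by (simp only: sum.atMost_Suc_shift) simp
  also have "dpow D n (\<beta> f (D g)) = (\<Sum>i\<le>n. of_nat (Suc n - i) * ?b i)"
    unfolding Suc dpow_Suc nat by (rule sum.cong) (auto simp: Suc_diff_le)
  also have "\<dots> = (\<Sum>i\<le>Suc n. of_nat (Suc n - i) * ?b i)" by simp
  also have "(\<Sum>i\<le>Suc n. of_nat i * ?b i) + \<dots> = (\<Sum>i\<le>Suc n. of_nat (Suc n) * ?b i)"
    unfolding sum.distrib[symmetric] distrib_right[symmetric] by (rule sum.cong) (auto simp flip: of_nat_add)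
  finally have "of_nat (Suc n) * dpow D (Suc n) (\<beta> f g) = of_nat (Suc n) * (\<Sum>i\<le>Suc n. ?b i)"
    by (simp only: sum_distrib_left)
  then show ?case using calg_of_nat_neq_0[of "Suc n", where 'a='a] by (simp only: mult_cancel_left) blast
qed simp

definition dexp :: "nat \<Rightarrow> ('a::calg \<Rightarrow> 'a) \<Rightarrow> 'a \<Rightarrow> 'a" where
  "dexp d D f = (\<Sum>n<d. dpow D n f)"

locale nilder =
  fixes n d :: nat and D E :: "S \<Rightarrow> S"
  assumes n: "n > 0" and d: "d > 1" and E: "der E" and Ex: "E xS = 0" and D_def: "D = (\<lambda>f. xS ^ n * E f)"
begin

lemma der_D: "der D" unfolding D_def by (intro der_times E)

lemma E_x: "E (xS ^ m * f) = xS ^ m * E f"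
  by (simp add: der_mult[OF E] der_power[OF E] Ex)

lemma D_funpow: "(D ^^ m) f = xS ^ (m * n) * (E ^^ m) f"
  by (induction m) (simp_all add: D_def E_x power_add mult.assoc)

lemma dpow_eq: "dpow D m f = xS ^ (m * n) * dpow E m f"
  by (simp add: dpow_def D_funpow algebra_simps)

lemma dexp_add: "dexp d D (f + g) = dexp d D f + dexp d D g"
  by (simp add: dexp_def dpow_def der_funpow_add[OF der_D] algebra_simps sum.distrib)

lemma dexp_x: "dexp d D (xS ^ m * f) = xS ^ m * dexp d D f"
proof -
  have "(E ^^ i) (xS ^ m * f) = xS ^ m * (E ^^ i) f" for i by (induction i) (simp_all add: E_x)
  then have "dpow D i (xS ^ m * f) = xS ^ m * dpow D i f" for i
    by (simp add: dpow_def D_funpow algebra_simps)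
  then show ?thesis by (simp add: dexp_def sum_distrib_left)
qed

lemma dexp_const: assumes "E f = 0" shows "dexp d D f = f"
proof -
  have "dpow D m f = (if m = 0 then f else 0)" for m
  proof (cases m)
    case (Suc m')
    have "(D ^^ m) f = (D ^^ m') (D f)" unfolding Suc by (simp add: funpow_swap1)
    also have "D f = 0" by (simp add: D_def assms)
    finally show ?thesis using Suc by (simp add: dpow_def der_funpow_0[OF der_D])
  qed simp
  then show ?thesis using d by (simp add: dexp_def)
qed

lemma dexp_cong: "xS ^ m dvd f - g \<Longrightarrow> xS ^ m dvd dexp d D f - dexp d D g"
  by (metis dexp_add dexp_x dvd_triv_left xS_dvd_E add_diff_cancel_left')

lemma dexp_first: "xS ^ Suc n dvd dexp d D f - (f + D f)"
proof -
  have "dexp d D f = dpow D 0 f + dpow D 1 f + (\<Sum>m\<in>{2..<d}. dpow D m f)"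
  proof -
    have "{..<d} = {0, 1} \<union> {2..<d}" using d by auto
    then show ?thesis unfolding dexp_def by (subst \<open>{..<d} = _\<close>, subst sum.union_disjoint) auto
  qed
  moreover have "xS ^ Suc n dvd (\<Sum>m\<in>{2..<d}. dpow D m f)"
  proof (rule dvd_sum)
    fix m assume "m \<in> {2..<d}"
    then have "2 * n \<le> m * n" by simp
    then have "Suc n \<le> m * n" using n by linarith
    then show "xS ^ Suc n dvd dpow D m f" unfolding dpow_eq by (meson dvd_mult2 le_imp_power_dvd)
  qed
  ultimately show ?thesis by (simp add: dpow_def)
qed

text \<open>The two sides differ by the terms with i + j >= d, and each of these carries the factor
  x^((i+j) n).\<close>

lemma dexp_bilinear:
  assumes add: "\<And>f f' g. \<beta> (f + f') g = \<beta> f g + \<beta> f' g" "\<And>f g g'. \<beta> f (g + g') = \<beta> f g + \<beta> f g'"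
    and cst: "\<And>c f g. \<beta> (cst c * f) g = cst c * \<beta> f g" "\<And>c f g. \<beta> f (cst c * g) = cst c * \<beta> f g"
    and x: "\<And>m f g. \<beta> (xS ^ m * f) g = xS ^ m * \<beta> f g" "\<And>m f g. \<beta> f (xS ^ m * g) = xS ^ m * \<beta> f g"
    and leib: "\<And>f g. D (\<beta> f g) = \<beta> (D f) g + \<beta> f (D g)"
  shows "xS ^ d dvd dexp d D (\<beta> f g) - \<beta> (dexp d D f) (dexp d D g)"
proof -
  define T where "T i j = \<beta> (dpow D i f) (dpow D j g)" for i j
  have z: "\<beta> 0 g = 0" "\<beta> f 0 = 0" for f g using cst(1)[of 0 0 g] cst(2)[of f 0 0] by simp_all
  have s1: "\<beta> (sum u I) g = (\<Sum>i\<in>I. \<beta> (u i) g)" if "finite I" for u g and I :: "nat set"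
    using that by (induction I rule: finite_induct) (simp_all add: z add)
  have s2: "\<beta> f (sum u I) = (\<Sum>i\<in>I. \<beta> f (u i))" if "finite I" for u f and I :: "nat set"
    using that by (induction I rule: finite_induct) (simp_all add: z add)
  have "dexp d D (\<beta> f g) = (\<Sum>m<d. \<Sum>i\<le>m. T i (m - i))"
    unfolding dexp_def T_def by (intro sum.cong refl dpow_leibniz[OF der_D add cst leib])
  also have "\<dots> = (\<Sum>(i,j)\<in>{(i,j). i + j < d}. T i j)" by (rule sum.triangle_reindex[symmetric])
  finally have 1: "dexp d D (\<beta> f g) = (\<Sum>(i,j)\<in>{(i,j). i + j < d}. T i j)" .
  have 2: "\<beta> (dexp d D f) (dexp d D g) = (\<Sum>(i,j)\<in>{..<d} \<times> {..<d}. T i j)"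
    unfolding dexp_def s1[OF finite_lessThan] unfolding s2[OF finite_lessThan] sum.cartesian_product T_def ..
  have "(\<Sum>(i,j)\<in>{..<d} \<times> {..<d}. T i j) =
      (\<Sum>(i,j)\<in>{..<d} \<times> {..<d} - {(i,j). i + j < d}. T i j) + (\<Sum>(i,j)\<in>{(i,j). i + j < d}. T i j)"
    by (rule sum.subset_diff) auto
  then have "dexp d D (\<beta> f g) - \<beta> (dexp d D f) (dexp d D g)
      = - (\<Sum>(i,j)\<in>{..<d} \<times> {..<d} - {(i,j). i + j < d}. T i j)" unfolding 1 2 by simp
  moreover have "xS ^ d dvd (\<Sum>(i,j)\<in>{..<d} \<times> {..<d} - {(i,j). i + j < d}. T i j)"
  proof (rule dvd_sum)
    fix p assume p: "p \<in> {..<d} \<times> {..<d} - {(i,j). i + j < d}"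
    obtain i j where ij: "p = (i, j)" by (rule prod.exhaust)
    with p have "d \<le> (i + j) * 1" by simp
    also have "\<dots> \<le> (i + j) * n" using n by (intro mult_le_mono2) simp
    finally have "d \<le> i * n + j * n" by (simp add: algebra_simps)
    then have "xS ^ d dvd xS ^ (i * n + j * n)" by (rule le_imp_power_dvd)
    moreover have "T i j = xS ^ (i * n + j * n) * \<beta> (dpow E i f) (dpow E j g)"
      unfolding T_def dpow_eq x power_add by (simp only: ac_simps)
    ultimately show "xS ^ d dvd (case p of (i, j) \<Rightarrow> T i j)" by (simp add: ij)
  qed
  ultimately show ?thesis by simp
qed

lemma dexp_mult: "xS ^ d dvd dexp d D (f * g) - dexp d D f * dexp d D g"
  by (rule dexp_bilinear) (simp_all add: algebra_simps der_mult[OF der_D])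

end

section \<open>Divergence-free fields and fields tangent to the curve\<close>

lemma poly_antideriv:
  fixes p :: "'a::{calg,idom} poly"
  shows "\<exists>q. pderiv q = p"
proof -
  define q where "q = (\<Sum>i\<le>degree p. monom (cst (1 / of_nat (Suc i)) * coeff p i) (Suc i))"
  have "pderiv q = (\<Sum>i\<le>degree p. monom (coeff p i) i)"
    unfolding q_def der_sum[OF der_pderiv]
  proof (rule sum.cong)
    fix i
    have "of_nat (Suc i) * (cst (1 / of_nat (Suc i)) * coeff p i) = cst (of_nat (Suc i) * (1 / of_nat (Suc i))) * coeff p i"
      by (simp only: cst_mult cst_of_nat mult.assoc)
    also have "of_nat (Suc i) * (1 / of_nat (Suc i)) = (1::complex)" by (simp del: of_nat_Suc)
    finally show "pderiv (monom (cst (1 / of_nat (Suc i)) * coeff p i) (Suc i)) = monom (coeff p i) i"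
      unfolding pderiv_monom by simp
  qed simp
  then show ?thesis by (metis poly_as_sum_of_monoms)
qed

text \<open>Integration in t determines \<eta> up to a polynomial in z, which is used to adjust the
  other partial derivative.\<close>

lemma poincare:
  assumes "dz u + dt v = 0"
  shows "\<exists>\<eta>. dt \<eta> = u \<and> dz \<eta> = - v"
proof -
  obtain \<eta> where \<eta>: "dt \<eta> = u" using poly_antideriv[of u] unfolding dt_def by blast
  have "dt (dz \<eta> + v) = 0" using assms \<eta> by (simp add: dt_simps dz_dt_commute[symmetric])
  then obtain c where c: "dz \<eta> + v = [:c:]" unfolding dt_def by (auto simp: pderiv_eq_0_iff elim: degree_eq_zeroE)
  obtain e where e: "pderiv e = c" using poly_antideriv by blast
  have "dt (\<eta> - [:e:]) = u" "dz (\<eta> - [:e:]) = - v"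
    using \<eta> c e by (simp_all add: dt_simps dz_simps) (simp_all add: dt_def dz_def map_poly_pCons algebra_simps eq_neg_iff_add_eq_0)
  then show ?thesis by blast
qed

text \<open>Along the parametrized curve r = 0 the tangency makes the derivative of \<eta> vanish,
  so \<eta> is a constant c there. The normal form of \<eta> - c then has to be zero, which means
  divisibility by r.\<close>

lemma hamiltonian_tangent:
  assumes kl: "k > 0" "l > 0" "coprime k l"
    and rel: "dz (cusp k l) * dt \<eta> - dt (cusp k l) * dz \<eta> = h * cusp k l"
  shows "\<exists>c w. \<eta> = cst c + cusp k l * w"
proof -
  obtain \<zeta> \<tau> :: "complex fls" where par: "\<zeta> ^ k + \<tau> ^ l = cst 0"
    "fls_subdegree \<zeta> = - int l" "fls_subdegree \<tau> = - int k" using curve_param[OF kl(1,2)] by metis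
  define \<gamma> where "\<gamma> = E2 \<zeta> \<tau>"
  have \<gamma>: "chom \<gamma>" unfolding \<gamma>_def by (rule chom_E2)
  have \<gamma>r: "\<gamma> (cusp k l) = 0" using par(1) by (simp add: \<gamma>_def cusp_def E_hom)
  have d: "fls_deriv (\<gamma> f) = \<gamma> (dz f) * fls_deriv \<zeta> + \<gamma> (dt f) * fls_deriv \<tau>" for f
    unfolding \<gamma>_def by (rule der_E2[OF der_fls_deriv])
  have 1: "\<gamma> (dz (cusp k l)) * fls_deriv \<zeta> = - (\<gamma> (dt (cusp k l)) * fls_deriv \<tau>)"
    using d[of "cusp k l"] \<gamma>r by (simp add: eq_neg_iff_add_eq_0)
  have 2: "\<gamma> (dz (cusp k l)) * \<gamma> (dt \<eta>) = \<gamma> (dt (cusp k l)) * \<gamma> (dz \<eta>)"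
    using arg_cong[OF rel, of \<gamma>] by (simp add: chom_simps[OF \<gamma>] \<gamma>r)
  have "\<gamma> (dz (cusp k l)) * fls_deriv (\<gamma> \<eta>) = \<gamma> (dz \<eta>) * (\<gamma> (dz (cusp k l)) * fls_deriv \<zeta>) + (\<gamma> (dz (cusp k l)) * \<gamma> (dt \<eta>)) * fls_deriv \<tau>"
    unfolding d by (simp add: algebra_simps)
  also have "\<dots> = 0" unfolding 1 2 by (simp add: algebra_simps)
  finally have "\<gamma> (dz (cusp k l)) * fls_deriv (\<gamma> \<eta>) = 0" .
  moreover have "\<gamma> (dz (cusp k l)) = of_nat k * \<zeta> ^ (k - 1)"
    unfolding cusp_def using kl by (simp add: dz_simps \<gamma>_def E_hom chom_cst[OF chom_E2, of _ _ "of_nat _", unfolded cst_of_nat])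
  moreover have "\<zeta> \<noteq> 0" using par kl by auto
  ultimately have "fls_deriv (\<gamma> \<eta>) = 0" using kl by simp
  then have dn: "of_int (n + 1) * \<gamma> \<eta> $$ (n + 1) = 0" for n by (metis fls_deriv_nth fls_zero_nth)
  have "\<gamma> \<eta> $$ n = 0" if "n \<noteq> 0" for n using dn[of "n - 1"] that by simp
  then have "\<gamma> \<eta> = cst (\<gamma> \<eta> $$ 0)" by (intro fls_eqI) (auto simp: cst_fls_def)
  then have z: "\<gamma> (\<eta> - cst (\<gamma> \<eta> $$ 0)) = 0" by (simp add: chom_simps[OF \<gamma>])
  obtain a w where aw: "\<eta> - cst (\<gamma> \<eta> $$ 0) = (\<Sum>i<k. E1 tv (a i) * zv ^ i) + (cusp k l - cst 0) * w"
    using cusp_reduce[OF kl(1)] by blast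
  have "(\<Sum>i<k. E1 \<tau> (a i) * \<zeta> ^ i) = 0"
    using z \<gamma>r unfolding aw by (simp add: chom_simps[OF \<gamma>]) (simp add: \<gamma>_def chom_E1_comp[OF chom_E2])
  then have "a i = 0" if "i < k" for i
    using subdegree_normal_form[OF kl(3) zero_less_one kl(1,2), of \<zeta> \<tau> a] par that by auto
  then have "\<eta> = cst (\<gamma> \<eta> $$ 0) + cusp k l * w" using aw by (simp add: E_hom algebra_simps)
  then show ?thesis by blast
qed

section \<open>Uniqueness of the normal form\<close>

text \<open>The three variables take values in any algebra, so that a substitution into the normal
  form is again of this shape.\<close>

definition Fg :: "nat \<Rightarrow> nat \<Rightarrow> (nat \<times> nat \<Rightarrow> complex poly) \<Rightarrow> 'a::calg \<Rightarrow> 'a \<Rightarrow> 'a \<Rightarrow> 'a" where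
  "Fg k l a x Z T = Z ^ k + T ^ l + (\<Sum>v\<in>idx k l. E1 x (a v) * (Z ^ fst v * T ^ snd v))"

lemma chom_Fg: "chom h \<Longrightarrow> h (Fg k l a x Z T) = Fg k l a (h x) (h Z) (h T)"
  by (simp add: Fg_def chom_simps chom_E1_comp)

abbreviation FS :: "nat \<Rightarrow> nat \<Rightarrow> (nat \<times> nat \<Rightarrow> complex poly) \<Rightarrow> S" where
  "FS k l a \<equiv> Fg k l a xS zS tS"

lemma coeff_E1_xS: "coeff (E1 xS c) n = cst (coeff c n)"
proof (induction c arbitrary: n)
  case (pCons b c)
  have "E1 xS (pCons b c) = cst b + xS * E1 xS c" by (simp add: E1_def lift_pCons chom_cst_fun)
  then have "E1 xS (pCons b c) = pCons (cst b) (E1 xS c)" by (simp add: cst_poly_def[where 'a = bp] xS_def)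
  then show ?case using pCons by (cases n) simp_all
qed (simp add: E_hom)

lemma const_power: "[:c:] ^ n = [:c ^ n:]" for c :: "'a::comm_ring_1"
  by (induction n) (simp_all add: one_pCons)

lemma zt_power: "zS ^ i * tS ^ j = [:zv ^ i * tv ^ j:]"
  by (simp add: zS_def tS_def const_power mult.commute)

lemma coeff_FS: "coeff (FS k l a) n = (if n = 0 then cusp k l else 0) + (\<Sum>v\<in>idx k l. cst (coeff (a v) n) * (zv ^ fst v * tv ^ snd v))"
proof -
  have "zS ^ k + tS ^ l = [:cusp k l:]" by (simp add: zS_def tS_def const_power cusp_def)
  then have "coeff (zS ^ k + tS ^ l) n = (if n = 0 then cusp k l else 0)" by (cases n) simp_all
  moreover have "coeff (E1 xS c * (zS ^ i * tS ^ j)) n = cst (coeff c n) * (zv ^ i * tv ^ j)" for c i j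
    unfolding zt_power by (simp add: mult.commute[of _ "[:_:]"] coeff_E1_xS mult.commute)
  ultimately show ?thesis by (simp add: Fg_def coeff_sum)
qed

lemma zt_monom: "cst c * (zv ^ i * tv ^ j) = monom (monom c i) j"
proof -
  have "zv ^ i = [:monom 1 i:]" by (simp add: zv_def const_power monom_altdef)
  moreover have "tv ^ j = monom 1 j" by (simp add: tv_def monom_altdef)
  ultimately show ?thesis by (simp add: cst_poly_def smult_monom)
qed

lemma coeff_idx_sum:
  "coeff (coeff (\<Sum>v\<in>idx k l. cst (f v) * (zv ^ fst v * tv ^ snd v)) j) i = (if (i, j) \<in> idx k l then f (i, j) else 0)"
proof -
  have "coeff (coeff (\<Sum>v\<in>idx k l. cst (f v) * (zv ^ fst v * tv ^ snd v)) j) i = (\<Sum>v\<in>idx k l. if v = (i, j) then f v else 0)"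
    unfolding zt_monom coeff_sum by (rule sum.cong) (auto simp: prod_eq_iff)
  then show ?thesis using finite_idx[of k l] by simp
qed

lemma coeff_zv_power_mult: "i < m \<Longrightarrow> coeff (coeff (zv ^ m * g) j) i = 0"
  by (simp add: zv_def const_power monom_altdef[symmetric] coeff_monom_mult flip: monom_altdef[of 1])
    (simp add: monom_altdef[of 1, simplified, symmetric] coeff_monom_mult)

lemma coeff_tv_power_mult: "j < m \<Longrightarrow> coeff (tv ^ m * g) j = 0"
proof -
  have "tv ^ m = monom 1 m" by (simp add: tv_def monom_altdef)
  then show "j < m \<Longrightarrow> coeff (tv ^ m * g) j = 0" by (simp add: coeff_monom_mult)
qed

lemma dvd_diff_mult:
  fixes a :: "'a::comm_ring_1"
  assumes "q dvd a - a'" "q dvd b - b'" shows "q dvd a * b - a' * b'"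
proof -
  have "a * b - a' * b' = a * (b - b') + (a - a') * b'" by (simp add: algebra_simps)
  then show ?thesis using assms by simp
qed

lemma dvd_diff_power:
  fixes a :: "'a::comm_ring_1"
  assumes "q dvd a - a'" shows "q dvd a ^ n - a' ^ n"
  by (induction n) (simp_all add: dvd_diff_mult assms)

lemma dvd_diff_trans:
  fixes a :: "'a::comm_ring_1"
  assumes "q dvd a - b" "q dvd b - c" shows "q dvd a - c"
  using dvd_add[OF assms] by simp

lemma power_first_order:
  fixes z :: "'a::comm_ring_1"
  shows "e ^ 2 dvd (z + e * u) ^ m - (z ^ m + e * (of_nat m * z ^ (m - 1) * u))"
proof (induction m)
  case (Suc m)
  have "(z + e * u) ^ Suc m - (z ^ Suc m + e * (of_nat (Suc m) * z ^ (Suc m - 1) * u)) =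
      (z + e * u) * ((z + e * u) ^ m - (z ^ m + e * (of_nat m * z ^ (m - 1) * u))) + e ^ 2 * (of_nat m * z ^ (m - 1) * u * u)"
    by (cases m) (simp_all add: power2_eq_square algebra_simps)
  then show ?case using Suc by simp
qed simp

lemma xS_dvd_E1: "coeff c 0 = 0 \<Longrightarrow> xS dvd E1 xS c"
  using xS_dvd_iff[of 1 "E1 xS c"] by (simp add: coeff_E1_xS)

text \<open>Only z^k + t^l contributes at order n, because the other coefficients are divisible by
  x.\<close>

lemma Fg_first_order:
  assumes n: "n > 0" and b: "\<And>v. v \<in> idx k l \<Longrightarrow> coeff (b v) 0 = 0"
  shows "xS ^ Suc n dvd Fg k l b xS (zS + xS ^ n * U) (tS + xS ^ n * V)
     - (FS k l b + xS ^ n * (of_nat k * zS ^ (k - 1) * U + of_nat l * tS ^ (l - 1) * V))"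
proof -
  let ?Z = "zS + xS ^ n * U" and ?T = "tS + xS ^ n * V"
  have sq: "xS ^ Suc n dvd (xS ^ n) ^ 2"
    using n by (simp only: power_mult[symmetric]) (rule le_imp_power_dvd, simp)
  have 1: "xS ^ Suc n dvd ?Z ^ k - (zS ^ k + xS ^ n * (of_nat k * zS ^ (k - 1) * U))"
    "xS ^ Suc n dvd ?T ^ l - (tS ^ l + xS ^ n * (of_nat l * tS ^ (l - 1) * V))"
    using power_first_order dvd_trans[OF sq] by blast+
  have 2: "xS ^ Suc n dvd (\<Sum>v\<in>idx k l. E1 xS (b v) * (?Z ^ fst v * ?T ^ snd v - zS ^ fst v * tS ^ snd v))"
  proof (rule dvd_sum)
    fix v assume "v \<in> idx k l"
    then have "xS dvd E1 xS (b v)" by (rule xS_dvd_E1[OF b])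
    moreover have "xS ^ n dvd ?Z ^ fst v * ?T ^ snd v - zS ^ fst v * tS ^ snd v"
      by (intro dvd_diff_mult dvd_diff_power) simp_all
    ultimately show "xS ^ Suc n dvd E1 xS (b v) * (?Z ^ fst v * ?T ^ snd v - zS ^ fst v * tS ^ snd v)"
      unfolding power_Suc by (rule mult_dvd_mono)
  qed
  have "Fg k l b xS ?Z ?T - (FS k l b + xS ^ n * (of_nat k * zS ^ (k - 1) * U + of_nat l * tS ^ (l - 1) * V))
     = (?Z ^ k - (zS ^ k + xS ^ n * (of_nat k * zS ^ (k - 1) * U))) + (?T ^ l - (tS ^ l + xS ^ n * (of_nat l * tS ^ (l - 1) * V)))
       + (\<Sum>v\<in>idx k l. E1 xS (b v) * (?Z ^ fst v * ?T ^ snd v - zS ^ fst v * tS ^ snd v))"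
    unfolding Fg_def right_diff_distrib sum_subtractf distrib_left by simp
  then show ?thesis using 1 2 by (simp only: dvd_add)
qed

lemma pb_FW: "pb (f * w) (f * g) = f * (pb (f * w) g + g * pb w f)"
  by (simp add: pb_def Dz_simps Dt_simps algebra_simps)

text \<open>The coefficient of x^n in the relation gives an identity with the normal-form monomials
  on one side and multiples of z^(k-1) and t^(l-1) on the other; both vanish. What is left says that
  the field (u, v) is tangent to r = 0, and a flow removes it.\<close>

lemma unique_step:
  assumes kl: "k \<ge> 2" "l \<ge> 2" "coprime k l" and n: "0 < n" "n < d"
    and a: "\<And>v. v \<in> idx k l \<Longrightarrow> coeff (a v) 0 = 0" and b: "\<And>v. v \<in> idx k l \<Longrightarrow> coeff (b v) 0 = 0"
    and ab: "xS ^ n dvd FS k l b - FS k l a"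
    and Z: "xS ^ n dvd Z - zS" and T: "xS ^ n dvd T - tS"
    and jac: "xS ^ d dvd pb Z T - 1" and rel: "xS ^ d dvd Fg k l b xS Z T - H * FS k l a"
  shows "xS ^ Suc n dvd FS k l b - FS k l a \<and>
    (\<exists>Z T H. xS ^ Suc n dvd Z - zS \<and> xS ^ Suc n dvd T - tS \<and> xS ^ d dvd pb Z T - 1 \<and>
       xS ^ d dvd Fg k l b xS Z T - H * FS k l a)"
proof -
  let ?r = "cusp k l" and ?F = "FS k l a"
  have r0: "?r \<noteq> 0" using kl by (simp add: cusp_neq_0)
  obtain U where U: "Z = zS + xS ^ n * U" using Z by (rule xS_dvd_E)
  obtain V where V: "T = tS + xS ^ n * V" using T by (rule xS_dvd_E)
  define u where "u = coeff U 0"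
  define v where "v = coeff V 0"
  have cn: "coeff f i = coeff g i" if "xS ^ d dvd f - g" "i \<le> n" for f g i
    using that n unfolding xS_dvd_iff by simp
  have cn': "coeff f i = coeff g i" if "xS ^ Suc n dvd f - g" "i \<le> n" for f g i
    using that unfolding xS_dvd_iff by simp
  have "pb Z T = 1 + xS ^ n * (Dz U + Dt V + xS ^ n * pb U V)"
    unfolding U V by (simp add: pb_def Dz_simps Dt_simps algebra_simps)
  then have "coeff (1 + xS ^ n * (Dz U + Dt V + xS ^ n * pb U V)) n = coeff 1 n"
    using cn[OF jac, of n] by simp
  moreover have "coeff (xS ^ n * pb U V) 0 = 0" using n by (simp add: coeff_xS_mult)
  \<comment> \<open>The quadratic term of the Jacobian starts at order 2 n, beyond n, so the field
    has divergence zero.\<close>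
  ultimately have div0: "dz u + dt v = 0"
    by (simp add: coeff_xS_mult coeff_Dz coeff_Dt u_def v_def)
  have F0: "coeff ?F 0 = ?r" by (simp add: coeff_FS a)
  have fo: "xS ^ Suc n dvd Fg k l b xS Z T - (FS k l b + xS ^ n * (of_nat k * zS ^ (k - 1) * U + of_nat l * tS ^ (l - 1) * V))"
    unfolding U V by (rule Fg_first_order[OF n(1) b])
  have xn: "xS ^ n dvd xS ^ Suc n" "xS ^ n dvd xS ^ d" using n by (auto intro: le_imp_power_dvd)
  have "xS ^ n dvd Fg k l b xS Z T - FS k l b"
    using dvd_add[OF dvd_trans[OF xn(1) fo], of "xS ^ n * (of_nat k * zS ^ (k - 1) * U + of_nat l * tS ^ (l - 1) * V)"] by simp
  then have "xS ^ n dvd Fg k l b xS Z T - ?F" using ab by (rule dvd_diff_trans)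
  then have "xS ^ n dvd H * ?F - ?F"
    using dvd_trans[OF xn(2) rel] by (metis dvd_diff_trans dvd_minus_iff minus_diff_eq)
  then have "xS ^ n dvd ?F * (H - 1)" by (simp add: algebra_simps)
  then have "xS ^ n dvd H - 1" by (rule xS_dvd_cancel[rotated]) (simp add: F0 r0)
  then obtain h where h: "H = 1 + xS ^ n * h" by (rule xS_dvd_E)
  define h0 where "h0 = coeff h 0"
  have "coeff (FS k l b + xS ^ n * (of_nat k * zS ^ (k - 1) * U + of_nat l * tS ^ (l - 1) * V)) n = coeff (H * ?F) n"
    using cn[OF rel, of n] cn'[OF fo, of n] by simp
  moreover have "coeff (of_nat k * zS ^ (k - 1) * U + of_nat l * tS ^ (l - 1) * V) 0 = of_nat k * zv ^ (k - 1) * u + of_nat l * tv ^ (l - 1) * v"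
    by (simp add: zS_def tS_def const_power of_nat_poly u_def v_def coeff_mult)
  moreover have "coeff (h * ?F) 0 = h0 * ?r" by (simp add: coeff_mult F0 h0_def)
  moreover have "H * ?F = ?F + xS ^ n * (h * ?F)" by (simp add: h algebra_simps)
  ultimately have key: "coeff (FS k l b) n + (of_nat k * zv ^ (k - 1) * u + of_nat l * tv ^ (l - 1) * v) = coeff ?F n + h0 * ?r"
    by (simp add: coeff_xS_mult)
  have diff: "coeff (FS k l b) n - coeff ?F n = (\<Sum>w\<in>idx k l. cst (coeff (b w) n - coeff (a w) n) * (zv ^ fst w * tv ^ snd w))"
    using n by (simp add: coeff_FS sum_subtractf cst_diff algebra_simps)
  also have "coeff (FS k l b) n - coeff ?F n = h0 * ?r - (of_nat k * zv ^ (k - 1) * u + of_nat l * tv ^ (l - 1) * v)"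
    using key by (simp add: algebra_simps)
  also have "\<dots> = zv ^ (k - 1) * (h0 * zv - of_nat k * u) + tv ^ (l - 1) * (h0 * tv - of_nat l * v)"
  proof -
    have "zv ^ k = zv ^ (k - 1) * zv" "tv ^ l = tv ^ (l - 1) * tv" using kl by (simp_all flip: power_Suc2)
    then show ?thesis unfolding cusp_def by (simp add: algebra_simps)
  qed
  finally have eq: "zv ^ (k - 1) * (h0 * zv - of_nat k * u) + tv ^ (l - 1) * (h0 * tv - of_nat l * v)
      = (\<Sum>w\<in>idx k l. cst (coeff (b w) n - coeff (a w) n) * (zv ^ fst w * tv ^ snd w))" .
  have abn: "coeff (b w) n - coeff (a w) n = 0" if w: "w \<in> idx k l" for w
  proof -
    obtain i j where ij: "w = (i, j)" by (rule prod.exhaust)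
    then have "i < k - 1" "j < l - 1" using w kl by (auto simp: idx_def)
    then have "coeff (coeff (zv ^ (k - 1) * (h0 * zv - of_nat k * u) + tv ^ (l - 1) * (h0 * tv - of_nat l * v)) j) i = 0"
      by (simp only: coeff_add coeff_zv_power_mult coeff_tv_power_mult) simp
    then show ?thesis using w unfolding eq coeff_idx_sum ij by simp
  qed
  then have eqn: "coeff (FS k l b) n = coeff ?F n" using diff by (simp add: abn)
  have 1: "xS ^ Suc n dvd FS k l b - ?F"
    using ab eqn unfolding xS_dvd_iff by (auto simp: less_Suc_eq)
  obtain \<eta> where \<eta>: "dt \<eta> = u" "dz \<eta> = - v" using poincare[OF div0] by blast
  have "dz ?r * dt \<eta> - dt ?r * dz \<eta> = h0 * ?r"
    using key eqn by (simp add: cusp_def dz_simps dt_simps \<eta> algebra_simps)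
  then obtain c w where w: "\<eta> = cst c + ?r * w" using hamiltonian_tangent[OF _ _ kl(3)] kl by fastforce
  \<comment> \<open>Modulo x, bracketing with F W sends z to -u and t to -v, which cancels the
    deviation at order n. By \<open>pb_FW\<close> it preserves the ideal of F.\<close>
  define W where "W = [:w:]"
  define E where "E = pb (?F * W)"
  define D where "D = (\<lambda>f. xS ^ n * E f)"
  interpret nilder n d D E
    by standard (use n in \<open>simp_all add: E_def D_def der_pb pb_def\<close>)
  define Z' where "Z' = dexp d D Z"
  define T' where "T' = dexp d D T"
  have near: "xS ^ Suc n dvd dexp d D (y + xS ^ n * Y) - y" if "coeff (E y) 0 + coeff Y 0 = 0" for y Y
  proof -
    have "dexp d D (y + xS ^ n * Y) - y = (dexp d D (y + xS ^ n * Y) - ((y + xS ^ n * Y) + D (y + xS ^ n * Y)))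
        + xS ^ n * (Y + E y + xS ^ n * E Y)"
      by (simp only: D_def der_add[OF E] E_x) (simp add: algebra_simps)
    moreover have "xS ^ Suc n dvd xS ^ n * (Y + E y + xS ^ n * E Y)"
    proof -
      have "coeff (Y + E y + xS ^ n * E Y) 0 = 0" using that n by (simp add: coeff_xS_mult add.commute)
      then have "xS ^ 1 dvd Y + E y + xS ^ n * E Y" unfolding xS_dvd_iff by simp
      then have "xS ^ n * xS ^ 1 dvd xS ^ n * (Y + E y + xS ^ n * E Y)" by (rule mult_dvd_mono[OF dvd_refl])
      then show ?thesis by (simp add: mult.commute)
    qed
    ultimately show ?thesis using dexp_first by (simp only: dvd_add)
  qed
  have cF: "coeff (Dz (?F * W)) 0 = dz \<eta>" "coeff (Dt (?F * W)) 0 = dt \<eta>"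
    by (simp_all add: coeff_Dz coeff_Dt w dz_simps dt_simps coeff_mult F0 W_def)
  have Z': "xS ^ Suc n dvd Z' - zS"
    unfolding Z'_def U by (rule near) (simp add: E_def pb_def cF \<eta> u_def)
  have T': "xS ^ Suc n dvd T' - tS"
    unfolding T'_def V by (rule near) (simp add: E_def pb_def cF \<eta> v_def)
  \<comment> \<open>The Jacobi identity makes the flow respect the bracket, so the Jacobian
    condition survives.\<close>
  have leib: "D (pb f g) = pb (D f) g + pb f (D g)" for f g
    by (simp only: D_def pb_x E_def pb_jacobi[of "?F * W"] distrib_left)
  have "xS ^ d dvd dexp d D (pb Z T) - pb Z' T'"
    unfolding Z'_def T'_def by (rule dexp_bilinear) (simp_all add: pb_add pb_cst pb_x leib)
  moreover have "xS ^ d dvd dexp d D (pb Z T) - 1"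
    using dexp_cong[OF jac] dexp_const[of 1] by (simp add: der_1[OF E])
  ultimately have jac': "xS ^ d dvd pb Z' T' - 1" by (metis dvd_diff_trans dvd_minus_iff minus_diff_eq)
  have pw: "xS ^ d dvd dexp d D (f ^ m) - dexp d D f ^ m" for f m
  proof (induction m)
    case 0
    then show ?case using dexp_const[of 1] by (simp add: der_1[OF E])
  next
    case (Suc m)
    then have "xS ^ d dvd dexp d D f * dexp d D (f ^ m) - dexp d D f * dexp d D f ^ m"
      by (intro dvd_diff_mult) simp_all
    then show ?case using dvd_diff_trans[OF dexp_mult] by simp
  qed
  have const: "E (E1 xS c) = 0" for c
    by (induction c rule: poly_gen_induct) (simp_all add: E_hom der_simps[OF E] Ex)
  have sm: "dexp d D (sum f I) = (\<Sum>i\<in>I. dexp d D (f i))" for f and I :: "(nat \<times> nat) set"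
    by (induction I rule: infinite_finite_induct) (simp_all add: dexp_add dexp_const[OF der_0[OF E]])
  have "xS ^ d dvd dexp d D (Fg k l b xS Z T) - Fg k l b xS Z' T'"
  proof -
    have "xS ^ d dvd (\<Sum>v\<in>idx k l. dexp d D (E1 xS (b v) * (Z ^ fst v * T ^ snd v)) - E1 xS (b v) * (Z' ^ fst v * T' ^ snd v))"
    proof (rule dvd_sum)
      fix v
      have "xS ^ d dvd dexp d D (Z ^ fst v * T ^ snd v) - Z' ^ fst v * T' ^ snd v"
        unfolding Z'_def T'_def by (rule dvd_diff_trans[OF dexp_mult]) (intro dvd_diff_mult pw)
      then have "xS ^ d dvd dexp d D (E1 xS (b v)) * dexp d D (Z ^ fst v * T ^ snd v) - E1 xS (b v) * (Z' ^ fst v * T' ^ snd v)"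
        by (intro dvd_diff_mult) (simp_all add: dexp_const const)
      then show "xS ^ d dvd dexp d D (E1 xS (b v) * (Z ^ fst v * T ^ snd v)) - E1 xS (b v) * (Z' ^ fst v * T' ^ snd v)"
        by (rule dvd_diff_trans[OF dexp_mult])
    qed
    moreover have "dexp d D (Fg k l b xS Z T) - Fg k l b xS Z' T' = (dexp d D (Z ^ k) - Z' ^ k) + (dexp d D (T ^ l) - T' ^ l)
       + (\<Sum>v\<in>idx k l. dexp d D (E1 xS (b v) * (Z ^ fst v * T ^ snd v)) - E1 xS (b v) * (Z' ^ fst v * T' ^ snd v))"
      by (simp add: Fg_def dexp_add sm sum_subtractf)
    ultimately show ?thesis using pw[of Z k] pw[of T l] unfolding Z'_def T'_def by (simp only: dvd_add)
  qed
  moreover have "xS ^ d dvd dexp d D (Fg k l b xS Z T) - dexp d D (H * ?F)" by (rule dexp_cong[OF rel])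
  ultimately have rel': "xS ^ d dvd Fg k l b xS Z' T' - dexp d D (H * ?F)"
    by (metis dvd_diff_trans dvd_minus_iff minus_diff_eq)
  have "?F dvd (E ^^ m) (H * ?F)" for m
  proof (induction m)
    case (Suc m)
    then obtain g where "(E ^^ m) (H * ?F) = ?F * g" by (auto elim: dvdE)
    then show ?case by (simp add: E_def pb_FW)
  qed simp
  then have "?F dvd dpow D m (H * ?F)" for m by (simp add: dpow_def D_funpow)
  then have "?F dvd dexp d D (H * ?F)" unfolding dexp_def by (intro dvd_sum)
  then obtain H' where "dexp d D (H * ?F) = H' * ?F" by (metis dvdE mult.commute)
  with rel' have "xS ^ d dvd Fg k l b xS Z' T' - H' * ?F" by simp
  then show ?thesis using 1 Z' T' jac' by blast
qed

theorem normal_form_unique: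
  assumes kl: "k \<ge> 2" "l \<ge> 2" "coprime k l" and d: "d \<ge> 1"
    and a: "\<And>v. v \<in> idx k l \<Longrightarrow> coeff (a v) 0 = 0" and b: "\<And>v. v \<in> idx k l \<Longrightarrow> coeff (b v) 0 = 0"
    and Z: "coeff Z 0 = zv" and T: "coeff T 0 = tv"
    and jac: "xS ^ d dvd pb Z T - 1" and rel: "xS ^ d dvd Fg k l b xS Z T - H * FS k l a"
    and v: "v \<in> idx k l" and i: "i < d"
  shows "coeff (a v) i = coeff (b v) i"
proof -
  have "xS ^ n dvd FS k l b - FS k l a \<and>
    (\<exists>Z T H. xS ^ n dvd Z - zS \<and> xS ^ n dvd T - tS \<and> xS ^ d dvd pb Z T - 1 \<and> xS ^ d dvd Fg k l b xS Z T - H * FS k l a)"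
    if "1 \<le> n" "n \<le> d" for n
    using that
  proof (induction n rule: dec_induct)
    case base
    have "xS ^ 1 dvd FS k l b - FS k l a" "xS ^ 1 dvd Z - zS" "xS ^ 1 dvd T - tS"
      unfolding xS_dvd_iff by (simp_all add: coeff_FS a b Z T) (simp_all add: zS_def tS_def)
    then show ?case using jac rel by blast
  next
    case (step n)
    then have *: "0 < n" "n < d" by simp_all
    obtain Z T H where "xS ^ n dvd FS k l b - FS k l a" "xS ^ n dvd Z - zS" "xS ^ n dvd T - tS" "xS ^ d dvd pb Z T - 1"
      "xS ^ d dvd Fg k l b xS Z T - H * FS k l a"
      using step by auto
    from unique_step[OF kl * a b this] show ?case .
  qed
  from this[of d] d have "xS ^ d dvd FS k l b - FS k l a" by simp
  then have "coeff (FS k l b - FS k l a) i = 0" using i by (simp add: xS_dvd_iff)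
  then have "(\<Sum>v\<in>idx k l. cst (coeff (b v) i - coeff (a v) i) * (zv ^ fst v * tv ^ snd v)) = 0"
    by (simp add: coeff_FS sum_subtractf cst_diff algebra_simps)
  then have "coeff (coeff (\<Sum>v\<in>idx k l. cst (coeff (b v) i - coeff (a v) i) * (zv ^ fst v * tv ^ snd v)) (snd v)) (fst v) = 0"
    by simp
  then show ?thesis using v unfolding coeff_idx_sum by simp
qed

section \<open>Construction of isomorphisms\<close>

lemma regular_map_E4:
  "regular_map V W \<phi> \<longleftrightarrow> (\<forall>v\<in>V. \<phi> v \<in> W) \<and> (\<exists>P Q R S. \<forall>x y z t. (x, y, z, t) \<in> V \<longrightarrow>
     \<phi> (x, y, z, t) = (E4 x y z t P, E4 x y z t Q, E4 x y z t R, E4 x y z t S))"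
proof -
  have "(\<forall>v\<in>V. Q v) \<longleftrightarrow> (\<forall>x y z t. (x, y, z, t) \<in> V \<longrightarrow> Q (x, y, z, t))" for Q by auto
  then show ?thesis unfolding regular_map_def by (simp only: eval_xyzt_E4)
qed

lemma isomorphic_sym: "isomorphic_varieties V W \<Longrightarrow> isomorphic_varieties W V"
  unfolding isomorphic_varieties_def by blast

lemma regular_map_comp:
  assumes "regular_map V W \<phi>" "regular_map W U \<psi>"
  shows "regular_map V U (\<lambda>v. \<psi> (\<phi> v))"
proof -
  obtain P1 P2 P3 P4 where P: "\<forall>v\<in>V. \<phi> v \<in> W"
    "\<And>x y z t. (x, y, z, t) \<in> V \<Longrightarrow> \<phi> (x, y, z, t) = (E4 x y z t P1, E4 x y z t P2, E4 x y z t P3, E4 x y z t P4)"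
    using assms(1) unfolding regular_map_E4 by blast
  obtain Q1 Q2 Q3 Q4 where Q: "\<forall>v\<in>W. \<psi> v \<in> U"
    "\<And>x y z t. (x, y, z, t) \<in> W \<Longrightarrow> \<psi> (x, y, z, t) = (E4 x y z t Q1, E4 x y z t Q2, E4 x y z t Q3, E4 x y z t Q4)"
    using assms(2) unfolding regular_map_E4 by blast
  have "\<psi> (\<phi> (x, y, z, t)) = (E4 x y z t (E4 P1 P2 P3 P4 Q1), E4 x y z t (E4 P1 P2 P3 P4 Q2),
      E4 x y z t (E4 P1 P2 P3 P4 Q3), E4 x y z t (E4 P1 P2 P3 P4 Q4))" if v: "(x, y, z, t) \<in> V" for x y z t
  proof -
    have "(E4 x y z t P1, E4 x y z t P2, E4 x y z t P3, E4 x y z t P4) \<in> W" using P v by metis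
    from Q(2)[OF this] show ?thesis by (simp only: P(2)[OF v] E4_comp)
  qed
  then show ?thesis unfolding regular_map_E4 using P(1) Q(1) by blast
qed

lemma isomorphic_trans:
  assumes "isomorphic_varieties V W" "isomorphic_varieties W U"
  shows "isomorphic_varieties V U"
proof -
  obtain \<phi> \<psi> where 1: "regular_map V W \<phi>" "regular_map W V \<psi>" "\<forall>v\<in>V. \<psi> (\<phi> v) = v" "\<forall>w\<in>W. \<phi> (\<psi> w) = w"
    using assms(1) unfolding isomorphic_varieties_def by blast
  obtain \<phi>' \<psi>' where 2: "regular_map W U \<phi>'" "regular_map U W \<psi>'" "\<forall>v\<in>W. \<psi>' (\<phi>' v) = v" "\<forall>w\<in>U. \<phi>' (\<psi>' w) = w"
    using assms(2) unfolding isomorphic_varieties_def by blast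
  have m: "\<And>v. v \<in> V \<Longrightarrow> \<phi> v \<in> W" "\<And>v. v \<in> U \<Longrightarrow> \<psi>' v \<in> W"
    using 1(1) 2(2) by (auto simp: regular_map_def)
  show ?thesis
    unfolding isomorphic_varieties_def
    by (intro exI[of _ "\<lambda>v. \<phi>' (\<phi> v)"] exI[of _ "\<lambda>v. \<psi> (\<psi>' v)"])
      (use regular_map_comp[OF 1(1) 2(1)] regular_map_comp[OF 2(2) 1(2)] 1 2 m in auto)
qed

lemma E3_vars [simp]: "E3 z t x xS = x" "E3 z t x zS = z" "E3 z t x tS = t"
  by (simp_all add: xS_def zS_def tS_def)

definition yP :: poly_xyzt where "yP = [:[:[:0,1:]:]:]"

lemma E4_yP [simp]: "E4 x y z t yP = y"
  by (simp add: yP_def)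

text \<open>On the hypersurface of F2 the image u F2 + x^d e of F1 equals - x^d (u y - e), so y goes
  to (u y - e) / \<mu>^d. This can be inverted because u is a unit modulo x^d.\<close>

lemma iso_VF:
  assumes \<mu>: "\<mu> \<noteq> 0"
    and inv: "E3 Z T (cst \<mu> * xS) Z' = zS" "E3 Z T (cst \<mu> * xS) T' = tS"
    and inv': "E3 Z' T' (cst (inverse \<mu>) * xS) Z = zS" "E3 Z' T' (cst (inverse \<mu>) * xS) T = tS"
    and rel: "E3 Z T (cst \<mu> * xS) F1 = u * F2 + xS ^ d * e" and unit: "u * v = 1 + xS ^ d * w"
  shows "isomorphic_varieties (VF d F2) (VF d F1)"
proof -
  define ev where "ev = (\<lambda>p x z t. E3 z t x p :: complex)"
  have evh: "ev (p + q) x z t = ev p x z t + ev q x z t" "ev (p * q) x z t = ev p x z t * ev q x z t"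
    "ev (p ^ n) x z t = ev p x z t ^ n" "ev (cst c) x z t = c" "ev xS x z t = x" "ev zS x z t = z" "ev tS x z t = t" "ev 1 x z t = 1"
    for p q x z t n c by (simp_all add: ev_def E_hom)
  have sub: "ev (E3 Z T (cst \<mu> * xS) p) x z t = ev p (\<mu> * x) (ev Z x z t) (ev T x z t)" for p x z t
    by (simp add: ev_def E3_comp E_hom)
  have sub': "ev (E3 Z' T' (cst (inverse \<mu>) * xS) p) x z t = ev p (inverse \<mu> * x) (ev Z' x z t) (ev T' x z t)" for p x z t
    by (simp add: ev_def E3_comp E_hom)
  have i1: "ev Z' (\<mu> * x) (ev Z x z t) (ev T x z t) = z" "ev T' (\<mu> * x) (ev Z x z t) (ev T x z t) = t" for x z t
    unfolding sub[symmetric] inv by (simp_all add: evh)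
  have i2: "ev Z (inverse \<mu> * x) (ev Z' x z t) (ev T' x z t) = z" "ev T (inverse \<mu> * x) (ev Z' x z t) (ev T' x z t) = t" for x z t
    unfolding sub'[symmetric] inv' by (simp_all add: evh)
  have r: "ev F1 (\<mu> * x) (ev Z x z t) (ev T x z t) = ev u x z t * ev F2 x z t + x ^ d * ev e x z t" for x z t
    unfolding sub[symmetric] rel by (simp add: evh)
  have uv: "ev u x z t * ev v x z t = 1 + x ^ d * ev w x z t" for x z t
    using arg_cong[OF unit, of "\<lambda>p. ev p x z t"] by (simp add: evh)
  define m where "m = \<mu> ^ d"
  have m: "m \<noteq> 0" "inverse m * (m * c) = c" "m * (inverse m * c) = c" for c using \<mu> by (simp_all add: m_def)
  define \<phi> where "\<phi> = (\<lambda>(x, y, z, t). (\<mu> * x, inverse m * (ev u x z t * y - ev e x z t), ev Z x z t, ev T x z t))"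
  \<comment> \<open>Multiplying u y - e = m y' by v and using u v = 1 + x^d w and x^d y = - F2 gives
    y = v (m y' + e) + w F2.\<close>
  define \<psi>0 where "\<psi>0 = (\<lambda>y x z t. (x, ev v x z t * (m * y) + (ev w x z t * ev F2 x z t + ev v x z t * ev e x z t), z, t))"
  define \<psi> where "\<psi> = (\<lambda>(x, y, z, t). \<psi>0 y (inverse \<mu> * x) (ev Z' x z t) (ev T' x z t))"
  have VF: "(x, y, z, t) \<in> VF d F \<longleftrightarrow> x ^ d * y + ev F x z t = 0" for F x y z t by (simp add: VF_def ev_def)
  have mu: "\<mu> * (inverse \<mu> * x) = x" "inverse \<mu> * (\<mu> * x) = x" for x using \<mu> by simp_all
  have A: "\<phi> (x, y, z, t) \<in> VF d F1" if "(x, y, z, t) \<in> VF d F2" for x y z t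
  proof -
    have "(\<mu> * x) ^ d * (inverse m * (ev u x z t * y - ev e x z t)) = x ^ d * (m * (inverse m * (ev u x z t * y - ev e x z t)))"
      by (simp add: power_mult_distrib m_def ac_simps)
    also have "\<dots> = x ^ d * (ev u x z t * y - ev e x z t)" by (simp only: m)
    finally have "(\<mu> * x) ^ d * (inverse m * (ev u x z t * y - ev e x z t)) + (ev u x z t * ev F2 x z t + x ^ d * ev e x z t)
        = ev u x z t * (x ^ d * y + ev F2 x z t)" by (simp only: algebra_simps) simp
    also have "\<dots> = 0" using that unfolding VF by (simp only: mult_zero_right)
    finally show ?thesis unfolding \<phi>_def VF prod.case r .
  qed
  have B: "\<psi>0 y x z t \<in> VF d F2" if "x ^ d * (m * y) = - (ev u x z t * ev F2 x z t + x ^ d * ev e x z t)" for x y z t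
  proof -
    have "x ^ d * (ev v x z t * (m * y) + (ev w x z t * ev F2 x z t + ev v x z t * ev e x z t)) + ev F2 x z t
       = ev v x z t * (x ^ d * (m * y)) + x ^ d * ev v x z t * ev e x z t + (1 + x ^ d * ev w x z t) * ev F2 x z t"
      by (simp add: algebra_simps)
    also have "\<dots> = 0" unfolding that uv[symmetric] by (simp add: algebra_simps)
    finally show ?thesis unfolding \<psi>0_def VF .
  qed
  have rel1: "(inverse \<mu> * x) ^ d * (m * y) = - (ev u (inverse \<mu> * x) (ev Z' x z t) (ev T' x z t) * ev F2 (inverse \<mu> * x) (ev Z' x z t) (ev T' x z t)
      + (inverse \<mu> * x) ^ d * ev e (inverse \<mu> * x) (ev Z' x z t) (ev T' x z t))" if "(x, y, z, t) \<in> VF d F1" for x y z t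
  proof -
    have "(inverse \<mu> * x) ^ d * (m * y) = inverse m * (m * (x ^ d * y))"
      by (simp add: power_mult_distrib m_def power_inverse ac_simps)
    also have "\<dots> = - ev F1 x z t" unfolding m(2) using that by (simp add: VF eq_neg_iff_add_eq_0)
    also have "ev F1 x z t = ev F1 (\<mu> * (inverse \<mu> * x)) (ev Z (inverse \<mu> * x) (ev Z' x z t) (ev T' x z t)) (ev T (inverse \<mu> * x) (ev Z' x z t) (ev T' x z t))"
      unfolding i2 mu ..
    finally show ?thesis unfolding r .
  qed
  have C: "\<psi> (\<phi> (x, y, z, t)) = (x, y, z, t)" if "(x, y, z, t) \<in> VF d F2" for x y z t
  proof -
    have F2: "ev F2 x z t = - (x ^ d * y)" using that by (simp add: VF eq_neg_iff_add_eq_0 add.commute)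
    have "ev v x z t * (ev u x z t * y - ev e x z t) + (ev w x z t * ev F2 x z t + ev v x z t * ev e x z t)
       = (ev u x z t * ev v x z t) * y + ev w x z t * ev F2 x z t" by (simp add: algebra_simps)
    also have "\<dots> = y" unfolding uv F2 by (simp add: algebra_simps)
    finally show ?thesis by (simp add: \<phi>_def \<psi>_def \<psi>0_def i1 mu m(3) del: mult.assoc)
  qed
  have Dd: "\<phi> (\<psi> (x, y, z, t)) = (x, y, z, t)" if "(x, y, z, t) \<in> VF d F1" for x y z t
  proof -
    define x' z' t' where "x' = inverse \<mu> * x" and "z' = ev Z' x z t" and "t' = ev T' x z t"
    have R: "x' ^ d * (m * y) = - (ev u x' z' t' * ev F2 x' z' t' + x' ^ d * ev e x' z' t')"
      unfolding x'_def z'_def t'_def by (rule rel1[OF that])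
    have "ev u x' z' t' * (ev v x' z' t' * (m * y) + (ev w x' z' t' * ev F2 x' z' t' + ev v x' z' t' * ev e x' z' t')) - ev e x' z' t'
      = (ev u x' z' t' * ev v x' z' t') * (m * y) + ev w x' z' t' * (ev u x' z' t' * ev F2 x' z' t') + (ev u x' z' t' * ev v x' z' t' - 1) * ev e x' z' t'"
      by (simp add: algebra_simps)
    also have "\<dots> = m * y + ev w x' z' t' * (x' ^ d * (m * y) + (ev u x' z' t' * ev F2 x' z' t' + x' ^ d * ev e x' z' t'))"
      unfolding uv by (simp add: algebra_simps)
    also have "\<dots> = m * y" unfolding R by simp
    finally have y: "ev u x' z' t' * (ev v x' z' t' * (m * y) + (ev w x' z' t' * ev F2 x' z' t' + ev v x' z' t' * ev e x' z' t')) - ev e x' z' t' = m * y" .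
    show ?thesis
      unfolding \<psi>_def prod.case x'_def[symmetric] z'_def[symmetric] t'_def[symmetric] \<psi>0_def \<phi>_def y m(2)
      unfolding x'_def z'_def t'_def by (simp only: mu i2)
  qed
  have p1: "regular_map (VF d F2) (VF d F1) \<phi>"
    unfolding regular_map_E4
  proof (intro conjI)
    show "\<forall>v\<in>VF d F2. \<phi> v \<in> VF d F1" using A by auto
    show "\<exists>P Q R S. \<forall>x y z t. (x, y, z, t) \<in> VF d F2 \<longrightarrow>
     \<phi> (x, y, z, t) = (E4 x y z t P, E4 x y z t Q, E4 x y z t R, E4 x y z t S)"
      by (rule exI[of _ "up (cst \<mu> * xS)"], rule exI[of _ "cst (inverse m) * (up u * yP - up e)"], rule exI[of _ "up Z"], rule exI[of _ "up T"])
        (simp add: \<phi>_def ev_def E4_up E_hom)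
  qed
  have p2: "regular_map (VF d F1) (VF d F2) \<psi>"
    unfolding regular_map_E4
  proof (intro conjI)
    show "\<forall>v\<in>VF d F1. \<psi> v \<in> VF d F2" using B[OF rel1] by (auto simp: \<psi>_def)
    let ?s = "\<lambda>p. up (E3 Z' T' (cst (inverse \<mu>) * xS) p)"
    have s: "E4 x y z t (?s p) = ev p (inverse \<mu> * x) (ev Z' x z t) (ev T' x z t)" for p x y z t
      unfolding E4_up sub'[symmetric] by (simp add: ev_def)
    show "\<exists>P Q R S. \<forall>x y z t. (x, y, z, t) \<in> VF d F1 \<longrightarrow>
     \<psi> (x, y, z, t) = (E4 x y z t P, E4 x y z t Q, E4 x y z t R, E4 x y z t S)"
      by (rule exI[of _ "?s xS"], rule exI[of _ "?s v * (cst m * yP) + (?s w * ?s F2 + ?s v * ?s e)"], rule exI[of _ "?s zS"], rule exI[of _ "?s tS"])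
        (simp only: \<psi>_def \<psi>0_def prod.case E4_hom s evh E4_yP cst_complex_def simp_thms)
  qed
  show ?thesis
    unfolding isomorphic_varieties_def
    by (intro exI[of _ \<phi>] exI[of _ \<psi>] conjI p1 p2) (use C Dd in auto)
qed

section \<open>Existence of the normal form\<close>

lemma coeff_xS_power: "coeff (xS ^ n) i = (if i = n then 1 else 0)"
  by (simp add: xS_power)

lemma coeff_xS_const: "coeff (xS ^ n * [:c:]) i = (if i = n then c else 0)"
  by (simp add: coeff_xS_power)

lemma cst_1_xS: "cst 1 * xS = xS" "cst (inverse 1) * xS = xS" by simp_all

text \<open>The form \<open>y\<close> is invariant under the substitution, hence so is f, and the
  substitution with -f is the inverse.\<close>

lemma iso_shear:
  assumes y: "y = cst a * zS + tS" and f: "f = xS ^ n * E1 y g"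
  shows "isomorphic_varieties (VF d Fx) (VF d (E3 (zS + f) (tS - cst a * f) xS Fx))"
proof (rule isomorphic_sym, rule iso_VF[where \<mu> = 1 and Z' = "zS - f" and T' = "tS + cst a * f" and u = 1 and v = 1 and e = 0 and w = 0])
  have f1: "E3 Z T xS f = f" if "cst a * Z + T = y" for Z T
    using that by (simp add: f chom_E1_comp[OF chom_E3] E_hom y)
  have "cst a * (zS + f) + (tS - cst a * f) = y" "cst a * (zS - f) + (tS + cst a * f) = y"
    by (simp_all add: y algebra_simps)
  note ff = this[THEN f1]
  show "E3 (zS + f) (tS - cst a * f) (cst 1 * xS) (zS - f) = zS"
    "E3 (zS + f) (tS - cst a * f) (cst 1 * xS) (tS + cst a * f) = tS"
    "E3 (zS - f) (tS + cst a * f) (cst (inverse 1) * xS) (zS + f) = zS"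
    "E3 (zS - f) (tS + cst a * f) (cst (inverse 1) * xS) (tS - cst a * f) = tS"
    unfolding cst_1_xS by (simp_all add: E_hom ff)
qed simp_all

lemma E3_idS: "E3 zS tS xS p = p"
  unfolding zS_def tS_def xS_def zv_def tv_def by simp

text \<open>Since x divides q, a finite geometric series in q inverts 1 - q modulo x^d.\<close>

lemma iso_unit:
  assumes n: "n > 0"
  shows "isomorphic_varieties (VF d Fx) (VF d ((1 + xS ^ n * h) * Fx))"
proof -
  define q where "q = - (xS ^ n * h)"
  define p where "p = - (xS ^ (n - 1) * h)"
  have "q = xS * p" using n by (cases n) (simp_all add: q_def p_def mult.assoc)
  then have qd: "q ^ d = xS ^ d * p ^ d" by (simp only: power_mult_distrib)
  have "(1 - q) * (\<Sum>i<d. q ^ i) = 1 - q ^ d" by (rule one_diff_power_eq[symmetric])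
  moreover have "1 - q = 1 + xS ^ n * h" by (simp add: q_def)
  ultimately have u: "(1 + xS ^ n * h) * (\<Sum>i<d. q ^ i) = 1 + xS ^ d * (- (p ^ d))" by (simp add: qd)
  show ?thesis
    by (rule iso_VF[where \<mu> = 1 and Z = zS and T = tS and Z' = zS and T' = tS and e = 0, OF _ _ _ _ _ _ u])
      (simp_all only: cst_1_xS E3_idS, simp_all)
qed

lemma iso_cong:
  assumes "xS ^ d dvd F1 - F2"
  shows "isomorphic_varieties (VF d F2) (VF d F1)"
proof -
  obtain e where e: "F1 = F2 + xS ^ d * e" using assms by (rule xS_dvd_E)
  show ?thesis
    by (rule iso_VF[where \<mu> = 1 and Z = zS and T = tS and Z' = zS and T' = tS and e = e and u = 1 and v = 1 and w = 0])
      (simp_all only: cst_1_xS E3_idS e, simp_all)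
qed

text \<open>
  \<open>g\<close> is good if every multiple of \<open>x\<^sup>n g\<close> can be added to an equation, modulo \<open>x\<close> to the power \<open>n + 1\<close>,
  without changing the isomorphism class of the hypersurface.
\<close>

definition good :: "nat \<Rightarrow> nat \<Rightarrow> nat \<Rightarrow> nat \<Rightarrow> bp \<Rightarrow> bool" where
  "good d k l n g \<longleftrightarrow> (\<forall>c Fx. coeff Fx 0 = cusp k l \<longrightarrow> (\<exists>F'. isomorphic_varieties (VF d Fx) (VF d F') \<and>
     coeff F' 0 = cusp k l \<and> xS ^ Suc n dvd F' - (Fx + xS ^ n * [:cst c * g:])))"

lemma good_scale: "good d k l n g \<Longrightarrow> good d k l n (cst b * g)"
  unfolding good_def mult.assoc[symmetric] cst_mult[symmetric] by blast

lemma good_add: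
  assumes "good d k l n g" "good d k l n h"
  shows "good d k l n (g + h)"
  unfolding good_def
proof (intro allI impI)
  fix c Fx assume "coeff Fx 0 = cusp k l"
  then obtain F' where F': "isomorphic_varieties (VF d Fx) (VF d F')" "coeff F' 0 = cusp k l"
    "xS ^ Suc n dvd F' - (Fx + xS ^ n * [:cst c * g:])" using assms(1) unfolding good_def by blast
  then obtain F'' where F'': "isomorphic_varieties (VF d F') (VF d F'')" "coeff F'' 0 = cusp k l"
    "xS ^ Suc n dvd F'' - (F' + xS ^ n * [:cst c * h:])" using assms(2) unfolding good_def by blast
  have "[:cst c * (g + h):] = [:cst c * g:] + [:cst c * h:]" by (simp add: algebra_simps)
  then have "F'' - (Fx + xS ^ n * [:cst c * (g + h):]) = (F' - (Fx + xS ^ n * [:cst c * g:])) + (F'' - (F' + xS ^ n * [:cst c * h:]))"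
    by (simp only: distrib_left) (simp only: algebra_simps)
  then have "xS ^ Suc n dvd F'' - (Fx + xS ^ n * [:cst c * (g + h):])" using F'(3) F''(3) by (simp only: dvd_add)
  then show "\<exists>F'. isomorphic_varieties (VF d Fx) (VF d F') \<and> coeff F' 0 = cusp k l \<and> xS ^ Suc n dvd F' - (Fx + xS ^ n * [:cst c * (g + h):])"
    using isomorphic_trans[OF F'(1) F''(1)] F''(2) by blast
qed

lemma good_0: "good d k l n 0"
  unfolding good_def
  by (metis cancel_comm_monoid_add_class.diff_cancel dvd_0_right iso_cong mult_zero_right pCons_0_0 add_0_right)

lemma good_diff: "good d k l n g \<Longrightarrow> good d k l n h \<Longrightarrow> good d k l n (g - h)"
  using good_add[of d k l n g "- h"] good_scale[of d k l n h "- 1"] by (simp add: cst_minus)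

lemma good_sum: "(\<And>i. i \<in> I \<Longrightarrow> good d k l n (f i)) \<Longrightarrow> good d k l n (sum f I)"
  by (induction I rule: infinite_finite_induct) (simp_all add: good_0 good_add)

text \<open>Multiplying the equation by 1 + c x^n h adds c h r at order n.\<close>

lemma good_cusp:
  assumes n: "n > 0"
  shows "good d k l n (h * cusp k l)"
  unfolding good_def
proof (intro allI impI)
  fix c Fx assume F: "coeff Fx 0 = cusp k l"
  let ?F' = "(1 + xS ^ n * [:cst c * h:]) * Fx"
  have "?F' - (Fx + xS ^ n * [:cst c * (h * cusp k l):]) = xS ^ n * ([:cst c * h:] * Fx - [:cst c * (h * cusp k l):])"
    by (simp only: algebra_simps) simp
  moreover have "xS ^ 1 dvd [:cst c * h:] * Fx - [:cst c * (h * cusp k l):]"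
    unfolding xS_dvd_iff using F by (simp add: mult.assoc)
  then have "xS ^ n * xS ^ 1 dvd xS ^ n * ([:cst c * h:] * Fx - [:cst c * (h * cusp k l):])" by (intro mult_dvd_mono dvd_refl)
  ultimately have "xS ^ Suc n dvd ?F' - (Fx + xS ^ n * [:cst c * (h * cusp k l):])" by (simp only: power_Suc2 power_one_right)
  moreover have "coeff ?F' 0 = cusp k l" using n F by (simp add: coeff_mult coeff_xS_power)
  ultimately show "\<exists>F'. isomorphic_varieties (VF d Fx) (VF d F') \<and> coeff F' 0 = cusp k l \<and> xS ^ Suc n dvd F' - (Fx + xS ^ n * [:cst c * (h * cusp k l):])"
    using iso_unit[OF n] by blast
qed

section \<open>Changes of the equation by Hamiltonian fields\<close>

lemma E3_near_id:
  assumes "xS ^ n dvd Z - zS" "xS ^ n dvd T - tS"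
  shows "xS ^ n dvd E3 Z T xS p - p"
proof (induction p rule: S_induct)
  case z then show ?case using assms by (simp add: zS_def zv_def)
next
  case t then show ?case using assms by (simp add: tS_def tv_def)
next
  case x then show ?case by (simp add: xS_def)
next
  case (add p q)
  have "E3 Z T xS (p + q) - (p + q) = (E3 Z T xS p - p) + (E3 Z T xS q - q)" by (simp add: E_hom)
  then show ?case using add by (simp only: dvd_add)
next
  case (mult p q) then show ?case by (simp only: E3_hom dvd_diff_mult)
qed (simp add: E_hom)

lemma E3_first_order:
  assumes n: "n > 0" and F: "coeff Fx 0 = cusp k l"
  shows "xS ^ Suc n dvd E3 (zS + xS ^ n * U) (tS + xS ^ n * V) xS Fx
     - (Fx + xS ^ n * (of_nat k * zS ^ (k - 1) * U + of_nat l * tS ^ (l - 1) * V))"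
proof -
  let ?Z = "zS + xS ^ n * U" and ?T = "tS + xS ^ n * V"
  obtain G where G: "Fx = [:cusp k l:] + xS * G"
    using F by (cases Fx) (simp add: xS_def)
  have c: "[:cusp k l:] = zS ^ k + tS ^ l" by (simp add: cusp_def zS_def tS_def const_power)
  have sq: "xS ^ Suc n dvd (xS ^ n) ^ 2"
    using n by (simp only: power_mult[symmetric]) (rule le_imp_power_dvd, simp)
  have 1: "xS ^ Suc n dvd ?Z ^ k - (zS ^ k + xS ^ n * (of_nat k * zS ^ (k - 1) * U))"
    "xS ^ Suc n dvd ?T ^ l - (tS ^ l + xS ^ n * (of_nat l * tS ^ (l - 1) * V))"
    using power_first_order dvd_trans[OF sq] by blast+
  have "xS ^ n dvd E3 ?Z ?T xS G - G" by (rule E3_near_id) simp_all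
  then have 2: "xS ^ Suc n dvd xS * (E3 ?Z ?T xS G - G)" unfolding power_Suc by (intro mult_dvd_mono dvd_refl)
  have "E3 ?Z ?T xS Fx = ?Z ^ k + ?T ^ l + xS * E3 ?Z ?T xS G"
    unfolding G c by (simp add: E_hom)
  then have "E3 ?Z ?T xS Fx - (Fx + xS ^ n * (of_nat k * zS ^ (k - 1) * U + of_nat l * tS ^ (l - 1) * V))
     = (?Z ^ k - (zS ^ k + xS ^ n * (of_nat k * zS ^ (k - 1) * U))) + (?T ^ l - (tS ^ l + xS ^ n * (of_nat l * tS ^ (l - 1) * V)))
       + xS * (E3 ?Z ?T xS G - G)"
    unfolding G c right_diff_distrib distrib_left by simp
  then show ?thesis using 1 2 by (simp only: dvd_add)
qed

text \<open>The bracket of r and H: the first-order change of an equation congruent to r modulo x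
  under the Hamiltonian field of H.\<close>

definition ham :: "nat \<Rightarrow> nat \<Rightarrow> bp \<Rightarrow> bp" where
  "ham k l H = dz (cusp k l) * dt H - dt (cusp k l) * dz H"

lemma dcusp: "dz (cusp k l) = of_nat k * zv ^ (k - 1)" "dt (cusp k l) = of_nat l * tv ^ (l - 1)"
  by (simp_all add: cusp_def dz_simps dt_simps)

lemma ham_cst: "ham k l (cst c * H) = cst c * ham k l H"
  by (simp add: ham_def dz_simps dt_simps algebra_simps)

lemma ham_sum: "ham k l (sum f I) = (\<Sum>i\<in>I. ham k l (f i))"
  by (simp add: ham_def dz_simps dt_simps sum_distrib_left sum_subtractf)

lemma der_E1: "der D \<Longrightarrow> D (E1 a p) = E1 a (pderiv p) * D a"
  by (induction p rule: poly_gen_induct)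
    (simp_all add: der_simps E_hom pderiv_add pderiv_mult pderiv_pCons algebra_simps)

text \<open>The shear by c x^n g'(a z + t) is the flow of the Hamiltonian g(a z + t) at time c
  x^n.\<close>

lemma good_shear:
  assumes n: "n > 0"
  shows "good d k l n (ham k l (E1 (cst a * zv + tv) g))"
  unfolding good_def
proof (intro allI impI)
  fix c Fx assume F: "coeff Fx 0 = cusp k l"
  define u where "u = E1 (cst a * zv + tv) (pderiv g)"
  define f where "f = xS ^ n * E1 (cst a * zS + tS) (smult c (pderiv g))"
  let ?F' = "E3 (zS + f) (tS - cst a * f) xS Fx"
  have "[:cst a * zv + tv:] = cst a * zS + tS" by (simp add: zS_def tS_def cst_poly_def[where 'a = bp])
  then have "E1 (cst a * zS + tS) (smult c (pderiv g)) = [:cst c * u:]"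
    using chom_E1_comp[OF chom_const_poly, of "cst a * zv + tv" "smult c (pderiv g)"] by (simp add: u_def E1_smult)
  then have f: "f = xS ^ n * [:cst c * u:]" by (simp add: f_def)
  have T: "tS - cst a * f = tS + xS ^ n * [:- (cst a * cst c * u):]"
    by (simp add: f cst_poly_def[where 'a = bp] ac_simps)
  have ham: "ham k l (E1 (cst a * zv + tv) g) = of_nat k * zv ^ (k - 1) * u - of_nat l * tv ^ (l - 1) * (cst a * u)"
    unfolding ham_def dcusp der_E1[OF der_dz] der_E1[OF der_dt] u_def by (simp add: dz_simps dt_simps ac_simps)
  have on: "of_nat m = [:of_nat m:]" for m :: nat by (simp add: of_nat_poly)
  have "of_nat k * zS ^ (k - 1) * [:cst c * u:] + of_nat l * tS ^ (l - 1) * [:- (cst a * cst c * u):] = [:cst c * ham k l (E1 (cst a * zv + tv) g):]"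
    unfolding ham zS_def tS_def const_power by (simp add: of_nat_poly algebra_simps)
  then have "xS ^ Suc n dvd ?F' - (Fx + xS ^ n * [:cst c * ham k l (E1 (cst a * zv + tv) g):])"
    using E3_first_order[OF n F, of "[:cst c * u:]" "[:- (cst a * cst c * u):]"] unfolding T unfolding f by simp
  moreover have "isomorphic_varieties (VF d Fx) (VF d ?F')" by (rule iso_shear[OF refl f_def])
  moreover have "coeff ?F' 0 = cusp k l"
  proof -
    have "xS ^ 1 dvd xS ^ n" using n by (intro le_imp_power_dvd) simp
    then have "xS ^ 1 dvd f" unfolding f by (rule dvd_mult2)
    then have "xS ^ 1 dvd ?F' - Fx" by (intro E3_near_id) simp_all
    then have "coeff (?F' - Fx) 0 = 0" unfolding xS_dvd_iff by simp
    then show ?thesis using F by simp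
  qed
  ultimately show "\<exists>F'. isomorphic_varieties (VF d Fx) (VF d F') \<and> coeff F' 0 = cusp k l \<and> xS ^ Suc n dvd F' - (Fx + xS ^ n * [:cst c * ham k l (E1 (cst a * zv + tv) g):])"
    by blast
qed

text \<open>Comparing the values at \<open>a\<close> and \<open>2 a\<close> eliminates the top coefficient.\<close>

lemma good_coeffs:
  "(\<And>a. good d k l n (\<Sum>i\<le>m. cst (a ^ i) * v i)) \<Longrightarrow> i \<le> m \<Longrightarrow> good d k l n (v i)"
proof (induction m arbitrary: v i)
  case 0
  then show ?case using 0(1)[of 1] by simp
next
  case (Suc m)
  define v' where "v' i = cst (2 ^ i - 2 ^ Suc m) * v i" for i
  have "good d k l n (\<Sum>i\<le>m. cst (a ^ i) * v' i)" for a
  proof -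
    have "(\<Sum>i\<le>m. cst (a ^ i) * v' i) = (\<Sum>i\<le>Suc m. cst (a ^ i) * v' i)" by (simp add: v'_def)
    also have "\<dots> = (\<Sum>i\<le>Suc m. cst ((2 * a) ^ i) * v i - cst (2 ^ Suc m) * (cst (a ^ i) * v i))"
      unfolding v'_def by (rule sum.cong) (simp_all only: cst_diff cst_mult power_mult_distrib algebra_simps)
    also have "\<dots> = (\<Sum>i\<le>Suc m. cst ((2 * a) ^ i) * v i) - cst (2 ^ Suc m) * (\<Sum>i\<le>Suc m. cst (a ^ i) * v i)"
      by (simp only: sum_subtractf sum_distrib_left)
    finally show ?thesis by (simp only: good_diff[OF Suc.prems(1) good_scale[OF Suc.prems(1)]])
  qed
  then have "good d k l n (v' i)" if "i \<le> m" for i using Suc.IH that by blast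
  then have 1: "good d k l n (v i)" if "i \<le> m" for i
  proof -
    have "(2::complex) ^ i \<noteq> 2 ^ Suc m"
    proof
      assume "(2::complex) ^ i = 2 ^ Suc m"
      then have "of_nat (2 ^ i) = (of_nat (2 ^ Suc m) :: complex)" by simp
      then have "(2::nat) ^ i = 2 ^ Suc m" by (simp only: of_nat_eq_iff)
      then have "i = Suc m" using power_inject_exp[of "2::nat" i "Suc m"] by simp
      then show False using that by simp
    qed
    then have "v i = cst (inverse (2 ^ i - 2 ^ Suc m)) * v' i" unfolding v'_def by (intro cst_inverse_cancel[symmetric]) simp
    then show ?thesis using good_scale \<open>\<And>i. i \<le> m \<Longrightarrow> good d k l n (v' i)\<close> that by metis
  qed
  have "good d k l n ((\<Sum>i\<le>Suc m. cst (1 ^ i) * v i) - (\<Sum>i\<le>m. v i))"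
    by (intro good_diff Suc.prems good_sum 1) simp
  then have "good d k l n (v (Suc m))" by simp
  then show ?case using 1 Suc.prems(2) le_Suc_eq by blast
qed

lemma good_unscale:
  assumes "c \<noteq> 0" "good d k l n (cst c * g)"
  shows "good d k l n g"
  using good_scale[OF assms(2), of "inverse c"] unfolding cst_inverse_cancel[OF assms(1)] .

lemma ham_monom:
  "ham k l (zv ^ i * tv ^ j) = of_nat (k * j) * (zv ^ (k - 1) * zv ^ i * tv ^ (j - 1)) - of_nat (l * i) * (tv ^ (l - 1) * zv ^ (i - 1) * tv ^ j)"
  by (simp add: ham_def dcusp dz_simps dt_simps ac_simps)

text \<open>By the binomial theorem the Hamiltonian (a z + t)^m is a polynomial in a whose
  coefficients are nonzero multiples of the monomials of degree m; \<open>good_coeffs\<close>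
  isolates them.\<close>

lemma good_ham_monom:
  assumes n: "n > 0"
  shows "good d k l n (ham k l (zv ^ i * tv ^ j))"
proof -
  define m where "m = i + j"
  define v where "v i = cst (of_nat (m choose i)) * ham k l (zv ^ i * tv ^ (m - i))" for i
  have "good d k l n (\<Sum>i\<le>m. cst (a ^ i) * v i)" for a
  proof -
    have "E1 (cst a * zv + tv) ([:0,1:] ^ m) = (\<Sum>i\<le>m. of_nat (m choose i) * (cst a * zv) ^ i * tv ^ (m - i))"
      unfolding E1_X_power by (rule binomial_ring)
    also have "\<dots> = (\<Sum>i\<le>m. cst (a ^ i * of_nat (m choose i)) * (zv ^ i * tv ^ (m - i)))"
      by (rule sum.cong) (simp_all add: cst_mult cst_of_nat cst_power power_mult_distrib)
    finally have "ham k l (E1 (cst a * zv + tv) ([:0,1:] ^ m)) = (\<Sum>i\<le>m. cst (a ^ i) * v i)"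
      by (simp only: ham_sum ham_cst v_def cst_mult mult.assoc)
    then show ?thesis using good_shear[OF n] by metis
  qed
  then have "good d k l n (v i)" by (rule good_coeffs) (simp add: m_def)
  then have "good d k l n (cst (of_nat (m choose i)) * ham k l (zv ^ i * tv ^ j))" by (simp add: v_def m_def)
  then show ?thesis by (rule good_unscale[rotated]) (simp add: m_def)
qed

text \<open>The bracket of r with z^i t^(j+1) combines z^(k-1+i) t^j and z^(i-1) t^(l+j); a multiple
  of r trades the second for the first. The resulting coefficient k (j+1) + l i is positive, hence
  nonzero.\<close>

lemma good_high_z:
  assumes n: "n > 0" and kl: "k > 0" "l > 0"
  shows "good d k l n (zv ^ (k - 1 + i) * tv ^ j)"
proof -
  define A where "A = zv ^ (k - 1 + i) * tv ^ j"
  define N :: bp where "N = of_nat (l * i)"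
  have 1: "zv ^ (k - 1) * zv ^ i * tv ^ j = A" by (simp add: A_def power_add)
  have 2: "N * zv ^ (i - 1) * tv ^ j * zv ^ k = N * A"
  proof (cases i)
    case (Suc i')
    then have "zv ^ (k - 1 + i) = zv ^ i' * zv ^ k" using kl by (simp flip: power_add add: add.commute)
    then show ?thesis by (simp add: A_def Suc ac_simps)
  qed (simp add: N_def)
  have 3: "tv ^ (l - 1) * zv ^ (i - 1) * tv ^ Suc j = zv ^ (i - 1) * tv ^ j * tv ^ l"
    using kl by (cases l) (simp_all add: ac_simps)
  have "ham k l (zv ^ i * tv ^ Suc j) + (N * zv ^ (i - 1) * tv ^ j) * cusp k l
      = of_nat (k * Suc j) * A - N * (zv ^ (i - 1) * tv ^ j * tv ^ l) + (N * A + N * (zv ^ (i - 1) * tv ^ j * tv ^ l))"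
    unfolding ham_monom cusp_def distrib_left 2 3 diff_Suc_1 1 N_def[symmetric] by (simp only: mult.assoc)
  also have "\<dots> = (of_nat (k * Suc j) + N) * A" by (simp add: algebra_simps)
  also have "\<dots> = cst (of_nat (k * Suc j + l * i)) * A" by (simp only: N_def cst_of_nat cst_add of_nat_add)
  finally have e: "ham k l (zv ^ i * tv ^ Suc j) + (N * zv ^ (i - 1) * tv ^ j) * cusp k l = cst (of_nat (k * Suc j + l * i)) * A" .
  have "good d k l n (cst (of_nat (k * Suc j + l * i)) * A)"
    unfolding e[symmetric] by (intro good_add good_ham_monom good_cusp n)
  then show ?thesis unfolding A_def
    by (rule good_unscale[rotated]) (use kl in \<open>simp only: of_nat_eq_0_iff, simp\<close>)
qed

lemma good_high_t:
  assumes n: "n > 0" and kl: "k > 0" "l > 0"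
  shows "good d k l n (zv ^ i * tv ^ (l - 1 + j))"
proof -
  define A where "A = zv ^ i * tv ^ (l - 1 + j)"
  define N :: bp where "N = of_nat (k * j)"
  have 1: "tv ^ (l - 1) * zv ^ i * tv ^ j = A" by (simp add: A_def power_add ac_simps)
  have 2: "N * zv ^ i * tv ^ (j - 1) * tv ^ l = N * A"
  proof (cases j)
    case (Suc j')
    then have "tv ^ (l - 1 + j) = tv ^ j' * tv ^ l" using kl by (simp flip: power_add add: add.commute)
    then show ?thesis by (simp add: A_def Suc ac_simps)
  qed (simp add: N_def)
  have 3: "zv ^ (k - 1) * zv ^ Suc i * tv ^ (j - 1) = zv ^ i * tv ^ (j - 1) * zv ^ k"
    using kl by (cases k) (simp_all add: ac_simps)
  have "ham k l (zv ^ Suc i * tv ^ j) - (N * zv ^ i * tv ^ (j - 1)) * cusp k l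
      = N * (zv ^ i * tv ^ (j - 1) * zv ^ k) - of_nat (l * Suc i) * A - (N * (zv ^ i * tv ^ (j - 1) * zv ^ k) + N * A)"
    unfolding ham_monom cusp_def distrib_left 2 3 diff_Suc_1 1 N_def[symmetric] by (simp only: mult.assoc)
  also have "\<dots> = - ((of_nat (l * Suc i) + N) * A)" by (simp add: algebra_simps)
  also have "\<dots> = cst (- of_nat (l * Suc i + k * j)) * A" by (simp only: N_def cst_minus cst_add cst_of_nat of_nat_add minus_mult_left)
  finally have e: "ham k l (zv ^ Suc i * tv ^ j) - (N * zv ^ i * tv ^ (j - 1)) * cusp k l = cst (- of_nat (l * Suc i + k * j)) * A" .
  have "good d k l n (cst (- of_nat (l * Suc i + k * j)) * A)"
    unfolding e[symmetric] by (intro good_diff good_ham_monom good_cusp n)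
  then show ?thesis unfolding A_def
    by (rule good_unscale[rotated]) (use kl in \<open>simp only: neg_equal_0_iff_equal of_nat_eq_0_iff, simp\<close>)
qed

lemma decompose:
  assumes n: "n > 0" and kl: "k > 0" "l > 0" and kl2: "k \<ge> 2" "l \<ge> 2"
  shows "\<exists>c q. g = (\<Sum>v\<in>idx k l. cst (c v) * (zv ^ fst v * tv ^ snd v)) + q \<and> good d k l n q"
proof -
  define N where "N g \<longleftrightarrow> (\<exists>c q. g = (\<Sum>v\<in>idx k l. cst (c v) * (zv ^ fst v * tv ^ snd v)) + q \<and> good d k l n q)" for g
  have add: "N (g + h)" if gh: "N g" "N h" for g h
  proof -
    obtain c q c' q' where "g = (\<Sum>v\<in>idx k l. cst (c v) * (zv ^ fst v * tv ^ snd v)) + q" "good d k l n q"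
      "h = (\<Sum>v\<in>idx k l. cst (c' v) * (zv ^ fst v * tv ^ snd v)) + q'" "good d k l n q'" using gh unfolding N_def by blast
    then have "g + h = (\<Sum>v\<in>idx k l. cst (c v + c' v) * (zv ^ fst v * tv ^ snd v)) + (q + q')" "good d k l n (q + q')"
      by (simp_all add: cst_add distrib_right sum.distrib good_add)
    then show ?thesis unfolding N_def by (intro exI[of _ "\<lambda>v. c v + c' v"] exI[of _ "q + q'"]) simp
  qed
  have monom: "N (cst c * (zv ^ i * tv ^ j))" for c i j
  proof (cases "(i, j) \<in> idx k l")
    case True
    have "(\<Sum>v\<in>idx k l. cst (if v = (i, j) then c else 0) * (zv ^ fst v * tv ^ snd v)) = (\<Sum>v\<in>idx k l. if v = (i, j) then cst c * (zv ^ i * tv ^ j) else 0)"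
      by (rule sum.cong) auto
    also have "\<dots> = cst c * (zv ^ i * tv ^ j)" using True finite_idx[of k l] by simp
    finally show ?thesis unfolding N_def by (intro exI[of _ "\<lambda>v. if v = (i, j) then c else 0"] exI[of _ 0]) (simp add: good_0)
  next
    case False
    then have "i \<ge> k - 1 \<or> j \<ge> l - 1" using kl2 by (auto simp: idx_def)
    then have "good d k l n (zv ^ i * tv ^ j)"
      using good_high_z[OF n kl, of d "i - (k - 1)" j] good_high_t[OF n kl, of d i "j - (l - 1)"] by auto
    then show ?thesis unfolding N_def using good_scale by (intro exI[of _ "\<lambda>v. 0"] exI[of _ "cst c * (zv ^ i * tv ^ j)"]) simp
  qed
  have "\<forall>i j. N (zv ^ i * tv ^ j * g)"
  proof (induction g rule: bp_induct_mod)
    case (const c) then show ?case using monom by (simp add: mult.commute)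
  next
    case (z p)
    have "zv ^ i * tv ^ j * (zv * p) = zv ^ Suc i * tv ^ j * p" for i j by (simp add: ac_simps)
    then show ?case using z by metis
  next
    case (t p)
    have "zv ^ i * tv ^ j * (tv * p) = zv ^ i * tv ^ Suc j * p" for i j by (simp add: ac_simps)
    then show ?case using t by metis
  next
    case (add p q) then show ?case using \<open>\<And>g h. N g \<Longrightarrow> N h \<Longrightarrow> N (g + h)\<close> by (simp add: distrib_left)
  qed
  from this[rule_format, of 0 0] show ?thesis unfolding N_def by simp
qed

text \<open>At order n the deviation splits into monomials from \<open>idx k l\<close>, absorbed by
  the coefficients of x^n in a, and a good part, removed by an isomorphism. By
  \<open>iso_cong\<close>, agreement modulo x^d is enough.\<close>

theorem normal_form_exists:
  assumes kl: "k \<ge> 2" "l \<ge> 2" and F0: "coeff Fx 0 = cusp k l" and d: "d \<ge> 1"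
  shows "\<exists>a. (\<forall>v. coeff (a v) 0 = 0) \<and> isomorphic_varieties (VF d Fx) (VF d (FS k l a))"
proof -
  have "\<exists>a F'. (\<forall>v. coeff (a v) 0 = 0) \<and> isomorphic_varieties (VF d Fx) (VF d F') \<and> coeff F' 0 = cusp k l \<and> xS ^ n dvd F' - FS k l a"
    if "1 \<le> n" for n
    using that
  proof (induction n rule: dec_induct)
    case base
    have "xS ^ 1 dvd Fx - FS k l (\<lambda>_. 0)" unfolding xS_dvd_iff using F0 by (simp add: coeff_FS)
    moreover have "isomorphic_varieties (VF d Fx) (VF d Fx)" by (rule iso_cong) simp
    ultimately show ?case using F0 by (intro exI[of _ "\<lambda>_. 0"] exI[of _ Fx]) simp
  next
    case (step n)
    then have n: "n > 0" by simp
    obtain a F1 where a: "\<forall>v. coeff (a v) 0 = 0" and F1: "isomorphic_varieties (VF d Fx) (VF d F1)" "coeff F1 0 = cusp k l" "xS ^ n dvd F1 - FS k l a"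
      using step by blast
    obtain c q where cq: "coeff F1 n - coeff (FS k l a) n = (\<Sum>v\<in>idx k l. cst (c v) * (zv ^ fst v * tv ^ snd v)) + q" "good d k l n q"
      using decompose[OF n, of k l "coeff F1 n - coeff (FS k l a) n" d] kl by auto
    obtain F2 where F2: "isomorphic_varieties (VF d F1) (VF d F2)" "coeff F2 0 = cusp k l"
      "xS ^ Suc n dvd F2 - (F1 + xS ^ n * [:cst (-1) * q:])" using cq(2) F1(2) unfolding good_def by blast
    define a' where "a' v = a v + monom (c v) n" for v
    have "coeff F2 i = coeff (FS k l a') i" if "i < Suc n" for i
    proof -
      have "coeff F2 i = coeff F1 i + coeff (xS ^ n * [:cst (-1) * q:]) i"
        using F2(3) that unfolding xS_dvd_iff by simp
      then have F2i: "coeff F2 i = coeff F1 i - (if i = n then q else 0)"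
        unfolding coeff_xS_const by (simp add: cst_minus)
      have "coeff (FS k l a') i = coeff (FS k l a) i + (if i = n then \<Sum>v\<in>idx k l. cst (c v) * (zv ^ fst v * tv ^ snd v) else 0)"
        by (simp add: coeff_FS a'_def cst_add distrib_right sum.distrib)
      moreover have "i < n \<Longrightarrow> coeff F1 i = coeff (FS k l a) i" using F1(3) unfolding xS_dvd_iff by simp
      ultimately show ?thesis using F2i cq(1) that by (cases "i = n") (simp_all add: algebra_simps)
    qed
    then have "xS ^ Suc n dvd F2 - FS k l a'" unfolding xS_dvd_iff by simp
    moreover have "\<forall>v. coeff (a' v) 0 = 0" using a n by (simp add: a'_def)
    ultimately show ?case using isomorphic_trans[OF F1(1) F2(1)] F2(2) by blast
  qed
  from this[OF d] obtain a F' where "\<forall>v. coeff (a v) 0 = 0" "isomorphic_varieties (VF d Fx) (VF d F')" "xS ^ d dvd F' - FS k l a" by blast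
  then show ?thesis using isomorphic_trans isomorphic_sym[OF iso_cong] by blast
qed

section \<open>Homomorphisms from the algebra B\<close>

lemma eval_xzt_E3: "eval_xzt g (x, z, t) = E3 x z t g"
proof -
  have "chom (\<lambda>p. eval_xzt p (x, z, t))" by (rule chomI) (simp_all add: cst_poly_def)
  from chom_E3_eq[OF this, of g] show ?thesis by simp
qed

text \<open>\<open>poly_xzt\<close> and \<open>S\<close> are the same type read with different
  variable orders; \<open>E3 xS zS tS\<close> converts the first into the second.\<close>

definition FX :: "nat \<Rightarrow> nat \<Rightarrow> poly_xzt \<Rightarrow> S" where
  "FX k l g = zS ^ k + tS ^ l + xS * E3 xS zS tS g"

lemma hypersurface_VF: "hypersurface d k l g = VF d (FX k l g)"
  by (simp add: hypersurface_def VF_def FX_def E_hom chom_E3_comp[OF chom_E3] eval_xzt_E3 add.assoc del: eval_xzt.simps)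

lemma coeff_FX_0: "coeff (FX k l g) 0 = cusp k l"
proof -
  have "zS ^ k + tS ^ l = [:cusp k l:]" by (simp add: zS_def tS_def const_power cusp_def)
  then show ?thesis by (simp add: FX_def xS_def)
qed

lemma threefold_VF:
  assumes "centered_hom k l \<alpha>"
  shows "threefold d k l \<alpha> = VF d (FS k l (\<lambda>v. \<alpha> (var_a v)))"
proof -
  have dvd: "[:0, 1:] dvd \<alpha> (var_a v)" if "v \<in> idx k l" for v
    using assms var_a_in_m0[OF that] by (auto simp: centered_hom_def)
  have g: "x * eval_xzt (g_of k l \<alpha>) (x, z, t) = (\<Sum>v\<in>idx k l. poly (\<alpha> (var_a v)) x * (z ^ fst v * t ^ snd v))" for x z t
  proof -
    have "chom (\<lambda>p. eval_xzt p (x, z, t))" by (rule chomI) (simp_all add: cst_poly_def)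
    note sum = chom_sum[OF this]
    have "eval_xzt (g_of k l \<alpha>) (x, z, t) = (\<Sum>v\<in>idx k l. poly (\<alpha> (var_a v) div [:0, 1:]) x * z ^ fst v * t ^ snd v)"
      unfolding g_of_def by (simp add: sum case_prod_beta eval_xzt_monomial del: eval_xzt.simps)
    also have "x * \<dots> = (\<Sum>v\<in>idx k l. poly (\<alpha> (var_a v)) x * (z ^ fst v * t ^ snd v))"
      unfolding sum_distrib_left
    proof (rule sum.cong[OF refl])
      fix v assume "v \<in> idx k l"
      then have "poly (\<alpha> (var_a v)) x = poly ([:0, 1:] * (\<alpha> (var_a v) div [:0, 1:])) x"
        by (simp only: dvd_mult_div_cancel[OF dvd])
      then show "x * (poly (\<alpha> (var_a v) div [:0, 1:]) x * z ^ fst v * t ^ snd v) = poly (\<alpha> (var_a v)) x * (z ^ fst v * t ^ snd v)"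
        by (simp add: mult.assoc)
    qed
    finally show ?thesis .
  qed
  show ?thesis
    unfolding threefold_def hypersurface_def VF_def g chom_Fg[OF chom_E3] E3_vars
    unfolding Fg_def E1_eq_poly by (simp add: add.assoc)
qed

lemma centered_hom_coeff_0:
  assumes "centered_hom k l \<alpha>" "v \<in> idx k l"
  shows "coeff (\<alpha> (var_a v)) 0 = 0"
proof -
  have "[:0, 1:] dvd \<alpha> (var_a v)" using assms var_a_in_m0[of v k l] by (auto simp: centered_hom_def)
  then show ?thesis by (auto simp: dvd_def)
qed

section \<open>Evaluation homomorphisms on the algebra B\<close>

definition power_prod :: "(nat \<times> nat \<Rightarrow> 'a::comm_ring_1) \<Rightarrow> (nat \<times> nat \<Rightarrow>\<^sub>0 nat) \<Rightarrow> 'a" where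
  "power_prod a m = (\<Prod>v\<in>Poly_Mapping.keys m. a v ^ Poly_Mapping.lookup m v)"

lemma power_prod_superset:
  "finite A \<Longrightarrow> Poly_Mapping.keys m \<subseteq> A \<Longrightarrow> power_prod a m = (\<Prod>v\<in>A. a v ^ Poly_Mapping.lookup m v)"
  unfolding power_prod_def by (rule prod.mono_neutral_left) (auto simp: in_keys_iff)

lemma power_prod_0 [simp]: "power_prod a 0 = 1"
  by (simp add: power_prod_def)

lemma power_prod_add: "power_prod a (m + n) = power_prod a m * power_prod a n"
proof -
  let ?A = "Poly_Mapping.keys m \<union> Poly_Mapping.keys n"
  have A: "finite ?A" "Poly_Mapping.keys (m + n) \<subseteq> ?A" using keys_add[of m n] by auto
  show ?thesis
    by (simp add: power_prod_superset[OF A] power_prod_superset[OF A(1), of m] power_prod_superset[OF A(1), of n]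
        lookup_add power_add prod.distrib)
qed

definition eval_a :: "(nat \<times> nat \<Rightarrow> complex poly) \<Rightarrow> poly_a \<Rightarrow> complex poly" where
  "eval_a a b = (\<Sum>m\<in>Poly_Mapping.keys b. [:Poly_Mapping.lookup b m:] * power_prod a m)"

lemma eval_a_superset:
  "finite A \<Longrightarrow> Poly_Mapping.keys b \<subseteq> A \<Longrightarrow> eval_a a b = (\<Sum>m\<in>A. [:Poly_Mapping.lookup b m:] * power_prod a m)"
  unfolding eval_a_def by (rule sum.mono_neutral_left) (auto simp: in_keys_iff)

lemma eval_a_single: "eval_a a (Poly_Mapping.single m c) = [:c:] * power_prod a m"
  by (subst eval_a_superset[of "{m}"]) auto

lemma eval_a_add: "eval_a a (p + q) = eval_a a p + eval_a a q"
proof -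
  let ?A = "Poly_Mapping.keys p \<union> Poly_Mapping.keys q"
  have A: "finite ?A" "Poly_Mapping.keys (p + q) \<subseteq> ?A" using keys_add[of p q] by auto
  have "[:x + y:] * c = [:x:] * c + [:y:] * c" for x y :: complex and c
    by (simp add: smult_add_left)
  then show ?thesis
    by (simp only: eval_a_superset[OF A] eval_a_superset[OF A(1) Un_upper1] eval_a_superset[OF A(1) Un_upper2]
        lookup_add sum.distrib)
qed

lemma eval_a_sum: "finite A \<Longrightarrow> eval_a a (\<Sum>i\<in>A. f i) = (\<Sum>i\<in>A. eval_a a (f i))"
  by (induction A rule: finite_induct) (simp_all add: eval_a_add eval_a_def[of a 0])

lemma poly_a_expand: "(p :: poly_a) = (\<Sum>m\<in>Poly_Mapping.keys p. Poly_Mapping.single m (Poly_Mapping.lookup p m))"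
proof (rule poly_mapping_eqI)
  fix m
  show "Poly_Mapping.lookup p m = Poly_Mapping.lookup (\<Sum>m\<in>Poly_Mapping.keys p. Poly_Mapping.single m (Poly_Mapping.lookup p m)) m"
    unfolding lookup_sum lookup_single when_def by (simp add: in_keys_iff)
qed

lemma eval_a_mult: "eval_a a (p * q) = eval_a a p * eval_a a q"
proof -
  let ?s = "\<lambda>p m. Poly_Mapping.single m (Poly_Mapping.lookup p m)"
  have s: "eval_a a (?s p m * ?s q n) = eval_a a (?s p m) * eval_a a (?s q n)" for m n
    by (simp add: mult_single eval_a_single power_prod_add ac_simps)
  have "eval_a a ((\<Sum>m\<in>Poly_Mapping.keys p. ?s p m) * (\<Sum>n\<in>Poly_Mapping.keys q. ?s q n))
      = eval_a a (\<Sum>m\<in>Poly_Mapping.keys p. ?s p m) * eval_a a (\<Sum>n\<in>Poly_Mapping.keys q. ?s q n)"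
    by (simp add: sum_product eval_a_sum s)
  then show ?thesis by (simp only: poly_a_expand[symmetric])
qed

lemma eval_a_const: "eval_a a (const_a c) = [:c:]"
  by (simp add: const_a_def eval_a_single)

lemma eval_a_var: "eval_a a (var_a v) = a v"
  by (simp add: var_a_def eval_a_single power_prod_def)

lemma centered_hom_eval_a:
  assumes "\<And>v. coeff (a v) 0 = 0"
  shows "centered_hom k l (eval_a a)"
proof -
  have "[:0, 1:] dvd a v" for v
    using assms[of v] by (cases "a v") (auto simp: dvd_def intro: exI[of _ "_ :: complex poly"])
  then have "[:0, 1:] dvd eval_a a (\<Sum>v\<in>idx k l. q v * var_a v)" for q
    by (simp only: eval_a_sum[OF finite_idx] eval_a_mult eval_a_var) (intro dvd_sum dvd_mult)
  then show ?thesis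
    by (auto simp: centered_hom_def alg_hom_B_def m0_def eval_a_const eval_a_add eval_a_mult)
qed

lemma B_add: "p \<in> B k l \<Longrightarrow> q \<in> B k l \<Longrightarrow> p + q \<in> B k l"
  using keys_add[of p q] by (auto simp: B_def)

lemma B_mult:
  assumes "p \<in> B k l" "q \<in> B k l" shows "p * q \<in> B k l"
proof -
  have "Poly_Mapping.keys m \<subseteq> idx k l" if m: "m \<in> Poly_Mapping.keys (p * q)" for m
  proof -
    obtain a b where "m = a + b" "a \<in> Poly_Mapping.keys p" "b \<in> Poly_Mapping.keys q"
      using set_mp[OF keys_mult m] by blast
    then show ?thesis using assms keys_add[of a b] unfolding B_def by blast
  qed
  then show ?thesis by (simp add: B_def)
qed

lemma subst_a_power_prod:
  "subst_a s b = (\<Sum>m\<in>Poly_Mapping.keys b. const_a (Poly_Mapping.lookup b m) * power_prod s m)"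
  by (simp add: subst_a_def power_prod_def)

text \<open>Since \<gamma> is a homomorphism only on \<open>B k l\<close>, every partial product and
  sum has to be shown to lie there. For s = \<open>var_a\<close> the statement says that \<gamma> is
  determined by its values on the indeterminates.\<close>

lemma alg_hom_subst_a:
  assumes h: "alg_hom_B k l \<gamma>" and s: "\<And>v. v \<in> idx k l \<Longrightarrow> s v \<in> B k l" and b: "b \<in> B k l"
  shows "\<gamma> (subst_a s b) = eval_a (\<lambda>v. \<gamma> (s v)) b"
proof -
  have const: "\<gamma> (const_a c) = [:c:]" for c using h by (simp add: alg_hom_B_def)
  have add: "\<gamma> (p + q) = \<gamma> p + \<gamma> q" and mult: "\<gamma> (p * q) = \<gamma> p * \<gamma> q" if "p \<in> B k l" "q \<in> B k l" for p q
    using h that by (simp_all add: alg_hom_B_def)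
  have c01: "(0::poly_a) = const_a 0" "(1::poly_a) = const_a 1" by (simp_all add: const_a_def)
  have power: "p ^ n \<in> B k l \<and> \<gamma> (p ^ n) = \<gamma> p ^ n" if "p \<in> B k l" for p n
    by (induction n) (use that in \<open>simp_all add: B_mult mult c01 const const_a_in_B one_pCons\<close>)
  have prod: "(\<Prod>i\<in>A. f i) \<in> B k l \<and> \<gamma> (\<Prod>i\<in>A. f i) = (\<Prod>i\<in>A. \<gamma> (f i))"
    if "finite A" "\<And>i. i \<in> A \<Longrightarrow> f i \<in> B k l" for A :: "(nat \<times> nat) set" and f
    using that by (induction A rule: finite_induct) (simp_all add: B_mult mult c01 const const_a_in_B one_pCons)
  have sum: "(\<Sum>i\<in>A. f i) \<in> B k l \<and> \<gamma> (\<Sum>i\<in>A. f i) = (\<Sum>i\<in>A. \<gamma> (f i))"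
    if "finite A" "\<And>i. i \<in> A \<Longrightarrow> f i \<in> B k l" for A :: "((nat \<times> nat) \<Rightarrow>\<^sub>0 nat) set" and f
    using that by (induction A rule: finite_induct) (simp_all add: B_add add c01 const const_a_in_B)
  have pp: "power_prod s m \<in> B k l \<and> \<gamma> (power_prod s m) = power_prod (\<lambda>v. \<gamma> (s v)) m" if "m \<in> Poly_Mapping.keys b" for m
  proof -
    have sB: "s v \<in> B k l" if "v \<in> Poly_Mapping.keys m" for v
    proof (rule s)
      show "v \<in> idx k l" using b \<open>m \<in> Poly_Mapping.keys b\<close> that unfolding B_def by blast
    qed
    have "(\<Prod>v\<in>Poly_Mapping.keys m. s v ^ Poly_Mapping.lookup m v) \<in> B k l \<and>
        \<gamma> (\<Prod>v\<in>Poly_Mapping.keys m. s v ^ Poly_Mapping.lookup m v) = (\<Prod>v\<in>Poly_Mapping.keys m. \<gamma> (s v ^ Poly_Mapping.lookup m v))"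
      by (rule prod) (use power sB in auto)
    moreover have "(\<Prod>v\<in>Poly_Mapping.keys m. \<gamma> (s v ^ Poly_Mapping.lookup m v)) = (\<Prod>v\<in>Poly_Mapping.keys m. \<gamma> (s v) ^ Poly_Mapping.lookup m v)"
      by (rule prod.cong) (use power sB in auto)
    ultimately show ?thesis by (simp add: power_prod_def)
  qed
  have "\<gamma> (subst_a s b) = (\<Sum>m\<in>Poly_Mapping.keys b. \<gamma> (const_a (Poly_Mapping.lookup b m) * power_prod s m))"
    unfolding subst_a_power_prod using sum pp by (simp add: B_mult const_a_in_B)
  also have "\<dots> = eval_a (\<lambda>v. \<gamma> (s v)) b"
    unfolding eval_a_def using pp by (intro sum.cong refl) (simp only: mult const const_a_in_B)
  finally show ?thesis .
qed

lemma single_power_prod: "Poly_Mapping.single m c = const_a c * power_prod var_a m"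
proof -
  have var: "var_a v ^ n = Poly_Mapping.single (Poly_Mapping.single v n) 1" for v n
    by (induction n) (simp_all add: var_a_def mult_single single_add[symmetric])
  have "(\<Prod>v\<in>A. Poly_Mapping.single (f v) 1 :: poly_a) = Poly_Mapping.single (\<Sum>v\<in>A. f v) 1" if "finite A"
    for A :: "(nat \<times> nat) set" and f
    using that by (induction A rule: finite_induct) (simp_all add: mult_single)
  then have "power_prod var_a m = Poly_Mapping.single (\<Sum>v\<in>Poly_Mapping.keys m. Poly_Mapping.single v (Poly_Mapping.lookup m v)) 1"
    by (simp add: power_prod_def var)
  also have "(\<Sum>v\<in>Poly_Mapping.keys m. Poly_Mapping.single v (Poly_Mapping.lookup m v)) = m"
    by (rule poly_mapping_eqI) (simp add: lookup_sum lookup_single when_def in_keys_iff)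
  finally show ?thesis by (simp add: const_a_def mult_single)
qed

lemma subst_a_var: "subst_a var_a b = b"
  unfolding subst_a_power_prod single_power_prod[symmetric] by (rule poly_a_expand[symmetric])

lemma chom_pcompose: "chom (\<lambda>p. pcompose p q)"
  by (rule chomI) (simp_all add: pcompose_add pcompose_mult cst_poly_def)

lemma pcompose_eval_a: "pcompose (eval_a a b) q = eval_a (\<lambda>v. pcompose (a v) q) b"
proof -
  have "pcompose [:c:] q = [:c:]" for c by simp
  then show ?thesis
    by (simp only: eval_a_def power_prod_def chom_simps[OF chom_pcompose])
qed

lemma eval_a_cong:
  assumes "b \<in> B k l" "\<And>v. v \<in> idx k l \<Longrightarrow> q dvd a v - a' v"
  shows "q dvd eval_a a b - eval_a a' b"
proof -
  have prod: "q dvd (\<Prod>v\<in>A. a v ^ n v) - (\<Prod>v\<in>A. a' v ^ n v)" if "finite A" "A \<subseteq> idx k l" for A n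
    using that by (induction A rule: finite_induct) (simp_all add: assms(2) dvd_diff_mult dvd_diff_power)
  show ?thesis
    unfolding eval_a_def sum_subtractf[symmetric] power_prod_def
    using assms(1) by (intro dvd_sum dvd_diff_mult prod) (auto simp: B_def)
qed

lemma proj_trunc_eq_iff: "proj_trunc d p = proj_trunc d q \<longleftrightarrow> monom 1 d dvd p - q"
proof
  assume "proj_trunc d p = proj_trunc d q"
  moreover have "p \<in> proj_trunc d p" by (simp add: proj_trunc_def)
  ultimately show "monom 1 d dvd p - q" by (simp add: proj_trunc_def)
next
  assume h: "monom 1 d dvd p - q"
  have h': "monom 1 d dvd q - p" using h by (simp add: dvd_diff_commute)
  show "proj_trunc d p = proj_trunc d q"
    unfolding proj_trunc_def using dvd_diff_trans[OF _ h] dvd_diff_trans[OF _ h'] by blast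
qed

text \<open>With weights l for z and k for t, this is the weighted degree of z^i t^j minus that of
  r.\<close>

definition wt :: "nat \<Rightarrow> nat \<Rightarrow> nat \<times> nat \<Rightarrow> int" where
  "wt k l v = int l * int (fst v) + int k * int (snd v) - int k * int l"

text \<open>Two homomorphisms on B agree modulo x^d as soon as they do so on the
  indeterminates.\<close>

lemma trunc_condition_iff:
  assumes \<alpha>: "alg_hom_B k l \<alpha>" and \<beta>: "alg_hom_B k l \<beta>" and \<mu>: "\<mu> \<noteq> 0"
  shows "(\<forall>b\<in>B k l. scale_trunc \<mu> (proj_trunc d (\<alpha> b)) = proj_trunc d (\<beta> (zeta k l lam b))) \<longleftrightarrow>
    (\<forall>v\<in>idx k l. monom 1 d dvd pcompose (\<alpha> (var_a v)) [:0, \<mu>:] - [:lam powi wt k l v:] * \<beta> (var_a v))"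
proof -
  define s where "s v = const_a (lam powi wt k l v) * var_a v" for v
  have z: "zeta k l lam = subst_a s"
    unfolding zeta_def s_def wt_def by (rule arg_cong[of _ _ subst_a]) (auto simp: fun_eq_iff)
  have sB: "s v \<in> B k l" if "v \<in> idx k l" for v
    unfolding s_def by (intro B_mult const_a_in_B var_a_in_B that)
  have s\<beta>: "\<beta> (s v) = [:lam powi wt k l v:] * \<beta> (var_a v)" if "v \<in> idx k l" for v
    using \<beta> const_a_in_B var_a_in_B[OF that] by (simp add: alg_hom_B_def s_def)
  have a: "\<alpha> b = eval_a (\<lambda>v. \<alpha> (var_a v)) b" if "b \<in> B k l" for b
    using alg_hom_subst_a[where s = var_a, OF \<alpha> var_a_in_B that] by (simp add: subst_a_var)
  have b: "\<beta> (subst_a s b) = eval_a (\<lambda>v. \<beta> (s v)) b" if "b \<in> B k l" for b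
    by (rule alg_hom_subst_a[OF \<beta> sB that])
  have st: "scale_trunc \<mu> (proj_trunc d p) = proj_trunc d q \<longleftrightarrow> monom 1 d dvd pcompose p [:0, \<mu>:] - q" for p q
    unfolding scale_proj_trunc[OF \<mu>] proj_trunc_eq_iff ..
  show ?thesis
    unfolding st z
  proof (intro iffI ballI)
    fix v assume h: "\<forall>b\<in>B k l. monom 1 d dvd pcompose (\<alpha> b) [:0, \<mu>:] - \<beta> (subst_a s b)" and v: "v \<in> idx k l"
    show "monom 1 d dvd pcompose (\<alpha> (var_a v)) [:0, \<mu>:] - [:lam powi wt k l v:] * \<beta> (var_a v)"
      using h[rule_format, OF var_a_in_B[OF v]] unfolding b[OF var_a_in_B[OF v]] eval_a_var s\<beta>[OF v] .
  next
    fix p assume h: "\<forall>v\<in>idx k l. monom 1 d dvd pcompose (\<alpha> (var_a v)) [:0, \<mu>:] - [:lam powi wt k l v:] * \<beta> (var_a v)"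
      and p: "p \<in> B k l"
    show "monom 1 d dvd pcompose (\<alpha> p) [:0, \<mu>:] - \<beta> (subst_a s p)"
      unfolding a[OF p] b[OF p] pcompose_eval_a by (rule eval_a_cong[OF p]) (simp only: s\<beta> h)
  qed
qed

theorem every_hypersurface:
  assumes "k \<ge> 2" "l \<ge> 2" "d \<ge> 1"
  shows "\<exists>\<alpha>. centered_hom k l \<alpha> \<and> isomorphic_varieties (hypersurface d k l g) (threefold d k l \<alpha>)"
proof -
  obtain a where a: "\<And>v. coeff (a v) 0 = 0" "isomorphic_varieties (VF d (FX k l g)) (VF d (FS k l a))"
    using normal_form_exists[OF assms(1,2) coeff_FX_0 assms(3)] by blast
  have c: "centered_hom k l (eval_a a)" by (rule centered_hom_eval_a[OF a(1)])
  show ?thesis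
    using a(2) c unfolding hypersurface_VF by (intro exI[of _ "eval_a a"]) (simp add: threefold_VF[OF c] eval_a_var)
qed

section \<open>Isomorphic threefolds\<close>

lemma E1_scale: "E1 (cst \<mu> * x) c = E1 x (pcompose c [:0, \<mu>:])"
proof -
  have "chom (\<lambda>c. E1 x (pcompose c [:0, \<mu>:]))" by (rule chom_comp[OF chom_E1 chom_pcompose])
  from chom_E1_eq[OF this, of c] have "E1 x (pcompose c [:0, \<mu>:]) = E1 (E1 x (pcompose [:0,1:] [:0, \<mu>:])) c" .
  moreover have "pcompose [:0,1:] [:0, \<mu>:] = [:\<mu>:] * [:0,1:]" by (simp add: pcompose_pCons)
  ultimately show ?thesis by (simp only: E1_hom E_simps)
qed

lemma Fg_scale: "Fg k l a (cst \<mu> * x) Z T = Fg k l (\<lambda>v. pcompose (a v) [:0, \<mu>:]) x Z T"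
  by (simp only: Fg_def E1_scale)

lemma Fg_torus:
  assumes c: "c \<noteq> 0"
  shows "Fg k l a x (cst (c ^ l) * Z) (cst (c ^ k) * T) = cst (c ^ (k * l)) * Fg k l (\<lambda>v. [:c powi wt k l v:] * a v) x Z T"
proof -
  have p: "(c ^ l) ^ i * (c ^ k) ^ j = c ^ (k * l) * c powi wt k l (i, j)" for i j
  proof -
    have "c powi (int (l * i + k * j)) = c powi (int (k * l) + wt k l (i, j))" by (simp add: wt_def)
    then show ?thesis
      unfolding power_int_add[OF disjI1[OF c]] by (simp only: power_int_of_nat power_add power_mult)
  qed
  have "E1 x b * ((cst (c ^ l) * Z) ^ i * (cst (c ^ k) * T) ^ j) = cst (c ^ (k * l)) * (E1 x ([:c powi wt k l (i, j):] * b) * (Z ^ i * T ^ j))" for b i j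
  proof -
    have "(cst (c ^ l) * Z) ^ i * (cst (c ^ k) * T) ^ j = cst ((c ^ l) ^ i * (c ^ k) ^ j) * (Z ^ i * T ^ j)"
      by (simp only: power_mult_distrib cst_mult cst_power ac_simps)
    then show ?thesis unfolding p by (simp only: E1_hom E_simps cst_mult ac_simps)
  qed
  moreover have "(cst (c ^ l) * Z) ^ k = cst (c ^ (k * l)) * Z ^ k" "(cst (c ^ k) * T) ^ l = cst (c ^ (k * l)) * T ^ l"
    by (simp_all add: power_mult_distrib cst_power power_mult mult.commute flip: power_mult)
  ultimately show ?thesis
    by (simp add: Fg_def distrib_left sum_distrib_left del: mult_pCons_left)
qed

lemma Fg_const:
  "xS ^ d dvd FS k l a - FS k l b" if "\<And>v i. v \<in> idx k l \<Longrightarrow> i < d \<Longrightarrow> coeff (a v) i = coeff (b v) i"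
  unfolding xS_dvd_iff using that by (simp add: coeff_FS)

lemma torus_iso:
  assumes \<mu>: "\<mu> \<noteq> 0" and lam: "lam \<noteq> 0"
    and ab: "\<And>v i. v \<in> idx k l \<Longrightarrow> i < d \<Longrightarrow> \<mu> ^ i * coeff (a v) i = lam powi wt k l v * coeff (b v) i"
  shows "isomorphic_varieties (VF d (FS k l a)) (VF d (FS k l b))"
proof -
  \<comment> \<open>By \<open>Fg_torus\<close> the coefficients of a are multiplied by c to the
    weight; for b to result modulo x^d, c has to be the inverse of \<open>lam\<close>.\<close>
  define c where "c = inverse lam"
  have c: "c \<noteq> 0" using lam by (simp add: c_def)
  define a' where "a' v = [:c powi wt k l v:] * pcompose (a v) [:0, \<mu>:]" for v
  have "coeff (a' v) i = coeff (b v) i" if "v \<in> idx k l" "i < d" for v i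
  proof -
    have "coeff (a' v) i = c powi wt k l v * (\<mu> ^ i * coeff (a v) i)" by (simp add: a'_def coeff_pcompose_linear)
    also have "\<dots> = (c * lam) powi wt k l v * coeff (b v) i" unfolding ab[OF that] power_int_mult_distrib by (simp only: mult.assoc)
    finally show ?thesis using lam by (simp add: c_def)
  qed
  then have "xS ^ d dvd FS k l a' - FS k l b" by (rule Fg_const)
  then obtain e where e: "FS k l a' = FS k l b + xS ^ d * e" by (rule xS_dvd_E)
  have cc: "cst p * (cst (inverse p) * x) = x" "cst (inverse p) * (cst p * x) = x" if "p \<noteq> 0" for p and x :: S
    using cst_inverse_cancel[OF nonzero_imp_inverse_nonzero[OF that]] cst_inverse_cancel[OF that] by (simp_all only: inverse_inverse_eq)
  show ?thesis
  proof (rule isomorphic_sym, rule iso_VF[where Z = "cst (c ^ l) * zS" and T = "cst (c ^ k) * tS"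
        and Z' = "cst (inverse (c ^ l)) * zS" and T' = "cst (inverse (c ^ k)) * tS"])
    show "E3 (cst (c ^ l) * zS) (cst (c ^ k) * tS) (cst \<mu> * xS) (FS k l a)
        = cst (c ^ (k * l)) * FS k l b + xS ^ d * (cst (c ^ (k * l)) * e)"
      unfolding chom_Fg[OF chom_E3] E3_vars Fg_scale
      unfolding Fg_torus[OF c] a'_def[symmetric] e by (simp only: distrib_left ac_simps)
    show "cst (c ^ (k * l)) * cst (inverse (c ^ (k * l))) = 1 + xS ^ d * 0"
      using c by (simp add: cst_inverse)
  qed (use c in \<open>simp_all only: \<mu> E3_hom E3_vars cc power_not_zero not_False_eq_True\<close>)
qed

text \<open>With Bezout coefficients x k + y l = 1 the witness is c = q^x p^y; its powers are
  computed from p^k = q^l = C.\<close>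

lemma common_root:
  fixes p q :: complex
  assumes "coprime k l" and p: "p ^ k = C" and q: "q ^ l = C" and C: "C \<noteq> 0" and kl: "k > 0" "l > 0"
  obtains c where "c \<noteq> 0" "p = c ^ l" "q = c ^ k"
proof -
  obtain x y where xy: "x * int k + y * int l = 1"
    using bezout_int[of "int k" "int l"] assms(1) by auto
  have p0: "p \<noteq> 0" using p C kl by auto
  have q0: "q \<noteq> 0" using q C kl by auto
  have P: "p powi (int k * m) = C powi m" "q powi (int l * m) = C powi m" for m
    by (simp_all only: power_int_mult power_int_of_nat p q)
  have "(q powi x * p powi y) ^ l = q powi (int l * x) * p powi (int l * y)"
    by (simp only: power_mult_distrib power_int_power' mult.commute)
  also have "int l * y = 1 - int k * x" using xy by (simp add: algebra_simps)
  also have "q powi (int l * x) * p powi (1 - int k * x) = p"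
    using p0 C by (simp add: power_int_diff P)
  finally have 1: "p = (q powi x * p powi y) ^ l" ..
  have "(q powi x * p powi y) ^ k = q powi (int k * x) * p powi (int k * y)"
    by (simp only: power_mult_distrib power_int_power' mult.commute)
  also have "int k * x = 1 - int l * y" using xy by (simp add: algebra_simps)
  also have "q powi (1 - int l * y) * p powi (int k * y) = q"
    using q0 C by (simp add: power_int_diff P)
  finally have 2: "q = (q powi x * p powi y) ^ k" ..
  show thesis by (rule that[OF _ 1 2]) (simp add: p0 q0)
qed

lemma coeff_E3_0:
  fixes Z T x :: S
  assumes "coeff x 0 = 0"
  shows "coeff (E3 Z T x f) 0 = E2 (coeff Z 0) (coeff T 0) (coeff f 0)"
proof -
  have "chom (\<lambda>f :: S. coeff f 0)" by (rule chomI) (simp_all add: cst_poly_def[where 'a = bp] coeff_mult_0)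
  then have "coeff (E3 Z T x f) 0 = E3 (coeff Z 0) (coeff T 0) (coeff x 0) f" by (rule chom_E3_comp)
  then show ?thesis
    unfolding assms by (cases f) (simp add: E3_def lift_pCons chom_E2)
qed

text \<open>By the chain rule the Jacobian is a unit of \<complex>[x,z,t].\<close>

lemma jacobian_const:
  assumes Z': "E3 Z T (cst \<mu> * xS) Z' = zS" and T': "E3 Z T (cst \<mu> * xS) T' = tS"
  obtains J where "J \<noteq> 0" "pb Z T = cst J"
proof -
  let ?E = "E3 Z T (cst \<mu> * xS)"
  have z: "1 = ?E (Dz Z') * Dz Z + ?E (Dt Z') * Dz T" "0 = ?E (Dz Z') * Dt Z + ?E (Dt Z') * Dt T"
    using arg_cong[OF Z', of Dz] arg_cong[OF Z', of Dt] by (simp_all add: der_E3[OF der_Dz] der_E3[OF der_Dt] Dz_simps Dt_simps)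
  have t: "0 = ?E (Dz T') * Dz Z + ?E (Dt T') * Dz T" "1 = ?E (Dz T') * Dt Z + ?E (Dt T') * Dt T"
    using arg_cong[OF T', of Dz] arg_cong[OF T', of Dt] by (simp_all add: der_E3[OF der_Dz] der_E3[OF der_Dt] Dz_simps Dt_simps)
  have "pb Z T * (?E (Dz Z') * ?E (Dt T') - ?E (Dt Z') * ?E (Dz T'))
     = (?E (Dz Z') * Dz Z + ?E (Dt Z') * Dz T) * (?E (Dz T') * Dt Z + ?E (Dt T') * Dt T)
      - (?E (Dz Z') * Dt Z + ?E (Dt Z') * Dt T) * (?E (Dz T') * Dz Z + ?E (Dt T') * Dz T)"
    by (simp add: pb_def algebra_simps)
  also have "\<dots> = 1" unfolding z[symmetric] t[symmetric] by simp
  finally show thesis using unit_S that by blast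
qed

text \<open>Modulo x the isomorphism is (c^l z, c^k t), and x is scaled by \<mu>; both are absorbed
  into the coefficients b'. What remains is the identity modulo x with Jacobian 1, to which
  \<open>normal_form_unique\<close> applies.\<close>

lemma torus_necessary:
  assumes d: "d \<ge> 2" and kl: "k \<ge> 2" "l \<ge> 2" "coprime k l"
    and a: "\<And>v. v \<in> idx k l \<Longrightarrow> coeff (a v) 0 = 0" and b: "\<And>v. v \<in> idx k l \<Longrightarrow> coeff (b v) 0 = 0"
    and iso: "isomorphic_varieties (VF d (FS k l a)) (VF d (FS k l b))"
  shows "\<exists>lam \<mu>. lam \<noteq> 0 \<and> \<mu> \<noteq> 0 \<and>
    (\<forall>v\<in>idx k l. \<forall>i<d. \<mu> ^ i * coeff (a v) i = lam powi wt k l v * coeff (b v) i)"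
proof -
  let ?r = "cusp k l"
  have r: "?r \<noteq> 0" using kl by (simp add: cusp_neq_0)
  have 0: "coeff (FS k l a) 0 = ?r" "coeff (FS k l b) 0 = ?r"
    using a b by (simp_all add: coeff_FS)
  have d0: "d > 0" using d by simp
  have nz: "coeff (FS k l a) 0 \<noteq> 0" "coeff (FS k l b) 0 \<noteq> 0" using 0 r by simp_all
  have kl2: "\<not> (k = 2 \<and> l = 2)" using kl(3) by auto
  obtain h h' where hh: "A_hom (Aset d (FS k l b)) (Aset d (FS k l a)) h" "A_hom (Aset d (FS k l a)) (Aset d (FS k l b)) h'"
    "\<And>f. f \<in> Aset d (FS k l b) \<Longrightarrow> h' (h f) = f" "\<And>f. f \<in> Aset d (FS k l a) \<Longrightarrow> h (h' f) = f"
    by (rule pullback[OF d0 nz iso], rule that, assumption, assumption, simp_all only:)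
  have iso: "alg_iso d k l (FS k l a) (FS k l b) h h'" by (rule alg_iso.intro[OF d kl(1,2) kl2 0 hh])
  obtain \<mu> Z T Z' T' p q p' q' where \<mu>: "\<mu> \<noteq> 0"
    and rel: "E3 Z T (cst \<mu> * xS) (FS k l b) = xS ^ d * p + q * FS k l a"
    and rel': "E3 Z' T' (cst (inverse \<mu>) * xS) (FS k l a) = xS ^ d * p' + q' * FS k l b"
    and inv: "\<And>f. E3 Z T (cst \<mu> * xS) (E3 Z' T' (cst (inverse \<mu>) * xS) f) = f"
    by (rule alg_iso.iso_structure[OF iso, folded xS_def], rule that, assumption, assumption, assumption, simp only:)
  let ?Z = "coeff Z 0" and ?T = "coeff T 0" and ?Z' = "coeff Z' 0" and ?T' = "coeff T' 0"
  have x0: "coeff (cst c * xS) 0 = 0" for c by (simp add: xS_def)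
  have xd: "coeff (xS ^ d) 0 = 0" using d by (simp add: coeff_xS_power)
  have cusp: "E2 x y ?r = x ^ k + y ^ l" for x y :: bp by (simp add: cusp_def E2_hom)
  have rel0: "E2 ?Z ?T ?r = coeff q 0 * ?r"
    using arg_cong[OF rel, of "\<lambda>f. coeff f 0"] by (simp add: coeff_E3_0[OF x0] 0 xd coeff_mult_0)
  have rel0': "E2 ?Z' ?T' ?r = coeff q' 0 * ?r"
    using arg_cong[OF rel', of "\<lambda>f. coeff f 0"] by (simp add: coeff_E3_0[OF x0] 0 xd coeff_mult_0)
  have inv0: "E2 ?Z ?T (E2 ?Z' ?T' g) = g" for g
    using arg_cong[OF inv[of "[:g:]"], of "\<lambda>f. coeff f 0"] by (simp add: coeff_E3_0[OF x0] del: E_simps)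
  \<comment> \<open>Composing the relations of both directions modulo x shows that the factor of r
    is a unit, hence constant.\<close>
  have "?r = E2 ?Z ?T (coeff q' 0) * (coeff q 0 * ?r)"
    using inv0[of ?r] by (simp add: rel0' E2_hom rel0)
  then have "(coeff q 0 * E2 ?Z ?T (coeff q' 0)) * ?r = 1 * ?r" by (simp add: ac_simps)
  then have "coeff q 0 * E2 ?Z ?T (coeff q' 0) = 1" using r by (simp only: mult_cancel_right) simp
  then obtain C where C: "C \<noteq> 0" "coeff q 0 = cst C" by (rule unit_bp)
  obtain s t where st: "?Z = cst s * zv" "?T = cst t * tv" "s ^ k = C" "t ^ l = C"
    using torus[OF kl C(1), of ?Z ?T] inv0 rel0 unfolding cusp C(2) by metis
  obtain c where c: "c \<noteq> 0" "s = c ^ l" "t = c ^ k"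
    using common_root[OF kl(3) st(3,4) C(1)] kl by auto
  obtain J where J: "J \<noteq> 0" "pb Z T = cst J"
    using jacobian_const[of Z T \<mu>] inv[of zS] inv[of tS] by blast
  have D0: "coeff (Dz f) 0 = dz (coeff f 0)" "coeff (Dt f) 0 = dt (coeff f 0)" for f :: S
    by (simp_all add: coeff_Dz coeff_Dt)
  have "coeff (pb Z T) 0 = cst (s * t)"
    by (simp add: pb_def coeff_mult_0 D0 st dz_simps dt_simps cst_mult)
  then have Jst: "J = s * t" by (simp add: J cst_poly_def[where 'a = bp])
  have st0: "s \<noteq> 0" "t \<noteq> 0" using c by simp_all
  define Zn where "Zn = cst (inverse s) * Z"
  define Tn where "Tn = cst (inverse t) * T"
  have Zn: "Z = cst (c ^ l) * Zn" "T = cst (c ^ k) * Tn"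
    using cst_inverse_cancel[of "inverse s" Z] cst_inverse_cancel[of "inverse t" T] st0 by (simp_all add: Zn_def Tn_def c)
  define b' where "b' v = [:c powi wt k l v:] * pcompose (b v) [:0, \<mu>:]" for v
  define H where "H = cst (inverse (c ^ (k * l))) * q"
  have "cst (c ^ (k * l)) * Fg k l b' xS Zn Tn = xS ^ d * p + q * FS k l a"
    using rel unfolding chom_Fg[OF chom_E3] E3_vars Fg_scale unfolding Zn Fg_torus[OF c(1)] b'_def .
  then have "cst (inverse (c ^ (k * l))) * (cst (c ^ (k * l)) * Fg k l b' xS Zn Tn)
      = cst (inverse (c ^ (k * l))) * (xS ^ d * p + q * FS k l a)" by (rule arg_cong)
  then have relF: "Fg k l b' xS Zn Tn = xS ^ d * (cst (inverse (c ^ (k * l))) * p) + H * FS k l a"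
    unfolding cst_inverse_cancel[OF power_not_zero[OF c(1)]] by (simp only: H_def distrib_left ac_simps)
  have "pb Zn Tn = cst (inverse s * (inverse t * (s * t)))" by (simp add: Zn_def Tn_def pb_cst J Jst flip: cst_mult)
  also have "inverse s * (inverse t * (s * t)) = 1" using st0 by (simp add: field_simps)
  finally have pb1: "pb Zn Tn = 1" by simp
  have co: "coeff (cst e * f) 0 = cst e * coeff f 0" for e and f :: S
    by (simp add: cst_poly_def[where 'a = bp])
  have eq: "coeff (a v) i = coeff (b' v) i" if "v \<in> idx k l" "i < d" for v i
  proof (rule normal_form_unique[OF kl _ a _ _ _ _ _ that])
    show "d \<ge> 1" using d by simp
    show "coeff (b' v) 0 = 0" if "v \<in> idx k l" for v using b[OF that] by (simp add: b'_def poly_0_coeff_0)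
    show "coeff Zn 0 = zv" "coeff Tn 0 = tv"
      using st0 by (simp_all only: Zn_def Tn_def co st cst_inverse_cancel not_False_eq_True)
    show "xS ^ d dvd pb Zn Tn - 1" by (simp add: pb1)
    show "xS ^ d dvd Fg k l b' xS Zn Tn - H * FS k l a" by (simp add: relF)
  qed
  \<comment> \<open>The pullback scales x in b while the claim scales it in a; hence the inverse of
    \<mu>.\<close>
  have "inverse \<mu> ^ i * coeff (a v) i = c powi wt k l v * coeff (b v) i" if "v \<in> idx k l" "i < d" for v i
    unfolding eq[OF that] b'_def using \<mu> by (simp add: coeff_pcompose_linear field_simps)
  then show ?thesis using c(1) \<mu> by (intro exI[of _ c] exI[of _ "inverse \<mu>"]) simp
qed

theorem theorem4p2:
  fixes d k l :: nat
  assumes "d \<ge> 2" and "k \<ge> 2" and "l \<ge> 2" and "coprime k l"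
  shows "(\<forall>g :: poly_xzt. \<exists>\<alpha>. centered_hom k l \<alpha> \<and>
            isomorphic_varieties (hypersurface d k l g) (threefold d k l \<alpha>)) \<and>
         (\<forall>\<alpha> \<beta>. centered_hom k l \<alpha> \<longrightarrow> centered_hom k l \<beta> \<longrightarrow>
            (isomorphic_varieties (threefold d k l \<alpha>) (threefold d k l \<beta>) \<longleftrightarrow>
             (\<exists>lam \<mu> :: complex. lam \<noteq> 0 \<and> \<mu> \<noteq> 0 \<and>
               (\<forall>b\<in>B k l. scale_trunc \<mu> (proj_trunc d (\<alpha> b)) =
                          proj_trunc d (\<beta> (zeta k l lam b))))))"
proof (intro conjI allI impI)
  show "\<exists>\<alpha>. centered_hom k l \<alpha> \<and> isomorphic_varieties (hypersurface d k l g) (threefold d k l \<alpha>)" for g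
    using assms by (intro every_hypersurface) auto
next
  fix \<alpha> \<beta> assume \<alpha>: "centered_hom k l \<alpha>" and \<beta>: "centered_hom k l \<beta>"
  let ?a = "\<lambda>v. \<alpha> (var_a v)" and ?b = "\<lambda>v. \<beta> (var_a v)"
  have cond: "(\<forall>b\<in>B k l. scale_trunc \<mu> (proj_trunc d (\<alpha> b)) = proj_trunc d (\<beta> (zeta k l lam b))) \<longleftrightarrow>
      (\<forall>v\<in>idx k l. \<forall>i<d. \<mu> ^ i * coeff (?a v) i = lam powi wt k l v * coeff (?b v) i)" if "\<mu> \<noteq> 0" for lam \<mu>
    using trunc_condition_iff[OF _ _ that, of k l \<alpha> \<beta>] \<alpha> \<beta>
    by (simp add: centered_hom_def monom_1_dvd_iff' coeff_pcompose_linear)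
  have "isomorphic_varieties (VF d (FS k l ?a)) (VF d (FS k l ?b)) \<longleftrightarrow> (\<exists>lam \<mu>. lam \<noteq> 0 \<and> \<mu> \<noteq> 0 \<and>
      (\<forall>v\<in>idx k l. \<forall>i<d. \<mu> ^ i * coeff (?a v) i = lam powi wt k l v * coeff (?b v) i))"
  proof
    show "isomorphic_varieties (VF d (FS k l ?a)) (VF d (FS k l ?b)) \<Longrightarrow> \<exists>lam \<mu>. lam \<noteq> 0 \<and> \<mu> \<noteq> 0 \<and>
        (\<forall>v\<in>idx k l. \<forall>i<d. \<mu> ^ i * coeff (?a v) i = lam powi wt k l v * coeff (?b v) i)"
      by (rule torus_necessary[OF assms centered_hom_coeff_0[OF \<alpha>] centered_hom_coeff_0[OF \<beta>]])
  next
    assume "\<exists>lam \<mu>. lam \<noteq> 0 \<and> \<mu> \<noteq> 0 \<and> (\<forall>v\<in>idx k l. \<forall>i<d. \<mu> ^ i * coeff (?a v) i = lam powi wt k l v * coeff (?b v) i)"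
    then obtain lam \<mu> where nz: "\<mu> \<noteq> 0" "lam \<noteq> 0"
      and h: "\<forall>v\<in>idx k l. \<forall>i<d. \<mu> ^ i * coeff (?a v) i = lam powi wt k l v * coeff (?b v) i" by blast
    show "isomorphic_varieties (VF d (FS k l ?a)) (VF d (FS k l ?b))" by (rule torus_iso[OF nz]) (use h in blast)
  qed
  then show "isomorphic_varieties (threefold d k l \<alpha>) (threefold d k l \<beta>) \<longleftrightarrow>
     (\<exists>lam \<mu> :: complex. lam \<noteq> 0 \<and> \<mu> \<noteq> 0 \<and> (\<forall>b\<in>B k l. scale_trunc \<mu> (proj_trunc d (\<alpha> b)) = proj_trunc d (\<beta> (zeta k l lam b))))"
    unfolding threefold_VF[OF \<alpha>] threefold_VF[OF \<beta>] by (simp only: cond not_False_eq_True cong: conj_cong)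
qed

end
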